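(* Let $\mathcal S$ be a deformation stack and let $A'\to A$ be a small extension in $\mathrm{Art}(\Lambda,k)$ with kernel $I$. (1) The addition law $+_{k[I],I}$ gives canonical abelian group structures to $T_I$ and $A_I$, with the addition on the latter agreeing with composition. These addition laws are functorial under linear maps $I\to J$ (of finite-dimensional $k$-vector spaces). (2) If we fix $\eta\in\mathcal S_A$, the addition law $+_{A',I}$ induces a canonical action of $T_I$ on $T_{\eta,A'}$, making $T_{\eta,A'}$ into a pseudotorsor for $T_I$. (3) Fixing $\eta'\in\mathcal S_{A'}$, the addition law $+_{A',I}$ induces a canonical group isomorphism $A_I\to A_{\mathrm{id},\eta'}$. Therefore, for any $\varphi\in\mathrm{Aut}(\eta'|_A)$, we have a canonical action of $A_I$ on $A_{\varphi,\eta'}$, making $A_{\varphi,\eta'}$ a pseudotorsor for $A_I$. (4) Both pseudotorsor structures are functorial in the following sense: given another small extension $B'\to B$ with kernel $J$, and a homomorphism $A'\to B'$ which induces a map $I\to J$ and therefore $A\to B$, the additive structures commute with the induced restriction maps.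
   Context: Conventions. $k$ is a field, $\Lambda$ a complete Noetherian local ring with residue field $k$, and $\mathrm{Art}(\Lambda,k)$ the category of local Artin $\Lambda$-algebras with residue field $k$; $\pi:A\to k$ is the residue map. All categories are small. For a finite-dimensional $k$-vector space $V$, $k[V]=k\oplus V$ with $V\cdot V=0$, a $\Lambda$-algebra via $\Lambda\to k$. A surjection $A'\to A$ in $\mathrm{Art}(\Lambda,k)$ with kernel $I$ is a small extension if $I\cdot\mathfrak m_{A'}=0$ (so $I$ is a finite-dimensional $k$-vector space). A set is a pseudotorsor over a group $G$ if it is empty or a $G$-torsor. Categories fibered in groupoids. A category fibered in groupoids over $C$ is a category $\mathcal S$ with a functor to $C$ such that (i) for every $T\to T'$ in $C$ and $\eta'$ over $T'$ there are $\eta$ over $T$ and a morphism $\eta\to\eta'$ over $T\to T'$ (a pullback, unique up to unique isomorphism); (ii) given $T\to T'\to T''$, a morphism $\eta\to\eta''$ over the composite and $\eta'\to\eta''$ over $T'\to T''$, there is a unique $\eta\to\eta'$ over $T\to T'$ making the triangle commute. $\mathcal S_T$ is the groupoid of objects over $T$ and morphisms over $\mathrm{id}_T$; $\mathrm{Mor}$, $\mathrm{Aut}$ are taken in such fibers; morphisms in fibers can also be pulled back. Over $C=\mathrm{Art}(\Lambda,k)^{\mathrm{opp}}$ we speak in terms of ring maps: for $f:A\to A'$ and $\eta\in\mathcal S_A$ the pullback is written $f_*\eta$ or $\eta|_{A'}$ and comes with a morphism $f_*\eta\to\eta$; thus a morphism in $\mathcal S$ lying over a ring map $A'\to A$ goes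 from an object over $A$ to an object over $A'$. Deformation stack. A category $\mathcal S$ fibered in groupoids over $\mathrm{Art}(\Lambda,k)^{\mathrm{opp}}$ is a deformation stack if $\mathcal S_k$ is the trivial groupoid (exactly one morphism between any two objects; an object $\zeta_0$ is fixed), and for all $A'\to A$, $A''\to A$ with $A''\to A$ surjective: (i) for $\eta,\eta'\in\mathcal S_{A'\times_AA''}$ the map $\mathrm{Mor}(\eta,\eta')\to\mathrm{Mor}(\eta|_{A'},\eta'|_{A'})\times_{\mathrm{Mor}(\eta|_A,\eta'|_A)}\mathrm{Mor}(\eta|_{A''},\eta'|_{A''})$ is bijective; (ii) for $\eta'\in\mathcal S_{A'}$, $\eta''\in\mathcal S_{A''}$ and $\varphi:\eta'|_A\to\eta''|_A$ over $\mathrm{id}_A$ there is $\tilde\eta\in\mathcal S_{A'\times_AA''}$ with $\eta'=\tilde\eta|_{A'}$, $\eta''=\tilde\eta|_{A''}$ and $\varphi$ the unique isomorphism identifying $\eta'|_A$ and $\eta''|_A$ as restrictions of $\tilde\eta$. $\zeta_I\in\mathcal S_{k[I]}$ denotes a pushforward of $\zeta_0$ under $k\to k[I]$. Notation. $T_I$ is the set of isomorphism classes of $\mathcal S_{k[I]}$ and $A_I=\mathrm{Aut}(\zeta_I)$. For $\eta\in\mathcal S_A$, $T_{\eta,A'}$ is the set of pairs $(\eta',\varphi)$ with $\eta'\in\mathcal S_{A'}$ and $\varphi:\eta\to\eta'$ lying over $A'\to A$, up to isomorphisms applied simultaneously to $\eta'$ and $\varphi$. For $\eta'\in\mathcal S_{A'}$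 and $\varphi\in\mathrm{Aut}(\eta'|_A)$, $A_{\varphi,\eta'}=\{\varphi'\in\mathrm{Aut}(\eta'):\varphi'|_A=\varphi\}$. Addition laws. For $\eta_1\in\mathcal S_{A'}$, $\eta_2\in\mathcal S_{k[I]}$ let $\eta_1\ast\eta_2\in\mathcal S_{A'\times_kk[I]}$ be an object with morphisms from $\eta_1,\eta_2$ lying over the two projections (unique up to unique isomorphism by the deformation stack axioms); for morphisms $f_i:\eta_i\to\mu_i$ in the fibers let $f_1\ast f_2:\eta_1\ast\eta_2\to\mu_1\ast\mu_2$ be the unique morphism over the identity restricting to $f_1,f_2$. Let $\sigma:A'\times_kk[I]\to A'$, $(x,\pi(x)+i)\mapsto x+i$. Then $+_{A',I}:\mathcal S_{A'}\times\mathcal S_{k[I]}\to\mathcal S_{A'}$ is $\eta_1+\eta_2=\sigma_*(\eta_1\ast\eta_2)$ (a chosen pushforward), $f_1+f_2=\sigma_*(f_1\ast f_2)$; $+_{k[I],I}$ is the case $A'=k[I]$, $A=k$. Choices are made so that $-+\zeta_I$ is the identity functor and $+_{k[I],I}$ is commutative; different choices differ by unique isomorphisms of functors. On $T_I$ the operation is the induced one on isomorphism classes, and on $A_I$ it is addition of morphisms (with $\zeta_I+\zeta_I=\zeta_I$). On $T_{\eta,A'}$, $(\eta'_1,\varphi_1)+\eta_2=(\eta'_1+\eta_2,\varphi_{12})$, where $\varphi_{12}:\eta\to\eta'_1+\eta_2$ over $A'\to A$ is the unique morphism whose composite with $\eta'_1+\eta_2\to\eta'_1\ast\eta_2$ (over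 $\sigma$) equals the composite $\eta\to\eta'_1\to\eta'_1\ast\eta_2$ of $\varphi_1$ with the morphism over the first projection. The map $A_I\to A_{\mathrm{id},\eta'}$ is $\alpha\mapsto\mathrm{id}_{\eta'}+\alpha$. *)

theory Defs
  imports "HOL-Algebra.Algebra"
begin

section \<open>Categories and categories fibered in groupoids\<close>

record ('o, 'm) cat =
  Obj :: "'o set"
  Arr :: "'m set"
  Dom :: "'m \<Rightarrow> 'o"
  Cod :: "'m \<Rightarrow> 'o"
  Ident :: "'o \<Rightarrow> 'm"
  Comp :: "'m \<Rightarrow> 'm \<Rightarrow> 'm"  \<comment> \<open>\<open>Comp C g f\<close> is \<open>g\<close> after \<open>f\<close>\<close>

definition Homs :: "('o, 'm, 'x) cat_scheme \<Rightarrow> 'o \<Rightarrow> 'o \<Rightarrow> 'm set" where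
  "Homs C x y = {m \<in> Arr C. Dom C m = x \<and> Cod C m = y}"

locale category =
  fixes C :: "('o, 'm, 'x) cat_scheme"
  assumes dom_closed: "m \<in> Arr C \<Longrightarrow> Dom C m \<in> Obj C"
    and cod_closed: "m \<in> Arr C \<Longrightarrow> Cod C m \<in> Obj C"
    and ident_closed: "x \<in> Obj C \<Longrightarrow> Ident C x \<in> Homs C x x"
    and comp_closed: "f \<in> Homs C x y \<Longrightarrow> g \<in> Homs C y z \<Longrightarrow> Comp C g f \<in> Homs C x z"
    and ident_left: "f \<in> Homs C x y \<Longrightarrow> Comp C (Ident C y) f = f"
    and ident_right: "f \<in> Homs C x y \<Longrightarrow> Comp C f (Ident C x) = f"
    and comp_assoc: "f \<in> Homs C w x \<Longrightarrow> g \<in> Homs C x y \<Longrightarrow> h \<in> Homs C y z \<Longrightarrow>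
      Comp C h (Comp C g f) = Comp C (Comp C h g) f"

definition opcat :: "('o, 'm) cat \<Rightarrow> ('o, 'm) cat" where
  "opcat C = \<lparr>Obj = Obj C, Arr = Arr C, Dom = Cod C, Cod = Dom C, Ident = Ident C,
    Comp = (\<lambda>g f. Comp C f g)\<rparr>"

text \<open>
  A category with a functor (\<open>proj_ob\<close>, \<open>proj_arr\<close>) to a base with objects \<open>'b\<close> and arrows
  \<open>'c\<close>, and a choice of pullbacks: \<open>pullback S f y\<close> is the chosen morphism
  from the pullback of \<open>y\<close> along \<open>f\<close> to \<open>y\<close>.  The field \<open>point\<close> is only
  used for deformation stacks, where it is the chosen object over the residue field.
\<close>

record ('o, 'm, 'b, 'c) fibered = "('o, 'm) cat" +
  proj_ob :: "'o \<Rightarrow> 'b"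
  proj_arr :: "'m \<Rightarrow> 'c"
  pullback :: "'c \<Rightarrow> 'o \<Rightarrow> 'm"
  point :: 'o

locale fibered_in_groupoids = S: category S + C: category C
  for S :: "('o, 'm, 'b, 'c) fibered" and C :: "('b, 'c) cat" +
  assumes proj_ob_closed: "x \<in> Obj S \<Longrightarrow> proj_ob S x \<in> Obj C"
    and proj_arr_closed: "m \<in> Homs S x y \<Longrightarrow> proj_arr S m \<in> Homs C (proj_ob S x) (proj_ob S y)"
    and proj_ident: "x \<in> Obj S \<Longrightarrow> proj_arr S (Ident S x) = Ident C (proj_ob S x)"
    and proj_comp: "m \<in> Homs S x y \<Longrightarrow> n \<in> Homs S y z \<Longrightarrow>
      proj_arr S (Comp S n m) = Comp C (proj_arr S n) (proj_arr S m)"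
    and pullback_ex: "f \<in> Arr C \<Longrightarrow> y \<in> Obj S \<Longrightarrow> proj_ob S y = Cod C f \<Longrightarrow>
      pullback S f y \<in> Arr S \<and> Cod S (pullback S f y) = y \<and> proj_arr S (pullback S f y) = f"
    and lift_unique: "f \<in> Homs C T T' \<Longrightarrow> g \<in> Homs C T' T'' \<Longrightarrow>
      h \<in> Homs S x z \<Longrightarrow> proj_arr S h = Comp C g f \<Longrightarrow>
      k \<in> Homs S y z \<Longrightarrow> proj_arr S k = g \<Longrightarrow>
      \<exists>!m. m \<in> Homs S x y \<and> proj_arr S m = f \<and> Comp S k m = h"


section \<open>Local Artin algebras with fixed residue field\<close>

definition local_ring :: "('a, 'x) ring_scheme \<Rightarrow> bool" where
  "local_ring R \<longleftrightarrow> cring R \<and> (\<exists>!M. maximalideal M R)"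

definition max_ideal :: "('a, 'x) ring_scheme \<Rightarrow> 'a set" where
  "max_ideal R = (THE M. maximalideal M R)"

definition artinian_ring :: "('a, 'x) ring_scheme \<Rightarrow> bool" where
  "artinian_ring R \<longleftrightarrow> ring R \<and>
    (\<forall>J :: nat \<Rightarrow> 'a set. (\<forall>n. ideal (J n) R \<and> J (Suc n) \<subseteq> J n) \<longrightarrow> (\<exists>n. \<forall>m\<ge>n. J m = J n))"

primrec ideal_power :: "('a, 'x) ring_scheme \<Rightarrow> 'a set \<Rightarrow> nat \<Rightarrow> 'a set" where
  "ideal_power R M 0 = carrier R"
| "ideal_power R M (Suc n) = ideal_prod R M (ideal_power R M n)"

text \<open>Bijectivity of the map from \<open>R\<close> to the limit of its quotients by the powers of the
  maximal ideal, with elements of the limit given by representatives.\<close>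

definition complete_local :: "('a, 'x) ring_scheme \<Rightarrow> bool" where
  "complete_local R \<longleftrightarrow>
    (\<forall>x :: nat \<Rightarrow> 'a. (\<forall>n. x n \<in> carrier R \<and> x (Suc n) \<ominus>\<^bsub>R\<^esub> x n \<in> ideal_power R (max_ideal R) n) \<longrightarrow>
      (\<exists>!y. y \<in> carrier R \<and> (\<forall>n. y \<ominus>\<^bsub>R\<^esub> x n \<in> ideal_power R (max_ideal R) n)))"

text \<open>
  An algebra over \<open>\<Lambda>\<close> (elements in \<open>'l\<close>) together with its map to the residue field.  The residue
  field itself is carried by an algebra \<open>K\<close> whose structure map is the reduction map of \<open>\<Lambda>\<close>.
\<close>

record ('l, 'r) alg = "'r ring" +
  str :: "'l \<Rightarrow> 'r"
  res :: "'r \<Rightarrow> 'r"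

record ('l, 'r) alg_arr =
  asrc :: "('l, 'r) alg"
  afun :: "'r \<Rightarrow> 'r"
  atgt :: "('l, 'r) alg"

definition coefficient_ring :: "'l ring \<Rightarrow> ('l, 'r) alg \<Rightarrow> bool" where
  "coefficient_ring \<Lambda> K \<longleftrightarrow>
    local_ring \<Lambda> \<and> noetherian_ring \<Lambda> \<and> complete_local \<Lambda> \<and>
    field K \<and> str K \<in> ring_hom \<Lambda> K \<and> str K ` carrier \<Lambda> = carrier K \<and>
    (\<forall>c\<in>carrier K. res K c = c)"

definition art_alg :: "'l ring \<Rightarrow> ('l, 'r) alg \<Rightarrow> ('l, 'r) alg \<Rightarrow> bool" where
  "art_alg \<Lambda> K A \<longleftrightarrow>
    local_ring A \<and> artinian_ring A \<and> str A \<in> ring_hom \<Lambda> A \<and>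
    res A \<in> ring_hom A K \<and> res A ` carrier A = carrier K \<and>
    (\<forall>l\<in>carrier \<Lambda>. res A (str A l) = str K l)"

definition alg_hom :: "'l ring \<Rightarrow> ('l, 'r) alg_arr \<Rightarrow> bool" where
  "alg_hom \<Lambda> c \<longleftrightarrow>
    afun c \<in> ring_hom (asrc c) (atgt c) \<and> afun c \<in> extensional (carrier (asrc c)) \<and>
    (\<forall>l\<in>carrier \<Lambda>. afun c (str (asrc c) l) = str (atgt c) l) \<and>
    (\<forall>x\<in>carrier (asrc c). res (atgt c) (afun c x) = res (asrc c) x)"

definition arr_id :: "('l, 'r) alg \<Rightarrow> ('l, 'r) alg_arr" where
  "arr_id A = \<lparr>asrc = A, afun = (\<lambda>x\<in>carrier A. x), atgt = A\<rparr>"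

definition arr_comp :: "('l, 'r) alg_arr \<Rightarrow> ('l, 'r) alg_arr \<Rightarrow> ('l, 'r) alg_arr" where
  "arr_comp d c = \<lparr>asrc = asrc c, afun = compose (carrier (asrc c)) (afun d) (afun c), atgt = atgt d\<rparr>"

text \<open>
  The category of local Artin \<open>\<Lambda>\<close>-algebras with residue field \<open>K\<close> whose elements lie in \<open>'r\<close>.
  When \<open>'r\<close> is infinite (and hence at least as large as each finite power of \<open>K\<close>),
  every such algebra is isomorphic to one of these.
\<close>

definition art :: "'l ring \<Rightarrow> ('l, 'r) alg \<Rightarrow> (('l, 'r) alg, ('l, 'r) alg_arr) cat" where
  "art \<Lambda> K = \<lparr>Obj = {A. art_alg \<Lambda> K A},
    Arr = {c. art_alg \<Lambda> K (asrc c) \<and> art_alg \<Lambda> K (atgt c) \<and> alg_hom \<Lambda> c},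
    Dom = asrc, Cod = atgt, Ident = arr_id, Comp = arr_comp\<rparr>"

definition arr_surj :: "('l, 'r) alg_arr \<Rightarrow> bool" where
  "arr_surj c \<longleftrightarrow> afun c ` carrier (asrc c) = carrier (atgt c)"

definition arr_ker :: "('l, 'r) alg_arr \<Rightarrow> 'r set" where
  "arr_ker c = a_kernel (asrc c) (atgt c) (afun c)"

definition res_arr :: "('l, 'r) alg \<Rightarrow> ('l, 'r) alg \<Rightarrow> ('l, 'r) alg_arr" where
  "res_arr K A = \<lparr>asrc = A, afun = restrict (res A) (carrier A), atgt = K\<rparr>"

text \<open>A coding of pairs, injective whenever \<open>'r\<close> is infinite.  It places fiber products and the
  algebras \<open>k[V]\<close> in the same universe.\<close>

definition enc :: "'r \<times> 'r \<Rightarrow> 'r" where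
  "enc = (SOME e. inj e)"

definition dec1 :: "'r \<Rightarrow> 'r" where
  "dec1 z = fst (inv_into UNIV enc z)"

definition dec2 :: "'r \<Rightarrow> 'r" where
  "dec2 z = snd (inv_into UNIV enc z)"

definition fprod :: "('l, 'r) alg_arr \<Rightarrow> ('l, 'r) alg_arr \<Rightarrow> ('l, 'r) alg" where
  "fprod c d =
    \<lparr>carrier = enc ` {(x, y). x \<in> carrier (asrc c) \<and> y \<in> carrier (asrc d) \<and> afun c x = afun d y},
     monoid.mult = (\<lambda>z w. enc (dec1 z \<otimes>\<^bsub>asrc c\<^esub> dec1 w, dec2 z \<otimes>\<^bsub>asrc d\<^esub> dec2 w)),
     monoid.one = enc (\<one>\<^bsub>asrc c\<^esub>, \<one>\<^bsub>asrc d\<^esub>),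
     ring.zero = enc (\<zero>\<^bsub>asrc c\<^esub>, \<zero>\<^bsub>asrc d\<^esub>),
     ring.add = (\<lambda>z w. enc (dec1 z \<oplus>\<^bsub>asrc c\<^esub> dec1 w, dec2 z \<oplus>\<^bsub>asrc d\<^esub> dec2 w)),
     str = (\<lambda>l. enc (str (asrc c) l, str (asrc d) l)),
     res = (\<lambda>z. res (asrc c) (dec1 z))\<rparr>"

definition fprod1 :: "('l, 'r) alg_arr \<Rightarrow> ('l, 'r) alg_arr \<Rightarrow> ('l, 'r) alg_arr" where
  "fprod1 c d = \<lparr>asrc = fprod c d, afun = restrict dec1 (carrier (fprod c d)), atgt = asrc c\<rparr>"

definition fprod2 :: "('l, 'r) alg_arr \<Rightarrow> ('l, 'r) alg_arr \<Rightarrow> ('l, 'r) alg_arr" where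
  "fprod2 c d = \<lparr>asrc = fprod c d, afun = restrict dec2 (carrier (fprod c d)), atgt = asrc d\<rparr>"


section \<open>Vector spaces and the algebras \<open>k[V]\<close>\<close>

definition fd_space :: "('l, 'r) alg \<Rightarrow> ('r, 'r) module \<Rightarrow> bool" where
  "fd_space K V \<longleftrightarrow> module K V \<and>
    (\<exists>B. finite B \<and> B \<subseteq> carrier V \<and>
      (\<forall>v\<in>carrier V. \<exists>a\<in>B \<rightarrow> carrier K. v = (\<Oplus>\<^bsub>V\<^esub>b\<in>B. a b \<odot>\<^bsub>V\<^esub> b)))"

definition linear_map :: "('l, 'r) alg \<Rightarrow> ('r, 'r) module \<Rightarrow> ('r, 'r) module \<Rightarrow> ('r \<Rightarrow> 'r) \<Rightarrow> bool" where
  "linear_map K V W \<psi> \<longleftrightarrow> \<psi> \<in> carrier V \<rightarrow> carrier W \<and>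
    (\<forall>x\<in>carrier V. \<forall>y\<in>carrier V. \<psi> (x \<oplus>\<^bsub>V\<^esub> y) = \<psi> x \<oplus>\<^bsub>W\<^esub> \<psi> y) \<and>
    (\<forall>a\<in>carrier K. \<forall>x\<in>carrier V. \<psi> (a \<odot>\<^bsub>V\<^esub> x) = a \<odot>\<^bsub>W\<^esub> \<psi> x)"

definition sqz :: "('l, 'r) alg \<Rightarrow> ('r, 'r) module \<Rightarrow> ('l, 'r) alg" where
  "sqz K V =
    \<lparr>carrier = enc ` (carrier K \<times> carrier V),
     monoid.mult = (\<lambda>z w. enc (dec1 z \<otimes>\<^bsub>K\<^esub> dec1 w, (dec1 z \<odot>\<^bsub>V\<^esub> dec2 w) \<oplus>\<^bsub>V\<^esub> (dec1 w \<odot>\<^bsub>V\<^esub> dec2 z))),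
     monoid.one = enc (\<one>\<^bsub>K\<^esub>, \<zero>\<^bsub>V\<^esub>),
     ring.zero = enc (\<zero>\<^bsub>K\<^esub>, \<zero>\<^bsub>V\<^esub>),
     ring.add = (\<lambda>z w. enc (dec1 z \<oplus>\<^bsub>K\<^esub> dec1 w, dec2 z \<oplus>\<^bsub>V\<^esub> dec2 w)),
     str = (\<lambda>l. enc (str K l, \<zero>\<^bsub>V\<^esub>)),
     res = dec1\<rparr>"

definition sqz_unit :: "('l, 'r) alg \<Rightarrow> ('r, 'r) module \<Rightarrow> ('l, 'r) alg_arr" where
  "sqz_unit K V = \<lparr>asrc = K, afun = (\<lambda>a\<in>carrier K. enc (a, \<zero>\<^bsub>V\<^esub>)), atgt = sqz K V\<rparr>"

definition sqz_map :: "('l, 'r) alg \<Rightarrow> ('r, 'r) module \<Rightarrow> ('r, 'r) module \<Rightarrow> ('r \<Rightarrow> 'r) \<Rightarrow> ('l, 'r) alg_arr" where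
  "sqz_map K V W \<psi> =
    \<lparr>asrc = sqz K V, afun = (\<lambda>z\<in>carrier (sqz K V). enc (dec1 z, \<psi> (dec2 z))), atgt = sqz K W\<rparr>"

definition small_extension :: "'l ring \<Rightarrow> ('l, 'r) alg \<Rightarrow> ('l, 'r) alg_arr \<Rightarrow> bool" where
  "small_extension \<Lambda> K c \<longleftrightarrow> c \<in> Arr (art \<Lambda> K) \<and> arr_surj c \<and>
    (\<forall>x\<in>arr_ker c. \<forall>y\<in>max_ideal (asrc c). x \<otimes>\<^bsub>asrc c\<^esub> y = \<zero>\<^bsub>asrc c\<^esub>)"

text \<open>The kernel of a small extension as a vector space: scalars act through any lift to the
  source.  The ring multiplication and unit are irrelevant fields of the module record.\<close>

definition ker_space :: "('l, 'r) alg_arr \<Rightarrow> ('r, 'r) module" where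
  "ker_space c =
    \<lparr>carrier = arr_ker c, monoid.mult = monoid.mult (asrc c), monoid.one = monoid.one (asrc c),
     ring.zero = ring.zero (asrc c), ring.add = ring.add (asrc c),
     smult = (\<lambda>a x. (SOME a'. a' \<in> carrier (asrc c) \<and> res (asrc c) a' = a) \<otimes>\<^bsub>asrc c\<^esub> x)\<rparr>"


section \<open>Restriction of objects and morphisms\<close>

type_synonym ('l, 'r, 'o, 'm) stack = "('o, 'm, ('l, 'r) alg, ('l, 'r) alg_arr) fibered"

text \<open>A morphism lying over the algebra map \<open>c\<close> goes from an object over \<open>atgt c\<close> to one over
  \<open>asrc c\<close>.\<close>

definition Fib :: "('l, 'r, 'o, 'm) stack \<Rightarrow> ('l, 'r) alg \<Rightarrow> 'o set" where
  "Fib S A = {x \<in> Obj S. proj_ob S x = A}"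

definition Over :: "('l, 'r, 'o, 'm) stack \<Rightarrow> ('l, 'r) alg_arr \<Rightarrow> 'o \<Rightarrow> 'o \<Rightarrow> 'm set" where
  "Over S c x y = {m \<in> Homs S x y. proj_arr S m = c}"

definition Mor :: "('l, 'r, 'o, 'm) stack \<Rightarrow> 'o \<Rightarrow> 'o \<Rightarrow> 'm set" where
  "Mor S x y = Over S (arr_id (proj_ob S x)) x y"

abbreviation Aut :: "('l, 'r, 'o, 'm) stack \<Rightarrow> 'o \<Rightarrow> 'm set" where
  "Aut S x \<equiv> Mor S x x"

definition factor_thru :: "('l, 'r, 'o, 'm) stack \<Rightarrow> ('l, 'r) alg_arr \<Rightarrow> 'm \<Rightarrow> 'm \<Rightarrow> 'm" where
  "factor_thru S c k h = (THE m. m \<in> Over S c (Dom S h) (Dom S k) \<and> Comp S k m = h)"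

text \<open>For \<open>u : x \<rightarrow> y\<close> and \<open>v : x' \<rightarrow> y'\<close> over the same algebra map and \<open>m : y \<rightarrow> y'\<close> in the fiber,
  the induced morphism \<open>x \<rightarrow> x'\<close>.\<close>

definition restr_along :: "('l, 'r, 'o, 'm) stack \<Rightarrow> 'm \<Rightarrow> 'm \<Rightarrow> 'm \<Rightarrow> 'm" where
  "restr_along S u v m = factor_thru S (arr_id (proj_ob S (Dom S u))) v (Comp S m u)"

definition restr_ob :: "('l, 'r, 'o, 'm) stack \<Rightarrow> ('l, 'r) alg_arr \<Rightarrow> 'o \<Rightarrow> 'o" where
  "restr_ob S c x = Dom S (pullback S c x)"

definition restr_mor :: "('l, 'r, 'o, 'm) stack \<Rightarrow> ('l, 'r) alg_arr \<Rightarrow> 'm \<Rightarrow> 'm" where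
  "restr_mor S c m = restr_along S (pullback S c (Dom S m)) (pullback S c (Cod S m)) m"

text \<open>For \<open>p : B \<rightarrow> A'\<close> and \<open>c : A' \<rightarrow> A\<close>, the map from morphisms between the restrictions of
  \<open>x\<close>, \<open>y\<close> to \<open>A'\<close> to morphisms between their restrictions to \<open>A\<close>, using the
  canonical morphism from the restriction to \<open>A\<close> to the restriction to \<open>A'\<close>.\<close>

definition restr_further ::
  "('l, 'r, 'o, 'm) stack \<Rightarrow> ('l, 'r) alg_arr \<Rightarrow> ('l, 'r) alg_arr \<Rightarrow> 'o \<Rightarrow> 'o \<Rightarrow> 'm \<Rightarrow> 'm" where
  "restr_further S p c x y m =
    restr_along S
      (factor_thru S c (pullback S p x) (pullback S (arr_comp c p) x))
      (factor_thru S c (pullback S p y) (pullback S (arr_comp c p) y)) m"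


section \<open>Deformation stacks\<close>

definition glues_morphisms ::
  "('l, 'r, 'o, 'm) stack \<Rightarrow> ('l, 'r) alg_arr \<Rightarrow> ('l, 'r) alg_arr \<Rightarrow> bool" where
  "glues_morphisms S c d \<longleftrightarrow>
    (\<forall>x\<in>Fib S (fprod c d). \<forall>y\<in>Fib S (fprod c d).
      bij_betw (\<lambda>m. (restr_mor S (fprod1 c d) m, restr_mor S (fprod2 c d) m))
        (Mor S x y)
        {(m', m''). m' \<in> Mor S (restr_ob S (fprod1 c d) x) (restr_ob S (fprod1 c d) y) \<and>
          m'' \<in> Mor S (restr_ob S (fprod2 c d) x) (restr_ob S (fprod2 c d) y) \<and>
          restr_further S (fprod1 c d) c x y m' = restr_further S (fprod2 c d) d x y m''})"

definition glues_objects ::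
  "('l, 'r, 'o, 'm) stack \<Rightarrow> ('l, 'r) alg_arr \<Rightarrow> ('l, 'r) alg_arr \<Rightarrow> bool" where
  "glues_objects S c d \<longleftrightarrow>
    (\<forall>x'\<in>Fib S (asrc c). \<forall>x''\<in>Fib S (asrc d). \<forall>\<phi>\<in>Mor S (restr_ob S c x') (restr_ob S d x'').
      \<exists>x\<in>Fib S (fprod c d). \<exists>u'\<in>Over S (fprod1 c d) x' x. \<exists>u''\<in>Over S (fprod2 c d) x'' x.
        Comp S u' (pullback S c x') = Comp S (Comp S u'' (pullback S d x'')) \<phi>)"

definition deformation_stack :: "'l ring \<Rightarrow> ('l, 'r) alg \<Rightarrow> ('l, 'r, 'o, 'm) stack \<Rightarrow> bool" where
  "deformation_stack \<Lambda> K S \<longleftrightarrow>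
    fibered_in_groupoids S (opcat (art \<Lambda> K)) \<and>
    point S \<in> Fib S K \<and>
    (\<forall>x\<in>Fib S K. \<forall>y\<in>Fib S K. \<exists>!m. m \<in> Mor S x y) \<and>
    (\<forall>c\<in>Arr (art \<Lambda> K). \<forall>d\<in>Arr (art \<Lambda> K). atgt c = atgt d \<longrightarrow> arr_surj d \<longrightarrow>
      glues_morphisms S c d \<and> glues_objects S c d)"

definition zeta :: "('l, 'r) alg \<Rightarrow> ('l, 'r, 'o, 'm) stack \<Rightarrow> ('r, 'r) module \<Rightarrow> 'o" where
  "zeta K S V = restr_ob S (sqz_unit K V) (point S)"


section \<open>Addition laws\<close>

text \<open>
  The choices entering an addition law: for \<open>x\<close>, \<open>y\<close> an object \<open>star_ob x y\<close> with its
  morphisms from \<open>x\<close> and \<open>y\<close>, and a pushforward \<open>sum_ob x y\<close> of it under \<open>\<sigma>\<close> with its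
  morphism to \<open>star_ob x y\<close>.
\<close>

record ('o, 'm) law =
  star_ob :: "'o \<Rightarrow> 'o \<Rightarrow> 'o"
  star1 :: "'o \<Rightarrow> 'o \<Rightarrow> 'm"
  star2 :: "'o \<Rightarrow> 'o \<Rightarrow> 'm"
  sum_ob :: "'o \<Rightarrow> 'o \<Rightarrow> 'o"
  sum_arr :: "'o \<Rightarrow> 'o \<Rightarrow> 'm"

definition star_mor :: "('l, 'r, 'o, 'm) stack \<Rightarrow> ('o, 'm) law \<Rightarrow> 'm \<Rightarrow> 'm \<Rightarrow> 'm" where
  "star_mor S L f1 f2 =
    (THE g. g \<in> Mor S (star_ob L (Dom S f1) (Dom S f2)) (star_ob L (Cod S f1) (Cod S f2)) \<and>
      Comp S g (star1 L (Dom S f1) (Dom S f2)) = Comp S (star1 L (Cod S f1) (Cod S f2)) f1 \<and>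
      Comp S g (star2 L (Dom S f1) (Dom S f2)) = Comp S (star2 L (Cod S f1) (Cod S f2)) f2)"

definition sum_mor :: "('l, 'r, 'o, 'm) stack \<Rightarrow> ('o, 'm) law \<Rightarrow> 'm \<Rightarrow> 'm \<Rightarrow> 'm" where
  "sum_mor S L f1 f2 =
    restr_along S (sum_arr L (Dom S f1) (Dom S f2)) (sum_arr L (Cod S f1) (Cod S f2))
      (star_mor S L f1 f2)"

text \<open>The map \<open>\<sigma> : (x, \<pi>(x) + v) \<mapsto> x + j v\<close>, where \<open>j\<close> identifies \<open>V\<close> with the kernel of a small
  extension of source \<open>A'\<close>.\<close>

definition sigma ::
  "('l, 'r) alg \<Rightarrow> ('l, 'r) alg \<Rightarrow> ('r, 'r) module \<Rightarrow> ('r \<Rightarrow> 'r) \<Rightarrow> ('l, 'r) alg_arr" where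
  "sigma K A' V j =
    (let B = fprod (res_arr K A') (res_arr K (sqz K V)) in
      \<lparr>asrc = B, afun = (\<lambda>z\<in>carrier B. dec1 z \<oplus>\<^bsub>A'\<^esub> j (dec2 (dec2 z))), atgt = A'\<rparr>)"

definition addition_law ::
  "('l, 'r) alg \<Rightarrow> ('l, 'r, 'o, 'm) stack \<Rightarrow> ('l, 'r) alg \<Rightarrow> ('r, 'r) module \<Rightarrow> ('r \<Rightarrow> 'r) \<Rightarrow>
    ('o, 'm) law \<Rightarrow> bool" where
  "addition_law K S A' V j L \<longleftrightarrow>
    (\<forall>x\<in>Fib S A'. \<forall>y\<in>Fib S (sqz K V).
      star_ob L x y \<in> Fib S (fprod (res_arr K A') (res_arr K (sqz K V))) \<and>
      star1 L x y \<in> Over S (fprod1 (res_arr K A') (res_arr K (sqz K V))) x (star_ob L x y) \<and>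
      star2 L x y \<in> Over S (fprod2 (res_arr K A') (res_arr K (sqz K V))) y (star_ob L x y) \<and>
      sum_arr L x y \<in> Over S (sigma K A' V j) (sum_ob L x y) (star_ob L x y)) \<and>
    (\<forall>x\<in>Fib S A'. sum_ob L x (zeta K S V) = x) \<and>
    (\<forall>x\<in>Fib S A'. \<forall>x'\<in>Fib S A'. \<forall>f\<in>Mor S x x'. sum_mor S L f (Ident S (zeta K S V)) = f)"

text \<open>The addition law for a small extension \<open>c\<close> and its kernel.\<close>

definition ext_law ::
  "('l, 'r) alg \<Rightarrow> ('l, 'r, 'o, 'm) stack \<Rightarrow> ('l, 'r) alg_arr \<Rightarrow> ('o, 'm) law \<Rightarrow> bool" where
  "ext_law K S c L \<longleftrightarrow> addition_law K S (asrc c) (ker_space c) (\<lambda>v. v) L"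

text \<open>The addition law for the small extension \<open>k[V] \<rightarrow> k\<close>.\<close>

definition sqz_law ::
  "('l, 'r) alg \<Rightarrow> ('l, 'r, 'o, 'm) stack \<Rightarrow> ('r, 'r) module \<Rightarrow> ('o, 'm) law \<Rightarrow> bool" where
  "sqz_law K S V L \<longleftrightarrow>
    addition_law K S (sqz K V) V (\<lambda>v. enc (\<zero>\<^bsub>K\<^esub>, v)) L \<and>
    (\<forall>x\<in>Fib S (sqz K V). \<forall>y\<in>Fib S (sqz K V). sum_ob L x y = sum_ob L y x) \<and>
    (\<forall>x\<in>Fib S (sqz K V). \<forall>x'\<in>Fib S (sqz K V). \<forall>y\<in>Fib S (sqz K V). \<forall>y'\<in>Fib S (sqz K V).
      \<forall>f\<in>Mor S x x'. \<forall>g\<in>Mor S y y'. sum_mor S L f g = sum_mor S L g f)"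


section \<open>The groups \<open>T\<close> and \<open>A\<close> of a vector space\<close>

definition iso_class :: "('l, 'r, 'o, 'm) stack \<Rightarrow> 'o \<Rightarrow> 'o set" where
  "iso_class S x = {y \<in> Obj S. Mor S x y \<noteq> {}}"

text \<open>Operations on classes are given as the union of the classes obtained from all
  representatives, which is a single class exactly when the operation is well defined.\<close>

definition T_group ::
  "('l, 'r) alg \<Rightarrow> ('l, 'r, 'o, 'm) stack \<Rightarrow> ('r, 'r) module \<Rightarrow> ('o, 'm) law \<Rightarrow> 'o set monoid" where
  "T_group K S V L =
    \<lparr>carrier = iso_class S ` Fib S (sqz K V),
     monoid.mult = (\<lambda>P Q. \<Union>x\<in>P. \<Union>y\<in>Q. iso_class S (sum_ob L x y)),
     monoid.one = iso_class S (zeta K S V)\<rparr>"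

definition A_group ::
  "('l, 'r) alg \<Rightarrow> ('l, 'r, 'o, 'm) stack \<Rightarrow> ('r, 'r) module \<Rightarrow> ('o, 'm) law \<Rightarrow> 'm monoid" where
  "A_group K S V L =
    \<lparr>carrier = Aut S (zeta K S V), monoid.mult = sum_mor S L, monoid.one = Ident S (zeta K S V)\<rparr>"

definition T_map ::
  "('l, 'r) alg \<Rightarrow> ('l, 'r, 'o, 'm) stack \<Rightarrow> ('r, 'r) module \<Rightarrow> ('r, 'r) module \<Rightarrow> ('r \<Rightarrow> 'r) \<Rightarrow>
    'o set \<Rightarrow> 'o set" where
  "T_map K S V W \<psi> P = (\<Union>x\<in>P. iso_class S (restr_ob S (sqz_map K V W \<psi>) x))"

text \<open>The morphism \<open>\<zeta>\<^sub>W \<rightarrow> \<zeta>\<^sub>V\<close> over \<open>k[V] \<rightarrow> k[W]\<close> compatible with the morphisms to \<open>\<zeta>\<^sub>0\<close>.\<close>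

definition zeta_arr ::
  "('l, 'r) alg \<Rightarrow> ('l, 'r, 'o, 'm) stack \<Rightarrow> ('r, 'r) module \<Rightarrow> ('r, 'r) module \<Rightarrow> ('r \<Rightarrow> 'r) \<Rightarrow> 'm" where
  "zeta_arr K S V W \<psi> =
    factor_thru S (sqz_map K V W \<psi>)
      (pullback S (sqz_unit K V) (point S)) (pullback S (sqz_unit K W) (point S))"

definition A_map ::
  "('l, 'r) alg \<Rightarrow> ('l, 'r, 'o, 'm) stack \<Rightarrow> ('r, 'r) module \<Rightarrow> ('r, 'r) module \<Rightarrow> ('r \<Rightarrow> 'r) \<Rightarrow>
    'm \<Rightarrow> 'm" where
  "A_map K S V W \<psi> \<alpha> = restr_along S (zeta_arr K S V W \<psi>) (zeta_arr K S V W \<psi>) \<alpha>"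


section \<open>Extensions of objects and of automorphisms\<close>

definition ext_pairs :: "('l, 'r, 'o, 'm) stack \<Rightarrow> ('l, 'r) alg_arr \<Rightarrow> 'o \<Rightarrow> ('o \<times> 'm) set" where
  "ext_pairs S c x = {(y, \<phi>). y \<in> Fib S (asrc c) \<and> \<phi> \<in> Over S c x y}"

definition ext_class ::
  "('l, 'r, 'o, 'm) stack \<Rightarrow> ('l, 'r) alg_arr \<Rightarrow> 'o \<Rightarrow> 'o \<times> 'm \<Rightarrow> ('o \<times> 'm) set" where
  "ext_class S c x p =
    {q \<in> ext_pairs S c x. \<exists>m\<in>Mor S (fst p) (fst q). Comp S m (snd p) = snd q}"

definition T_ext :: "('l, 'r, 'o, 'm) stack \<Rightarrow> ('l, 'r) alg_arr \<Rightarrow> 'o \<Rightarrow> ('o \<times> 'm) set set" where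
  "T_ext S c x = ext_class S c x ` ext_pairs S c x"

definition pair_sum ::
  "('l, 'r, 'o, 'm) stack \<Rightarrow> ('l, 'r) alg_arr \<Rightarrow> ('o, 'm) law \<Rightarrow> 'o \<times> 'm \<Rightarrow> 'o \<Rightarrow> 'o \<times> 'm" where
  "pair_sum S c L p y =
    (sum_ob L (fst p) y, factor_thru S c (sum_arr L (fst p) y) (Comp S (star1 L (fst p) y) (snd p)))"

definition T_act ::
  "('l, 'r, 'o, 'm) stack \<Rightarrow> ('l, 'r) alg_arr \<Rightarrow> ('o, 'm) law \<Rightarrow> 'o \<Rightarrow>
    'o set \<Rightarrow> ('o \<times> 'm) set \<Rightarrow> ('o \<times> 'm) set" where
  "T_act S c L x t = (\<lambda>P\<in>T_ext S c x. \<Union>p\<in>P. \<Union>y\<in>t. ext_class S c x (pair_sum S c L p y))"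

definition A_ext :: "('l, 'r, 'o, 'm) stack \<Rightarrow> ('l, 'r) alg_arr \<Rightarrow> 'o \<Rightarrow> 'm \<Rightarrow> 'm set" where
  "A_ext S c y \<phi> = {\<phi>' \<in> Aut S y. restr_mor S c \<phi>' = \<phi>}"

definition A_ext_id_group ::
  "('l, 'r, 'o, 'm) stack \<Rightarrow> ('l, 'r) alg_arr \<Rightarrow> 'o \<Rightarrow> 'm monoid" where
  "A_ext_id_group S c y =
    \<lparr>carrier = A_ext S c y (Ident S (restr_ob S c y)), monoid.mult = Comp S, monoid.one = Ident S y\<rparr>"

definition A_act ::
  "('l, 'r, 'o, 'm) stack \<Rightarrow> ('l, 'r) alg_arr \<Rightarrow> ('o, 'm) law \<Rightarrow> 'o \<Rightarrow> 'm \<Rightarrow> 'm \<Rightarrow> 'm \<Rightarrow> 'm" where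
  "A_act S c L y \<phi> \<alpha> = (\<lambda>\<phi>'\<in>A_ext S c y \<phi>. Comp S (sum_mor S L (Ident S y) \<alpha>) \<phi>')"

definition pseudotorsor :: "('g, 'x) monoid_scheme \<Rightarrow> 'e set \<Rightarrow> ('g \<Rightarrow> 'e \<Rightarrow> 'e) \<Rightarrow> bool" where
  "pseudotorsor G E act \<longleftrightarrow> group_action G E act \<and>
    (E = {} \<or> (\<forall>x\<in>E. \<forall>y\<in>E. \<exists>!g. g \<in> carrier G \<and> act g x = y))"


section \<open>Restriction along a map of small extensions\<close>

text \<open>
  Here \<open>c : A' \<rightarrow> A\<close>, \<open>d : B' \<rightarrow> B\<close>, \<open>h' : A' \<rightarrow> B'\<close> and \<open>h : A \<rightarrow> B\<close> form a commutative square.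
\<close>

definition pair_restr ::
  "('l, 'r, 'o, 'm) stack \<Rightarrow> ('l, 'r) alg_arr \<Rightarrow> ('l, 'r) alg_arr \<Rightarrow> ('l, 'r) alg_arr \<Rightarrow> 'o \<Rightarrow>
    'o \<times> 'm \<Rightarrow> 'o \<times> 'm" where
  "pair_restr S d h' h x p =
    (restr_ob S h' (fst p),
     factor_thru S d (pullback S h' (fst p)) (Comp S (snd p) (pullback S h x)))"

definition T_ext_restr ::
  "('l, 'r, 'o, 'm) stack \<Rightarrow> ('l, 'r) alg_arr \<Rightarrow> ('l, 'r) alg_arr \<Rightarrow> ('l, 'r) alg_arr \<Rightarrow> 'o \<Rightarrow>
    ('o \<times> 'm) set \<Rightarrow> ('o \<times> 'm) set" where
  "T_ext_restr S d h' h x P =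
    (\<Union>p\<in>P. ext_class S d (restr_ob S h x) (pair_restr S d h' h x p))"

text \<open>An automorphism of the restriction of \<open>y\<close> to \<open>A\<close> induces one of the restriction to \<open>B\<close> of
  the restriction of \<open>y\<close> to \<open>B'\<close>.\<close>

definition aut_restr ::
  "('l, 'r, 'o, 'm) stack \<Rightarrow> ('l, 'r) alg_arr \<Rightarrow> ('l, 'r) alg_arr \<Rightarrow> ('l, 'r) alg_arr \<Rightarrow>
    ('l, 'r) alg_arr \<Rightarrow> 'o \<Rightarrow> 'm \<Rightarrow> 'm" where
  "aut_restr S c d h' h y \<phi> =
    (let u = factor_thru S h (pullback S c y)
        (Comp S (pullback S h' y) (pullback S d (restr_ob S h' y)))
     in restr_along S u u \<phi>)"

end

theory Submission
  imports Defs
begin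

text \<open>
  The gluing axioms say that \<open>S\<close> turns fiber products of algebras along surjections into fiber
  products of groupoids.
  As every morphism of \<open>S\<close> is cartesian, this can be read inside \<open>S\<close>: an object over
  \<open>A' \<times>\<^sub>A A''\<close> is the pushout of its restrictions to \<open>A'\<close> and \<open>A''\<close> over their common restriction
  to \<open>A\<close> (\<open>cartesian_glue\<close>, \<open>cartesian_pushout\<close>).  Over the residue field all compatibilities hold
  automatically, so a morphism out of \<open>\<eta>\<^sub>1 * \<eta>\<^sub>2\<close> is just a pair of morphisms out of \<open>\<eta>\<^sub>1\<close> and \<open>\<eta>\<^sub>2\<close>
  (\<open>star_pushout\<close>).

  The torsor statements hold because \<open>A' \<times>\<^sub>k k[I]\<close>, with \<open>\<sigma>\<close> and the first projection, is also the
  fiber product \<open>A' \<times>\<^sub>A A'\<close> (\<open>cartesian_sigma\<close>).  Gluing an extension \<open>z\<close> of \<open>\<eta>\<close> with an extension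
  \<open>x\<close> along this square writes \<open>z\<close> as \<open>x + y\<close>, and gluing isomorphisms shows that \<open>y\<close> is unique up to
  isomorphism (\<open>sum_transitive\<close>, \<open>sum_free\<close>).  In the same way, automorphisms of \<open>x = x + \<zeta>\<close> that
  are trivial over \<open>A\<close> and automorphisms of \<open>\<zeta>\<close> both amount to the endomorphisms of \<open>x * \<zeta>\<close> that are
  trivial on \<open>x\<close> (\<open>sum_Ident_bij\<close>).  Associativity of the addition is associativity of addition in
  \<open>A'\<close>, seen on a gluing of three objects (\<open>sum_assoc\<close>), and on \<open>A\<^sub>I\<close> the addition agrees with
  composition by the Eckmann--Hilton argument (\<open>sum_mor_zeta\<close>).

  Well-definedness on classes, independence of the choices in an addition law and functoriality are
  all instances of one fact: for two small extensions linked by a map, morphisms \<open>f\<close>, \<open>g\<close> between the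
  summands have a unique sum \<open>f + g\<close> between the two sums, and these sums compose (\<open>sum_rel\<close>,
  \<open>sum_rel_ex\<close>, \<open>sum_rel_unique\<close>, \<open>sum_rel_comp\<close>).

  On the side of algebras, the main point is that \<open>k[V]\<close> is Artinian.  That the fiber products and
  \<open>\<sigma>\<close> belong to the base category is read off from the objects and morphisms of \<open>S\<close> lying over
  them.
\<close>

section \<open>Artin algebras\<close>

text \<open>
  The coding of pairs is a choice of injection; one exists because an infinite set is equipotent to
  its square.  This is what makes fiber products and \<open>k[V]\<close> honest algebras in the same universe.
\<close>

lemma inj_enc:
  assumes "infinite (UNIV :: 'r set)"
  shows "inj (enc :: 'r \<times> 'r \<Rightarrow> 'r)"
proof -
  have "|(UNIV :: 'r set) \<times> (UNIV :: 'r set)| =o |UNIV :: 'r set|"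
    using card_of_Times_same_infinite[OF assms] .
  then obtain e :: "'r \<times> 'r \<Rightarrow> 'r" where "bij_betw e (UNIV \<times> UNIV) UNIV"
    using card_of_ordIso by blast
  then have "inj e"
    by (simp add: bij_betw_def)
  then show ?thesis
    unfolding enc_def by (rule someI[where P = inj])
qed

lemma mem_a_kernel: "x \<in> a_kernel R S h \<longleftrightarrow> x \<in> carrier R \<and> h x = \<zero>\<^bsub>S\<^esub>"
  unfolding a_kernel_def' by (rule mem_Collect_eq)

locale coefficients =
  fixes \<Lambda> :: "'l ring" and K :: "('l, 'r) alg"
  assumes infinite_universe: "infinite (UNIV :: 'r set)"
    and coefficient_ring: "coefficient_ring \<Lambda> K"
begin

sublocale K: field K
  using coefficient_ring by (simp add: coefficient_ring_def)

lemma enc_eq_iff [simp]: "enc p = enc q \<longleftrightarrow> p = (q :: 'r \<times> 'r)"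
  using inj_enc[OF infinite_universe] by (auto dest: injD)

lemma dec_enc [simp]: "dec1 (enc (p :: 'r \<times> 'r)) = fst p" "dec2 (enc p) = snd p"
  using inj_enc[OF infinite_universe] by (simp_all add: dec1_def dec2_def)

lemma res_K: "a \<in> carrier K \<Longrightarrow> res K a = a"
  using coefficient_ring by (simp add: coefficient_ring_def)

lemma str_K: "str K \<in> ring_hom \<Lambda> K"
  using coefficient_ring by (simp add: coefficient_ring_def)

subsection \<open>Residue maps and maximal ideals\<close>

text \<open>
  An ideal strictly containing the kernel has an element with nonzero residue; lifting the inverse
  of this residue puts \<open>1\<close> into the ideal.
\<close>

lemma kernel_of_residue_maximal:
  assumes "cring A" and r: "r \<in> ring_hom A K" and surj: "r ` carrier A = carrier K"
  shows "maximalideal (a_kernel A K r) A"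
proof -
  interpret A: cring A by fact
  have cancel: "(s \<ominus>\<^bsub>A\<^esub> t) \<oplus>\<^bsub>A\<^esub> t = s" if "s \<in> carrier A" "t \<in> carrier A" for s t
    using that by (simp add: A.minus_eq A.a_assoc A.l_neg)
  interpret r: ring_hom_ring A K r
    using ring_hom_ringI2[OF A.ring_axioms K.ring_axioms r] .
  show ?thesis
  proof (rule maximalidealI)
    show "ideal (a_kernel A K r) A"
      by (rule r.kernel_is_ideal)
    show "carrier A \<noteq> a_kernel A K r"
    proof
      assume eq: "carrier A = a_kernel A K r"
      then have "\<one>\<^bsub>A\<^esub> \<in> a_kernel A K r" using A.one_closed by blast
      then have "r \<one>\<^bsub>A\<^esub> = \<zero>\<^bsub>K\<^esub>" by (rule mem_a_kernel[THEN iffD1, THEN conjunct2])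
      then show False using r.hom_one K.one_not_zero by metis
    qed
  next
    fix J assume J: "ideal J A" "a_kernel A K r \<subseteq> J" "J \<subseteq> carrier A"
    interpret J: ideal J A by fact
    show "J = a_kernel A K r \<or> J = carrier A"
    proof (cases "J \<subseteq> a_kernel A K r")
      case False
      then obtain b where b: "b \<in> J" "r b \<noteq> \<zero>\<^bsub>K\<^esub>"
        using J(3) unfolding subset_iff mem_a_kernel by blast
      then have bA: "b \<in> carrier A" using J(3) by auto
      then have "inv\<^bsub>K\<^esub> r b \<in> r ` carrier A"
        using b K.field_Units by (simp add: surj)
      then obtain b' where b': "b' \<in> carrier A" "r b' = inv\<^bsub>K\<^esub> r b" by auto
      have "r (\<one>\<^bsub>A\<^esub> \<ominus>\<^bsub>A\<^esub> b' \<otimes>\<^bsub>A\<^esub> b) = \<zero>\<^bsub>K\<^esub>"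
        using b b' bA K.field_Units
        by (simp add: A.minus_eq K.r_neg)
      then have "\<one>\<^bsub>A\<^esub> \<ominus>\<^bsub>A\<^esub> b' \<otimes>\<^bsub>A\<^esub> b \<in> J"
        using J(2) bA b' unfolding subset_iff mem_a_kernel by simp
      moreover have "b' \<otimes>\<^bsub>A\<^esub> b \<in> J"
        using b b' by (simp add: J.I_l_closed)
      ultimately have "(\<one>\<^bsub>A\<^esub> \<ominus>\<^bsub>A\<^esub> b' \<otimes>\<^bsub>A\<^esub> b) \<oplus>\<^bsub>A\<^esub> b' \<otimes>\<^bsub>A\<^esub> b \<in> J"
        by (rule J.a_closed)
      then have "\<one>\<^bsub>A\<^esub> \<in> J"
        using cancel[of "\<one>\<^bsub>A\<^esub>" "b' \<otimes>\<^bsub>A\<^esub> b"] bA b' A.m_closed A.one_closed by metis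
      then show ?thesis using J.one_imp_carrier by blast
    qed (use J in auto)
  qed
qed

text \<open>
  The criterion by which \<open>K\<close> and \<open>k[V]\<close> are recognized as local: a maximal ideal contains no unit,
  hence lies in the kernel of the residue map.
\<close>

lemma local_ring_if_units:
  assumes "cring A" and r: "r \<in> ring_hom A K" and surj: "r ` carrier A = carrier K"
    and units: "\<And>z. z \<in> carrier A \<Longrightarrow> r z \<noteq> \<zero>\<^bsub>K\<^esub> \<Longrightarrow> z \<in> Units A"
  shows "local_ring A"
proof -
  interpret A: cring A by fact
  note ker = kernel_of_residue_maximal[OF assms(1-3)]
  have "M = a_kernel A K r" if "maximalideal M A" for M
  proof -
    interpret M: maximalideal M A by fact
    have "M \<subseteq> a_kernel A K r"
    proof
      fix z assume z: "z \<in> M"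
      then have zA: "z \<in> carrier A" using M.a_subset by auto
      show "z \<in> a_kernel A K r"
      proof (rule ccontr)
        assume "z \<notin> a_kernel A K r"
        then have u: "z \<in> Units A" using units zA by (auto simp: mem_a_kernel)
        have "inv\<^bsub>A\<^esub> z \<otimes>\<^bsub>A\<^esub> z \<in> M" using M.I_l_closed[OF z A.Units_inv_closed[OF u]] .
        then have "\<one>\<^bsub>A\<^esub> \<in> M" using u A.Units_l_inv by metis
        then show False using M.one_imp_carrier M.I_notcarr by auto
      qed
    qed
    then show ?thesis
      using M.I_maximal[of "a_kernel A K r"] ker
      by (metis maximalideal.axioms(1) ideal.axioms(1) additive_subgroup.a_subset maximalideal.I_notcarr)
  qed
  then show ?thesis
    using ker \<open>cring A\<close> unfolding local_ring_def by blast
qed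

lemma art_algD:
  assumes "art_alg \<Lambda> K A"
  shows "cring A" "ring A" "str A \<in> ring_hom \<Lambda> A" "res A \<in> ring_hom A K"
    "res A ` carrier A = carrier K" "\<And>l. l \<in> carrier \<Lambda> \<Longrightarrow> res A (str A l) = str K l"
  using assms by (auto simp: art_alg_def local_ring_def intro: cring.axioms)

lemma max_ideal_eq_kernel_of_residue:
  assumes "art_alg \<Lambda> K A"
  shows "max_ideal A = a_kernel A K (res A)"
proof -
  note A = art_algD[OF assms]
  have "\<exists>!M. maximalideal M A"
    using assms by (simp add: art_alg_def local_ring_def)
  then show ?thesis
    using kernel_of_residue_maximal[OF A(1,4,5)] unfolding max_ideal_def by (metis the_equality)
qed

lemma art_alg_K: "art_alg \<Lambda> K K"
proof -
  have res: "res K \<in> ring_hom K K" "res K ` carrier K = carrier K"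
    by (auto simp: ring_hom_def res_K image_iff)
  have "local_ring K"
    by (rule local_ring_if_units[of K "res K"])
      (use res K.field_Units in \<open>auto simp: res_K K.cring_axioms\<close>)
  moreover have "artinian_ring K"
    unfolding artinian_ring_def
  proof (intro conjI allI impI)
    fix J :: "nat \<Rightarrow> 'r set"
    assume J: "\<forall>n. ideal (J n) K \<and> J (Suc n) \<subseteq> J n"
    then have anti: "J m \<subseteq> J n" if "n \<le> m" for m n
      using that by (simp add: lift_Suc_antimono_le)
    have cases: "J n = {\<zero>\<^bsub>K\<^esub>} \<or> J n = carrier K" for n
      using J K.all_ideals by auto
    show "\<exists>n. \<forall>m\<ge>n. J m = J n"
    proof (cases "\<exists>n. J n = {\<zero>\<^bsub>K\<^esub>}")
      case True
      then obtain n where n: "J n = {\<zero>\<^bsub>K\<^esub>}" by auto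
      then have "\<forall>m\<ge>n. J m = J n" using anti[of n] cases K.zero_closed by force
      then show ?thesis by blast
    next
      case False
      then have "\<forall>n. J n = carrier K" using cases by blast
      then show ?thesis by simp
    qed
  qed (rule K.ring_axioms)
  moreover have "res K (str K l) = str K l" if "l \<in> carrier \<Lambda>" for l
    using that str_K by (simp add: res_K ring_hom_closed)
  ultimately show ?thesis
    using str_K res by (simp add: art_alg_def)
qed

subsection \<open>The algebras \<open>k[V]\<close>\<close>

text \<open>
  The condition on \<open>V\<close> that makes \<open>k[V]\<close> Artinian.  It isolates what finite-dimensional spaces and
  kernels of small extensions have in common, and so avoids extracting a finite basis of a kernel.
\<close>

definition submodule_dcc :: "('r, 'r) module \<Rightarrow> bool" where
  "submodule_dcc V \<longleftrightarrow>
    (\<forall>J :: nat \<Rightarrow> 'r set. (\<forall>n. submodule (J n) K V \<and> J (Suc n) \<subseteq> J n) \<longrightarrow>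
      (\<exists>n. \<forall>m\<ge>n. J m = J n))"

lemma carrier_sqz: "z \<in> carrier (sqz K V) \<longleftrightarrow> (\<exists>a\<in>carrier K. \<exists>v\<in>carrier V. z = enc (a, v))"
  by (auto simp: sqz_def)

lemma enc_in_sqz [simp]: "enc (a, v) \<in> carrier (sqz K V) \<longleftrightarrow> a \<in> carrier K \<and> v \<in> carrier V"
  by (auto simp: sqz_def)

lemma sqz_simps [simp]:
  "enc (a, v) \<otimes>\<^bsub>sqz K V\<^esub> enc (b, w) = enc (a \<otimes>\<^bsub>K\<^esub> b, (a \<odot>\<^bsub>V\<^esub> w) \<oplus>\<^bsub>V\<^esub> (b \<odot>\<^bsub>V\<^esub> v))"
  "enc (a, v) \<oplus>\<^bsub>sqz K V\<^esub> enc (b, w) = enc (a \<oplus>\<^bsub>K\<^esub> b, v \<oplus>\<^bsub>V\<^esub> w)"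
  "\<one>\<^bsub>sqz K V\<^esub> = enc (\<one>\<^bsub>K\<^esub>, \<zero>\<^bsub>V\<^esub>)" "\<zero>\<^bsub>sqz K V\<^esub> = enc (\<zero>\<^bsub>K\<^esub>, \<zero>\<^bsub>V\<^esub>)"
  "str (sqz K V) l = enc (str K l, \<zero>\<^bsub>V\<^esub>)" "res (sqz K V) = dec1"
  by (simp_all add: sqz_def)

lemma cring_sqz:
  assumes "module K V"
  shows "cring (sqz K V)"
proof -
  interpret V: module K V by fact
  show ?thesis
  proof (rule cringI)
    show "abelian_group (sqz K V)"
    proof (rule abelian_groupI)
      fix z assume "z \<in> carrier (sqz K V)"
      then obtain a v where z: "z = enc (a, v)" "a \<in> carrier K" "v \<in> carrier V"
        by (auto simp: carrier_sqz)
      then show "\<exists>y\<in>carrier (sqz K V). y \<oplus>\<^bsub>sqz K V\<^esub> z = \<zero>\<^bsub>sqz K V\<^esub>"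
        by (intro bexI[of _ "enc (\<ominus>\<^bsub>K\<^esub> a, \<ominus>\<^bsub>V\<^esub> v)"]) (auto simp: K.l_neg V.M.l_neg)
    qed (auto simp: carrier_sqz K.a_ac V.M.a_ac)
    show "comm_monoid (sqz K V)"
      by (rule comm_monoidI)
        (auto simp: carrier_sqz V.smult_r_distr V.smult_assoc1[symmetric] V.M.a_ac K.m_ac
          V.smult_r_null)
    show "(x \<oplus>\<^bsub>sqz K V\<^esub> y) \<otimes>\<^bsub>sqz K V\<^esub> z = x \<otimes>\<^bsub>sqz K V\<^esub> z \<oplus>\<^bsub>sqz K V\<^esub> y \<otimes>\<^bsub>sqz K V\<^esub> z"
      if "x \<in> carrier (sqz K V)" "y \<in> carrier (sqz K V)" "z \<in> carrier (sqz K V)" for x y z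
      using that by (auto simp: carrier_sqz K.l_distr V.smult_l_distr V.smult_r_distr V.M.a_ac)
  qed
qed

text \<open>
  The inverse of \<open>a + v\<close> is \<open>a\<^bsup>-1\<^esup> - a\<^bsup>-2\<^esup> v\<close>.
\<close>

lemma Units_sqz:
  assumes "module K V" and "z \<in> carrier (sqz K V)" and "dec1 z \<noteq> \<zero>\<^bsub>K\<^esub>"
  shows "z \<in> Units (sqz K V)"
proof -
  interpret V: module K V by fact
  interpret R: cring "sqz K V" using cring_sqz[OF assms(1)] .
  obtain a v where z: "z = enc (a, v)" "a \<in> carrier K" "v \<in> carrier V" "a \<noteq> \<zero>\<^bsub>K\<^esub>"
    using assms by (auto simp: carrier_sqz)
  let ?b = "inv\<^bsub>K\<^esub> a"
  have b: "?b \<in> carrier K" "a \<otimes>\<^bsub>K\<^esub> ?b = \<one>\<^bsub>K\<^esub>"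
    using z K.field_Units by auto
  let ?y = "enc (?b, \<ominus>\<^bsub>V\<^esub> (?b \<odot>\<^bsub>V\<^esub> (?b \<odot>\<^bsub>V\<^esub> v)))"
  have "z \<otimes>\<^bsub>sqz K V\<^esub> ?y = \<one>\<^bsub>sqz K V\<^esub>"
    using z b by (simp add: V.smult_r_minus V.smult_assoc1[symmetric] K.m_assoc[symmetric] V.M.l_neg)
  moreover have "?y \<in> carrier (sqz K V)"
    using z b by simp
  ultimately show ?thesis
    using assms(2) R.m_comm[OF assms(2)] unfolding Units_def by force
qed

text \<open>
  Outside the kernel of the residue map everything is a unit, so an ideal of \<open>k[V]\<close> is either
  everything or a subspace of \<open>V\<close>.  A descending chain of ideals thus ends up as a chain of subspaces.
\<close>

lemma art_alg_sqz:
  assumes V: "module K V" and dcc: "submodule_dcc V"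
  shows "art_alg \<Lambda> K (sqz K V)"
proof -
  interpret V: module K V by fact
  interpret R: cring "sqz K V" using cring_sqz[OF V] .
  have res: "res (sqz K V) \<in> ring_hom (sqz K V) K"
    by (rule ring_hom_memI) (auto simp: carrier_sqz)
  have surj: "res (sqz K V) ` carrier (sqz K V) = carrier K"
  proof
    show "carrier K \<subseteq> res (sqz K V) ` carrier (sqz K V)"
    proof
      fix a assume "a \<in> carrier K"
      then show "a \<in> res (sqz K V) ` carrier (sqz K V)"
        by (intro image_eqI[of _ _ "enc (a, \<zero>\<^bsub>V\<^esub>)"]) auto
    qed
  qed (auto simp: carrier_sqz)
  have loc: "local_ring (sqz K V)"
    by (rule local_ring_if_units[OF cring_sqz[OF V] res surj]) (use Units_sqz[OF V] in auto)
  have str: "str (sqz K V) \<in> ring_hom \<Lambda> (sqz K V)"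
    using str_K by (intro ring_hom_memI) (auto simp: ring_hom_closed ring_hom_mult ring_hom_add ring_hom_one)
  have "artinian_ring (sqz K V)"
    unfolding artinian_ring_def
  proof (intro conjI allI impI)
    fix J :: "nat \<Rightarrow> 'r set"
    assume J: "\<forall>n. ideal (J n) (sqz K V) \<and> J (Suc n) \<subseteq> J n"
    then have anti: "J m \<subseteq> J n" if "n \<le> m" for m n
      using that by (simp add: lift_Suc_antimono_le)
    define H where "H n = {v \<in> carrier V. enc (\<zero>\<^bsub>K\<^esub>, v) \<in> J n}" for n
    have sub: "submodule (H n) K V" for n
    proof -
      interpret J: ideal "J n" "sqz K V" using J by auto
      show ?thesis
      proof (rule V.submoduleI)
        show "\<zero>\<^bsub>V\<^esub> \<in> H n" using J.additive_subgroup_axioms additive_subgroup.zero_closed[of "J n" "sqz K V"]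
          by (simp add: H_def)
        show scal: "a \<odot>\<^bsub>V\<^esub> x \<in> H n" if "a \<in> carrier K" "x \<in> H n" for a x
          using that J.I_l_closed[of "enc (\<zero>\<^bsub>K\<^esub>, x)" "enc (a, \<zero>\<^bsub>V\<^esub>)"] by (auto simp: H_def)
        show "a \<oplus>\<^bsub>V\<^esub> b \<in> H n" if "a \<in> H n" "b \<in> H n" for a b
          using that J.a_closed[of "enc (\<zero>\<^bsub>K\<^esub>, a)" "enc (\<zero>\<^bsub>K\<^esub>, b)"] by (auto simp: H_def)
        show "\<ominus>\<^bsub>V\<^esub> a \<in> H n" if "a \<in> H n" for a
          using scal[of "\<ominus>\<^bsub>K\<^esub> \<one>\<^bsub>K\<^esub>" a] that by (auto simp: H_def V.smult_l_minus)
      qed (auto simp: H_def)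
    qed
    have "H (Suc n) \<subseteq> H n" for n
      using J by (auto simp: H_def)
    then obtain n where n: "\<forall>m\<ge>n. H m = H n"
      using dcc sub unfolding submodule_dcc_def by blast
    show "\<exists>n. \<forall>m\<ge>n. J m = J n"
    proof (cases "\<forall>n. J n = carrier (sqz K V)")
      case False
      then obtain k where k: "J k \<noteq> carrier (sqz K V)" by auto
      have proper: "J m = (\<lambda>v. enc (\<zero>\<^bsub>K\<^esub>, v)) ` H m" if "m \<ge> k" for m
      proof -
        interpret J: ideal "J m" "sqz K V" using J by auto
        have ne: "J m \<noteq> carrier (sqz K V)"
          using k anti[OF that] J
          by (metis additive_subgroup.a_subset ideal.axioms(1) subset_antisym)
        have zero: "dec1 z = \<zero>\<^bsub>K\<^esub>" if "z \<in> J m" for z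
        proof (rule ccontr)
          assume nz: "dec1 z \<noteq> \<zero>\<^bsub>K\<^esub>"
          have zc: "z \<in> carrier (sqz K V)" using that J.a_subset by auto
          have u: "z \<in> Units (sqz K V)" using Units_sqz[OF V zc nz] .
          then have "inv\<^bsub>sqz K V\<^esub> z \<otimes>\<^bsub>sqz K V\<^esub> z \<in> J m"
            using that by (intro J.I_l_closed) auto
          then show False
            using u J.one_imp_carrier ne R.Units_l_inv by metis
        qed
        show ?thesis
        proof
          show "J m \<subseteq> (\<lambda>v. enc (\<zero>\<^bsub>K\<^esub>, v)) ` H m"
          proof
            fix z assume z: "z \<in> J m"
            then obtain a v where "z = enc (a, v)" "v \<in> carrier V"
              using J.a_subset by (force simp: carrier_sqz)
            then show "z \<in> (\<lambda>v. enc (\<zero>\<^bsub>K\<^esub>, v)) ` H m"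
              using zero[OF z] z by (auto simp: H_def)
          qed
        qed (auto simp: H_def)
      qed
      have "\<forall>m\<ge>max n k. J m = J (max n k)"
        using proper n by (metis max.bounded_iff max.cobounded1 order_refl)
      then show ?thesis by blast
    qed simp
  qed (rule R.ring_axioms)
  then show ?thesis
    using loc str res surj by (simp add: art_alg_def)
qed

text \<open>
  Induction on the number of generators.  When a generator \<open>b\<close> is added to a subspace \<open>U\<close> on which
  chains are stationary, all that a term \<open>J n\<close> of the chain can have beyond \<open>U \<inter> J n\<close> is the line of one vector
  \<open>b + w\<close>, because the leading coefficients along \<open>b\<close> form a subspace of the field \<open>K\<close>.
\<close>

lemma submodule_dcc_fd_space:
  assumes "fd_space K V"
  shows "submodule_dcc V"
proof -
  interpret V: module K V using assms by (simp add: fd_space_def)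
  define stable where "stable U \<longleftrightarrow> (\<forall>J :: nat \<Rightarrow> 'r set.
    (\<forall>n. submodule (J n) K V \<and> J (Suc n) \<subseteq> J n) \<longrightarrow> (\<exists>n. \<forall>m\<ge>n. U \<inter> J m = U \<inter> J n))" for U
  have step: "\<exists>U'. submodule U' K V \<and> stable U' \<and>
      (\<forall>k\<in>carrier K. \<forall>w\<in>U. k \<odot>\<^bsub>V\<^esub> b \<oplus>\<^bsub>V\<^esub> w \<in> U')"
    if U: "submodule U K V" "stable U" and b: "b \<in> carrier V" for U b
  proof -
    interpret U: submodule U K V by fact
    have Uc: "w \<in> carrier V" if "w \<in> U" for w using that U.subset by auto
    have Uadd: "w \<oplus>\<^bsub>V\<^esub> w' \<in> U" if "w \<in> U" "w' \<in> U" for w w' using U.m_closed[OF that] by simp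
    have U0: "\<zero>\<^bsub>V\<^esub> \<in> U" using U.one_closed by simp
    have Uneg: "\<ominus>\<^bsub>V\<^esub> w \<in> U" if "w \<in> U" for w
      using U.m_inv_closed[OF that] by (simp add: a_inv_def)
    define U' where "U' = {k \<odot>\<^bsub>V\<^esub> b \<oplus>\<^bsub>V\<^esub> w | k w. k \<in> carrier K \<and> w \<in> U}"
    have "submodule U' K V"
    proof (rule V.submoduleI)
      show "U' \<subseteq> carrier V" using b Uc by (auto simp: U'_def)
      have "\<zero>\<^bsub>V\<^esub> = \<zero>\<^bsub>K\<^esub> \<odot>\<^bsub>V\<^esub> b \<oplus>\<^bsub>V\<^esub> \<zero>\<^bsub>V\<^esub>"
        using b by (simp add: V.smult_l_null)
      then show "\<zero>\<^bsub>V\<^esub> \<in> U'"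
        unfolding U'_def using U0 K.zero_closed by blast
      show scal: "a \<odot>\<^bsub>V\<^esub> x \<in> U'" if a: "a \<in> carrier K" and x: "x \<in> U'" for a x
      proof -
        obtain k w where "k \<in> carrier K" "w \<in> U" "x = k \<odot>\<^bsub>V\<^esub> b \<oplus>\<^bsub>V\<^esub> w"
          using x by (auto simp: U'_def)
        then have "a \<odot>\<^bsub>V\<^esub> x = (a \<otimes>\<^bsub>K\<^esub> k) \<odot>\<^bsub>V\<^esub> b \<oplus>\<^bsub>V\<^esub> a \<odot>\<^bsub>V\<^esub> w"
          using a b Uc[of w] by (simp add: V.smult_r_distr V.smult_assoc1)
        then show ?thesis
          unfolding U'_def using a \<open>k \<in> carrier K\<close> \<open>w \<in> U\<close> U.smult_closed K.m_closed by blast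
      qed
      show "x \<oplus>\<^bsub>V\<^esub> y \<in> U'" if x: "x \<in> U'" and y: "y \<in> U'" for x y
      proof -
        obtain k w where 1: "k \<in> carrier K" "w \<in> U" "x = k \<odot>\<^bsub>V\<^esub> b \<oplus>\<^bsub>V\<^esub> w"
          using x by (auto simp: U'_def)
        obtain l u where 2: "l \<in> carrier K" "u \<in> U" "y = l \<odot>\<^bsub>V\<^esub> b \<oplus>\<^bsub>V\<^esub> u"
          using y by (auto simp: U'_def)
        have "x \<oplus>\<^bsub>V\<^esub> y = (k \<oplus>\<^bsub>K\<^esub> l) \<odot>\<^bsub>V\<^esub> b \<oplus>\<^bsub>V\<^esub> (w \<oplus>\<^bsub>V\<^esub> u)"
          using 1 2 b Uc by (simp add: V.smult_l_distr V.M.a_ac)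
        then show ?thesis unfolding U'_def using 1 2 Uadd by blast
      qed
      show "\<ominus>\<^bsub>V\<^esub> x \<in> U'" if x: "x \<in> U'" for x
      proof -
        have xV: "x \<in> carrier V" using x \<open>U' \<subseteq> carrier V\<close> by blast
        then have "(\<ominus>\<^bsub>K\<^esub> \<one>\<^bsub>K\<^esub>) \<odot>\<^bsub>V\<^esub> x = \<ominus>\<^bsub>V\<^esub> x"
          by (simp add: V.smult_l_minus)
        then show ?thesis using scal[OF _ x, of "\<ominus>\<^bsub>K\<^esub> \<one>\<^bsub>K\<^esub>"] by simp
      qed
    qed
    moreover have "stable U'"
      unfolding stable_def
    proof (intro allI impI)
      fix J :: "nat \<Rightarrow> 'r set"
      assume J: "\<forall>n. submodule (J n) K V \<and> J (Suc n) \<subseteq> J n"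
      have anti: "J m \<subseteq> J n" if "n \<le> m" for m n
        using lift_Suc_antimono_le[of J n m] J that by blast
      have Jadd: "x \<oplus>\<^bsub>V\<^esub> y \<in> J n" if "x \<in> J n" "y \<in> J n" for x y n
        using subgroup.m_closed[OF submodule.axioms(1), of "J n" K V x y] J that by simp
      have Jsc: "a \<odot>\<^bsub>V\<^esub> x \<in> J n" if "x \<in> J n" "a \<in> carrier K" for x a n
        using submodule.smult_closed[of "J n" K V a x] J that by simp
      have Jc: "x \<in> carrier V" if "x \<in> J n" for x n
        using subgroup.subset[OF submodule.axioms(1), of "J n" K V] J that by auto
      obtain n0 where n0: "\<forall>m\<ge>n0. U \<inter> J m = U \<inter> J n0"
        using U(2) J unfolding stable_def by blast
      \<comment> \<open>whether the term still contains a vector with leading coefficient 1 along \<open>b\<close>\<close>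
      define Q where "Q n \<longleftrightarrow> (\<exists>w\<in>U. b \<oplus>\<^bsub>V\<^esub> w \<in> J n)" for n
      show "\<exists>n. \<forall>m\<ge>n. U' \<inter> J m = U' \<inter> J n"
      proof (cases "\<forall>n. Q n")
        case True
        have "U' \<inter> J n0 \<subseteq> J m" if m: "m \<ge> n0" for m
        proof
          fix v assume v: "v \<in> U' \<inter> J n0"
          then obtain k w where kw: "k \<in> carrier K" "w \<in> U" "v = k \<odot>\<^bsub>V\<^esub> b \<oplus>\<^bsub>V\<^esub> w"
            by (auto simp: U'_def)
          obtain w' where w': "w' \<in> U" "b \<oplus>\<^bsub>V\<^esub> w' \<in> J m" using True by (auto simp: Q_def)
          let ?u = "k \<odot>\<^bsub>V\<^esub> (b \<oplus>\<^bsub>V\<^esub> w')"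
          have u: "?u \<in> J m" "(\<ominus>\<^bsub>K\<^esub> \<one>\<^bsub>K\<^esub>) \<odot>\<^bsub>V\<^esub> ?u \<in> J m" using w' kw Jsc by auto
          have "v \<oplus>\<^bsub>V\<^esub> (\<ominus>\<^bsub>K\<^esub> \<one>\<^bsub>K\<^esub>) \<odot>\<^bsub>V\<^esub> ?u \<in> J n0"
            using u anti[OF m] v Jadd by blast
          moreover have "v \<oplus>\<^bsub>V\<^esub> (\<ominus>\<^bsub>K\<^esub> \<one>\<^bsub>K\<^esub>) \<odot>\<^bsub>V\<^esub> ?u = w \<oplus>\<^bsub>V\<^esub> \<ominus>\<^bsub>V\<^esub> (k \<odot>\<^bsub>V\<^esub> w')"
          proof -
            have c: "k \<odot>\<^bsub>V\<^esub> b \<in> carrier V" "k \<odot>\<^bsub>V\<^esub> w' \<in> carrier V" "w \<in> carrier V"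
              using kw w' b Uc by auto
            have "v \<oplus>\<^bsub>V\<^esub> (\<ominus>\<^bsub>K\<^esub> \<one>\<^bsub>K\<^esub>) \<odot>\<^bsub>V\<^esub> ?u
                = (k \<odot>\<^bsub>V\<^esub> b \<oplus>\<^bsub>V\<^esub> w) \<oplus>\<^bsub>V\<^esub> (\<ominus>\<^bsub>V\<^esub> (k \<odot>\<^bsub>V\<^esub> b) \<oplus>\<^bsub>V\<^esub> \<ominus>\<^bsub>V\<^esub> (k \<odot>\<^bsub>V\<^esub> w'))"
              using kw w' b Uc c by (simp add: V.smult_l_minus V.smult_r_distr V.M.minus_add)
            also have "\<dots> = w \<oplus>\<^bsub>V\<^esub> \<ominus>\<^bsub>V\<^esub> (k \<odot>\<^bsub>V\<^esub> w')"
              using c by (simp add: V.M.a_ac V.M.r_neg2)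
            finally show ?thesis .
          qed
          moreover have "w \<oplus>\<^bsub>V\<^esub> \<ominus>\<^bsub>V\<^esub> (k \<odot>\<^bsub>V\<^esub> w') \<in> U"
            using kw w' Uadd Uneg U.smult_closed by auto
          ultimately have "v \<oplus>\<^bsub>V\<^esub> (\<ominus>\<^bsub>K\<^esub> \<one>\<^bsub>K\<^esub>) \<odot>\<^bsub>V\<^esub> ?u \<in> J m"
            using n0 m by auto
          then have "(v \<oplus>\<^bsub>V\<^esub> (\<ominus>\<^bsub>K\<^esub> \<one>\<^bsub>K\<^esub>) \<odot>\<^bsub>V\<^esub> ?u) \<oplus>\<^bsub>V\<^esub> ?u \<in> J m"
            using u Jadd by blast
          moreover have "v \<in> carrier V" "?u \<in> carrier V" using v u Jc by auto
          ultimately show "v \<in> J m" by (simp add: V.smult_l_minus V.M.a_assoc V.M.l_neg)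
        qed
        then show ?thesis using anti by blast
      next
        case False
        then obtain n1 where n1: "\<not> Q n1" by auto
        have "U' \<inter> J m = U \<inter> J m" if m: "m \<ge> n1" for m
        proof
          show "U \<inter> J m \<subseteq> U' \<inter> J m"
          proof
            fix w assume w: "w \<in> U \<inter> J m"
            then have "w = \<zero>\<^bsub>K\<^esub> \<odot>\<^bsub>V\<^esub> b \<oplus>\<^bsub>V\<^esub> w" using b Uc[of w] by (simp add: V.smult_l_null)
            then show "w \<in> U' \<inter> J m" unfolding U'_def using w K.zero_closed by blast
          qed
          show "U' \<inter> J m \<subseteq> U \<inter> J m"
          proof
            fix v assume v: "v \<in> U' \<inter> J m"
            then obtain k w where kw: "k \<in> carrier K" "w \<in> U" "v = k \<odot>\<^bsub>V\<^esub> b \<oplus>\<^bsub>V\<^esub> w"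
              by (auto simp: U'_def)
            have "k = \<zero>\<^bsub>K\<^esub>"
            proof (rule ccontr)
              assume k: "k \<noteq> \<zero>\<^bsub>K\<^esub>"
              then have i: "inv\<^bsub>K\<^esub> k \<in> carrier K" "inv\<^bsub>K\<^esub> k \<otimes>\<^bsub>K\<^esub> k = \<one>\<^bsub>K\<^esub>"
                using kw K.field_Units by auto
              have "inv\<^bsub>K\<^esub> k \<odot>\<^bsub>V\<^esub> v = b \<oplus>\<^bsub>V\<^esub> (inv\<^bsub>K\<^esub> k \<odot>\<^bsub>V\<^esub> w)"
                using kw i b Uc by (simp add: V.smult_r_distr V.smult_assoc1[symmetric])
              moreover have "inv\<^bsub>K\<^esub> k \<odot>\<^bsub>V\<^esub> v \<in> J n1"
                using v i Jsc anti[OF m] by blast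
              ultimately show False
                using n1 kw i unfolding Q_def by (metis U.smult_closed)
            qed
            then show "v \<in> U \<inter> J m"
              using v kw b Uc by (simp add: V.smult_l_null)
          qed
        qed
        then have "\<forall>m\<ge>max n0 n1. U' \<inter> J m = U' \<inter> J (max n0 n1)"
          using n0 by (metis max.bounded_iff max.cobounded1 max.cobounded2)
        then show ?thesis by blast
      qed
    qed
    ultimately show ?thesis
      unfolding U'_def by blast
  qed
  obtain B where B: "finite B" "B \<subseteq> carrier V"
    "\<forall>v\<in>carrier V. \<exists>a\<in>B \<rightarrow> carrier K. v = (\<Oplus>\<^bsub>V\<^esub>b\<in>B. a b \<odot>\<^bsub>V\<^esub> b)"
    using assms by (auto simp: fd_space_def)
  have "\<exists>U. submodule U K V \<and> stable U \<and> (\<forall>a\<in>B \<rightarrow> carrier K. (\<Oplus>\<^bsub>V\<^esub>b\<in>B. a b \<odot>\<^bsub>V\<^esub> b) \<in> U)"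
    using B(1,2)
  proof (induction B rule: finite_induct)
    case empty
    have sub: "submodule {\<zero>\<^bsub>V\<^esub>} K V" by (rule V.submoduleI) (auto simp: V.smult_r_null)
    have "\<zero>\<^bsub>V\<^esub> \<in> J" if "submodule J K V" for J
      using submodule.axioms(1)[OF that] subgroup.one_closed[of J "add_monoid V"] by simp
    then have "stable {\<zero>\<^bsub>V\<^esub>}" unfolding stable_def by auto
    then show ?case using sub by (intro exI[of _ "{\<zero>\<^bsub>V\<^esub>}"]) auto
  next
    case (insert b B)
    then obtain U where U: "submodule U K V" "stable U"
      "\<forall>a\<in>B \<rightarrow> carrier K. (\<Oplus>\<^bsub>V\<^esub>b\<in>B. a b \<odot>\<^bsub>V\<^esub> b) \<in> U" by auto
    from step[OF U(1,2), of b] insert.prems obtain U' where U': "submodule U' K V" "stable U'"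
      "\<forall>k\<in>carrier K. \<forall>w\<in>U. k \<odot>\<^bsub>V\<^esub> b \<oplus>\<^bsub>V\<^esub> w \<in> U'" by auto
    have "(\<Oplus>\<^bsub>V\<^esub>b\<in>insert b B. a b \<odot>\<^bsub>V\<^esub> b) \<in> U'" if a: "a \<in> insert b B \<rightarrow> carrier K" for a
    proof -
      have "(\<Oplus>\<^bsub>V\<^esub>b\<in>insert b B. a b \<odot>\<^bsub>V\<^esub> b) = a b \<odot>\<^bsub>V\<^esub> b \<oplus>\<^bsub>V\<^esub> (\<Oplus>\<^bsub>V\<^esub>b\<in>B. a b \<odot>\<^bsub>V\<^esub> b)"
        using insert a by (intro V.M.finsum_insert) (auto simp: Pi_iff)
      then show ?thesis using U(3) U'(3) a by (simp add: Pi_iff)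
    qed
    then show ?case using U' by blast
  qed
  then obtain U where U: "submodule U K V" "stable U" "carrier V \<subseteq> U"
    using B(3) by (metis subsetI)
  have "U \<inter> J = J" if "submodule J K V" for J
    using submodule.axioms(1)[OF that] subgroup.subset[of J "add_monoid V"] U(3) by auto
  then show ?thesis
    using U(2) unfolding stable_def submodule_dcc_def by (metis (full_types))
qed

lemma art_alg_sqz_fd: "fd_space K V \<Longrightarrow> art_alg \<Lambda> K (sqz K V)"
  using art_alg_sqz submodule_dcc_fd_space by (simp add: fd_space_def)

subsection \<open>Arrows of Artin algebras\<close>

abbreviation arr :: "('l, 'r) alg_arr \<Rightarrow> bool" where
  "arr f \<equiv> f \<in> Arr (art \<Lambda> K)"

lemma arr_iff: "arr f \<longleftrightarrow> art_alg \<Lambda> K (asrc f) \<and> art_alg \<Lambda> K (atgt f) \<and> alg_hom \<Lambda> f"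
  by (simp add: art_def)

lemma arrD:
  assumes "arr f"
  shows "art_alg \<Lambda> K (asrc f)" "art_alg \<Lambda> K (atgt f)" "cring (asrc f)" "cring (atgt f)"
    "afun f \<in> ring_hom (asrc f) (atgt f)" "afun f \<in> extensional (carrier (asrc f))"
    "\<And>l. l \<in> carrier \<Lambda> \<Longrightarrow> afun f (str (asrc f) l) = str (atgt f) l"
    "\<And>x. x \<in> carrier (asrc f) \<Longrightarrow> res (atgt f) (afun f x) = res (asrc f) x"
    "\<And>x. x \<in> carrier (asrc f) \<Longrightarrow> afun f x \<in> carrier (atgt f)"
    "\<And>x y. x \<in> carrier (asrc f) \<Longrightarrow> y \<in> carrier (asrc f) \<Longrightarrow>
      afun f (x \<oplus>\<^bsub>asrc f\<^esub> y) = afun f x \<oplus>\<^bsub>atgt f\<^esub> afun f y"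
    "\<And>x y. x \<in> carrier (asrc f) \<Longrightarrow> y \<in> carrier (asrc f) \<Longrightarrow>
      afun f (x \<otimes>\<^bsub>asrc f\<^esub> y) = afun f x \<otimes>\<^bsub>atgt f\<^esub> afun f y"
    "afun f \<one>\<^bsub>asrc f\<^esub> = \<one>\<^bsub>atgt f\<^esub>" "afun f \<zero>\<^bsub>asrc f\<^esub> = \<zero>\<^bsub>atgt f\<^esub>"
proof -
  show *: "art_alg \<Lambda> K (asrc f)" "art_alg \<Lambda> K (atgt f)" and hom: "afun f \<in> ring_hom (asrc f) (atgt f)"
    and "afun f \<in> extensional (carrier (asrc f))"
    and "\<And>l. l \<in> carrier \<Lambda> \<Longrightarrow> afun f (str (asrc f) l) = str (atgt f) l"
    and "\<And>x. x \<in> carrier (asrc f) \<Longrightarrow> res (atgt f) (afun f x) = res (asrc f) x"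
    using assms by (auto simp: arr_iff alg_hom_def)
  show "cring (asrc f)" "cring (atgt f)" using * by (auto dest: art_algD)
  show "\<And>x. x \<in> carrier (asrc f) \<Longrightarrow> afun f x \<in> carrier (atgt f)"
    "\<And>x y. x \<in> carrier (asrc f) \<Longrightarrow> y \<in> carrier (asrc f) \<Longrightarrow>
      afun f (x \<oplus>\<^bsub>asrc f\<^esub> y) = afun f x \<oplus>\<^bsub>atgt f\<^esub> afun f y"
    "\<And>x y. x \<in> carrier (asrc f) \<Longrightarrow> y \<in> carrier (asrc f) \<Longrightarrow>
      afun f (x \<otimes>\<^bsub>asrc f\<^esub> y) = afun f x \<otimes>\<^bsub>atgt f\<^esub> afun f y"
    "afun f \<one>\<^bsub>asrc f\<^esub> = \<one>\<^bsub>atgt f\<^esub>"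
    using hom by (simp_all add: ring_hom_closed ring_hom_add ring_hom_mult ring_hom_one)
  show "afun f \<zero>\<^bsub>asrc f\<^esub> = \<zero>\<^bsub>atgt f\<^esub>"
    using ring_hom_zero[OF hom] * by (auto dest: art_algD)
qed

lemma arrI:
  assumes "art_alg \<Lambda> K (asrc f)" "art_alg \<Lambda> K (atgt f)" "afun f \<in> extensional (carrier (asrc f))"
    "\<And>x. x \<in> carrier (asrc f) \<Longrightarrow> afun f x \<in> carrier (atgt f)"
    "\<And>x y. x \<in> carrier (asrc f) \<Longrightarrow> y \<in> carrier (asrc f) \<Longrightarrow>
      afun f (x \<oplus>\<^bsub>asrc f\<^esub> y) = afun f x \<oplus>\<^bsub>atgt f\<^esub> afun f y"
    "\<And>x y. x \<in> carrier (asrc f) \<Longrightarrow> y \<in> carrier (asrc f) \<Longrightarrow>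
      afun f (x \<otimes>\<^bsub>asrc f\<^esub> y) = afun f x \<otimes>\<^bsub>atgt f\<^esub> afun f y"
    "afun f \<one>\<^bsub>asrc f\<^esub> = \<one>\<^bsub>atgt f\<^esub>"
    "\<And>l. l \<in> carrier \<Lambda> \<Longrightarrow> afun f (str (asrc f) l) = str (atgt f) l"
    "\<And>x. x \<in> carrier (asrc f) \<Longrightarrow> res (atgt f) (afun f x) = res (asrc f) x"
  shows "arr f"
  unfolding arr_iff alg_hom_def using assms by (auto intro: ring_hom_memI)

lemma arr_eqI:
  assumes "arr f" "arr g" "asrc f = asrc g" "atgt f = atgt g"
    and "\<And>x. x \<in> carrier (asrc f) \<Longrightarrow> afun f x = afun g x"
  shows "f = g"
proof -
  have "afun f = afun g"
    using arrD(6)[OF assms(1)] arrD(6)[OF assms(2)] assms(3,5) by (auto intro: extensionalityI)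
  then show ?thesis using assms(3,4) by (cases f, cases g) simp
qed

lemma arr_comp_sel [simp]:
  "asrc (arr_comp d c) = asrc c" "atgt (arr_comp d c) = atgt d"
  "x \<in> carrier (asrc c) \<Longrightarrow> afun (arr_comp d c) x = afun d (afun c x)"
  by (simp_all add: arr_comp_def compose_def)

lemma arr_id_sel [simp]:
  "asrc (arr_id A) = A" "atgt (arr_id A) = A" "x \<in> carrier A \<Longrightarrow> afun (arr_id A) x = x"
  by (simp_all add: arr_id_def)

lemma arr_comp_arr [intro, simp]:
  assumes "arr c" "arr d" "atgt c = asrc d"
  shows "arr (arr_comp d c)"
proof (rule arrI)
  show "afun (arr_comp d c) \<in> extensional (carrier (asrc (arr_comp d c)))"
    by (simp add: arr_comp_def)
  interpret C: cring "asrc c" using arrD(3)[OF assms(1)] .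
  fix l assume l: "l \<in> carrier \<Lambda>"
  then have "str (asrc c) l \<in> carrier (asrc c)"
    using art_algD(3)[OF arrD(1)[OF assms(1)]] by (simp add: ring_hom_closed)
  then show "afun (arr_comp d c) (str (asrc (arr_comp d c)) l) = str (atgt (arr_comp d c)) l"
    using arrD(7)[OF assms(1) l] arrD(7)[OF assms(2) l] assms(3) by simp
qed (use arrD[OF assms(1)] arrD[OF assms(2)] assms(3) in
    \<open>simp_all add: cring.cring_simprules ring.ring_simprules\<close>)

lemma arr_id_arr [intro, simp]: "art_alg \<Lambda> K A \<Longrightarrow> arr (arr_id A)"
  by (rule arrI) (auto simp: arr_id_def dest: art_algD
      intro: cring.cring_simprules ring_hom_closed)

lemma arr_comp_assoc:
  "arr c \<Longrightarrow> arr d \<Longrightarrow> atgt c = asrc d \<Longrightarrow>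
    arr_comp e (arr_comp d c) = arr_comp (arr_comp e d) c"
  by (auto simp: arr_comp_def compose_def fun_eq_iff dest: arrD(9))

lemma arr_comp_id_left [simp]: "arr c \<Longrightarrow> B = atgt c \<Longrightarrow> arr_comp (arr_id B) c = c"
  by (rule arr_eqI) (auto simp: arrD)

lemma arr_comp_id_right [simp]: "arr c \<Longrightarrow> A = asrc c \<Longrightarrow> arr_comp c (arr_id A) = c"
  by (rule arr_eqI) (auto simp: arrD)

lemma mem_arr_ker: "x \<in> arr_ker c \<longleftrightarrow> x \<in> carrier (asrc c) \<and> afun c x = \<zero>\<^bsub>atgt c\<^esub>"
  by (simp only: arr_ker_def mem_a_kernel)

lemma arr_minus:
  assumes "arr f" "x \<in> carrier (asrc f)" "y \<in> carrier (asrc f)"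
  shows "afun f (x \<ominus>\<^bsub>asrc f\<^esub> y) = afun f x \<ominus>\<^bsub>atgt f\<^esub> afun f y"
proof -
  interpret f: ring_hom_cring "asrc f" "atgt f" "afun f"
    using arrD[OF assms(1)] by (simp add: ring_hom_cring_def ring_hom_cring_axioms_def)
  show ?thesis
    using assms by (simp add: f.R.minus_eq f.S.minus_eq)
qed

text \<open>
  Lets an isomorphism of algebras be produced by checking bijectivity only; it is applied to the
  comparison of two fiber products in \<open>cartesian_iso\<close>.
\<close>

lemma arr_inverse:
  assumes f: "arr f" and bij: "bij_betw (afun f) (carrier (asrc f)) (carrier (atgt f))"
  obtains g where "arr g" "asrc g = atgt f" "atgt g = asrc f"
    "arr_comp g f = arr_id (asrc f)" "arr_comp f g = arr_id (atgt f)"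
proof -
  define g where "g = \<lparr>asrc = atgt f,
    afun = (\<lambda>y\<in>carrier (atgt f). inv_into (carrier (asrc f)) (afun f) y), atgt = asrc f\<rparr>"
  have sel: "asrc g = atgt f" "atgt g = asrc f"
    by (simp_all add: g_def)
  interpret S: cring "asrc f" using arrD(3)[OF f] .
  have gf: "afun g (afun f x) = x" if "x \<in> carrier (asrc f)" for x
    using that bij arrD(9)[OF f] by (simp add: g_def bij_betw_inv_into_left)
  have fg: "afun f (afun g y) = y" and gc: "afun g y \<in> carrier (asrc f)"
    if "y \<in> carrier (atgt f)" for y
    using that bij
    by (simp_all add: g_def bij_betw_inv_into_right bij_betw_def inv_into_into)
  have onto: "\<exists>x\<in>carrier (asrc f). y = afun f x" if "y \<in> carrier (atgt f)" for y
    using fg[OF that] gc[OF that] by metis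
  have "arr g"
  proof (rule arrI, unfold sel)
    show "afun g \<in> extensional (carrier (atgt f))" by (simp add: g_def)
    show "afun g (x \<oplus>\<^bsub>atgt f\<^esub> y) = afun g x \<oplus>\<^bsub>asrc f\<^esub> afun g y"
      if "x \<in> carrier (atgt f)" "y \<in> carrier (atgt f)" for x y
      using gf[of "afun g x \<oplus>\<^bsub>asrc f\<^esub> afun g y"] that gc fg arrD(10)[OF f] by simp
    show "afun g (x \<otimes>\<^bsub>atgt f\<^esub> y) = afun g x \<otimes>\<^bsub>asrc f\<^esub> afun g y"
      if "x \<in> carrier (atgt f)" "y \<in> carrier (atgt f)" for x y
      using gf[of "afun g x \<otimes>\<^bsub>asrc f\<^esub> afun g y"] that gc fg arrD(11)[OF f] by simp
    show "afun g \<one>\<^bsub>atgt f\<^esub> = \<one>\<^bsub>asrc f\<^esub>"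
      using gf[of "\<one>\<^bsub>asrc f\<^esub>"] arrD(12)[OF f] by simp
    show "afun g (str (atgt f) l) = str (asrc f) l" if l: "l \<in> carrier \<Lambda>" for l
      using gf[of "str (asrc f) l"] arrD(7)[OF f l] ring_hom_closed[OF art_algD(3)[OF arrD(1)[OF f]] l]
      by simp
    show "res (asrc f) (afun g x) = res (atgt f) x" if "x \<in> carrier (atgt f)" for x
      using arrD(8)[OF f gc[OF that]] fg[OF that] by simp
  qed (use arrD[OF f] gc in auto)
  moreover have "arr_comp g f = arr_id (asrc f)"
    by (rule arr_eqI) (use \<open>arr g\<close> f sel gf arrD(1,2)[OF f] in auto)
  moreover have "arr_comp f g = arr_id (atgt f)"
    by (rule arr_eqI) (use \<open>arr g\<close> f sel fg arrD(1,2)[OF f] in auto)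
  ultimately show ?thesis using that sel by blast
qed

subsection \<open>Residue maps as arrows\<close>

lemma res_arr_sel [simp]:
  "asrc (res_arr K A) = A" "atgt (res_arr K A) = K"
  "x \<in> carrier A \<Longrightarrow> afun (res_arr K A) x = res A x"
  by (simp_all add: res_arr_def)

lemma res_arr_arr [intro, simp]:
  assumes "art_alg \<Lambda> K A"
  shows "arr (res_arr K A)"
proof -
  note A = art_algD[OF assms]
  interpret A: cring A using A(1) .
  show ?thesis
  proof (rule arrI)
    show "afun (res_arr K A) \<in> extensional (carrier (asrc (res_arr K A)))"
      by (simp add: res_arr_def)
  qed (use assms A art_alg_K in \<open>auto simp: ring_hom_add ring_hom_mult ring_hom_one
      ring_hom_closed res_K\<close>)
qed

lemma res_arr_surj: "art_alg \<Lambda> K A \<Longrightarrow> arr_surj (res_arr K A)"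
  using art_algD(5)[of A] by (simp add: arr_surj_def res_arr_def)

lemma arr_comp_res:
  assumes "arr f" "B = atgt f" shows "arr_comp (res_arr K B) f = res_arr K (asrc f)"
  using assms arrD[OF assms(1)] by (intro arr_eqI) auto

subsection \<open>Fiber products\<close>

text \<open>
  A square of algebras is a fiber product, stated on elements.  The point of this form is that the
  same algebra \<open>A' \<times>\<^sub>k k[I]\<close> is a fiber product in two ways, only one of which is literally an
  \<open>fprod\<close>.
\<close>

definition cartesian ::
  "('l, 'r) alg_arr \<Rightarrow> ('l, 'r) alg_arr \<Rightarrow> ('l, 'r) alg_arr \<Rightarrow> ('l, 'r) alg_arr \<Rightarrow> bool" where
  "cartesian c d p q \<longleftrightarrow> arr c \<and> arr d \<and> atgt c = atgt d \<and>
    arr p \<and> arr q \<and> asrc p = asrc q \<and> atgt p = asrc c \<and> atgt q = asrc d \<and>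
    arr_comp c p = arr_comp d q \<and>
    (\<forall>x\<in>carrier (asrc c). \<forall>y\<in>carrier (asrc d). afun c x = afun d y \<longrightarrow>
      (\<exists>!z. z \<in> carrier (asrc p) \<and> afun p z = x \<and> afun q z = y))"

lemma cartesianD:
  assumes "cartesian c d p q"
  shows "arr c" "arr d" "atgt c = atgt d" "arr p" "arr q" "asrc p = asrc q" "atgt p = asrc c"
    "atgt q = asrc d" "arr_comp c p = arr_comp d q"
  using assms by (simp_all add: cartesian_def)

lemma cartesian_ex1:
  assumes "cartesian c d p q" "x \<in> carrier (asrc c)" "y \<in> carrier (asrc d)" "afun c x = afun d y"
  shows "\<exists>!z. z \<in> carrier (asrc p) \<and> afun p z = x \<and> afun q z = y"
  using assms unfolding cartesian_def by blast

definition pair_arr ::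
  "('l, 'r) alg_arr \<Rightarrow> ('l, 'r) alg_arr \<Rightarrow> ('l, 'r) alg_arr \<Rightarrow> ('l, 'r) alg_arr \<Rightarrow> ('l, 'r) alg_arr" where
  "pair_arr c d p q = \<lparr>asrc = asrc p, afun = (\<lambda>z\<in>carrier (asrc p). enc (afun p z, afun q z)),
    atgt = fprod c d\<rparr>"

lemma enc_in_fprod [simp]:
  "enc (x, y :: 'r) \<in> carrier (fprod c d) \<longleftrightarrow>
    x \<in> carrier (asrc c) \<and> y \<in> carrier (asrc d) \<and> afun c x = afun d y"
  by (auto simp: fprod_def)

lemma in_fprodE:
  fixes c d :: "('l, 'r) alg_arr"
  assumes "z \<in> carrier (fprod c d)"
  obtains x y where "z = enc (x, y)" "x \<in> carrier (asrc c)" "y \<in> carrier (asrc d)" "afun c x = afun d y"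
  using assms by (auto simp: fprod_def)

lemma fprod_sel [simp]:
  fixes c d :: "('l, 'r) alg_arr"
  shows
  "asrc (fprod1 c d) = fprod c d" "atgt (fprod1 c d) = asrc c"
  "asrc (fprod2 c d) = fprod c d" "atgt (fprod2 c d) = asrc d"
  "z \<in> carrier (fprod c d) \<Longrightarrow> afun (fprod1 c d) z = dec1 z"
  "z \<in> carrier (fprod c d) \<Longrightarrow> afun (fprod2 c d) z = dec2 z"
  by (simp_all add: fprod1_def fprod2_def)

lemma fprod_ops:
  fixes c d :: "('l, 'r) alg_arr"
  shows
  "monoid.mult (fprod c d) = (\<lambda>z w. enc (dec1 z \<otimes>\<^bsub>asrc c\<^esub> dec1 w, dec2 z \<otimes>\<^bsub>asrc d\<^esub> dec2 w))"
  "ring.add (fprod c d) = (\<lambda>z w. enc (dec1 z \<oplus>\<^bsub>asrc c\<^esub> dec1 w, dec2 z \<oplus>\<^bsub>asrc d\<^esub> dec2 w))"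
  "\<one>\<^bsub>fprod c d\<^esub> = enc (\<one>\<^bsub>asrc c\<^esub>, \<one>\<^bsub>asrc d\<^esub>)"
  "str (fprod c d) l = enc (str (asrc c) l, str (asrc d) l)"
  "res (fprod c d) z = res (asrc c) (dec1 z)"
  by (simp_all add: fprod_def)

text \<open>
  That \<open>fprod c d\<close> is again local and Artinian is a hypothesis here.  In a deformation stack it comes
  from the gluing axiom, which puts objects over \<open>fprod c d\<close>, so that it is an object of the base.
\<close>

lemma cartesian_fprod:
  assumes c: "arr c" and d: "arr d" and eq: "atgt c = atgt d" and P: "art_alg \<Lambda> K (fprod c d)"
  shows "cartesian c d (fprod1 c d) (fprod2 c d)"
proof -
  note P' = art_algD[OF P]
  interpret P: cring "fprod c d" using P'(1) .
  have p1: "arr (fprod1 c d)"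
  proof (rule arrI)
    show "afun (fprod1 c d) \<in> extensional (carrier (asrc (fprod1 c d)))"
      by (simp add: fprod1_def)
    show "afun (fprod1 c d) (str (asrc (fprod1 c d)) l) = str (atgt (fprod1 c d)) l"
      if "l \<in> carrier \<Lambda>" for l
      using ring_hom_closed[OF P'(3) that] by (simp add: fprod_ops)
    show "afun (fprod1 c d) \<one>\<^bsub>asrc (fprod1 c d)\<^esub> = \<one>\<^bsub>atgt (fprod1 c d)\<^esub>"
      using P.one_closed by (simp add: fprod_ops)
    show "afun (fprod1 c d) (x \<oplus>\<^bsub>asrc (fprod1 c d)\<^esub> y) =
        afun (fprod1 c d) x \<oplus>\<^bsub>atgt (fprod1 c d)\<^esub> afun (fprod1 c d) y"
      if "x \<in> carrier (asrc (fprod1 c d))" "y \<in> carrier (asrc (fprod1 c d))" for x y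
      using that P.a_closed[of x y] by (simp add: fprod_ops)
    show "afun (fprod1 c d) (x \<otimes>\<^bsub>asrc (fprod1 c d)\<^esub> y) =
        afun (fprod1 c d) x \<otimes>\<^bsub>atgt (fprod1 c d)\<^esub> afun (fprod1 c d) y"
      if "x \<in> carrier (asrc (fprod1 c d))" "y \<in> carrier (asrc (fprod1 c d))" for x y
      using that P.m_closed[of x y] by (simp add: fprod_ops)
  qed (use P arrD(1)[OF c] in \<open>auto simp: fprod_ops elim: in_fprodE\<close>)
  have p2: "arr (fprod2 c d)"
  proof (rule arrI)
    show "afun (fprod2 c d) \<in> extensional (carrier (asrc (fprod2 c d)))"
      by (simp add: fprod2_def)
    show "afun (fprod2 c d) (str (asrc (fprod2 c d)) l) = str (atgt (fprod2 c d)) l"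
      if "l \<in> carrier \<Lambda>" for l
      using ring_hom_closed[OF P'(3) that] by (simp add: fprod_ops)
    show "afun (fprod2 c d) \<one>\<^bsub>asrc (fprod2 c d)\<^esub> = \<one>\<^bsub>atgt (fprod2 c d)\<^esub>"
      using P.one_closed by (simp add: fprod_ops)
    show "afun (fprod2 c d) (x \<oplus>\<^bsub>asrc (fprod2 c d)\<^esub> y) =
        afun (fprod2 c d) x \<oplus>\<^bsub>atgt (fprod2 c d)\<^esub> afun (fprod2 c d) y"
      if "x \<in> carrier (asrc (fprod2 c d))" "y \<in> carrier (asrc (fprod2 c d))" for x y
      using that P.a_closed[of x y] by (simp add: fprod_ops)
    show "afun (fprod2 c d) (x \<otimes>\<^bsub>asrc (fprod2 c d)\<^esub> y) =
        afun (fprod2 c d) x \<otimes>\<^bsub>atgt (fprod2 c d)\<^esub> afun (fprod2 c d) y"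
      if "x \<in> carrier (asrc (fprod2 c d))" "y \<in> carrier (asrc (fprod2 c d))" for x y
      using that P.m_closed[of x y] by (simp add: fprod_ops)
    \<comment> \<open>the residue of a pair is that of its first entry; both agree as \<open>c\<close> and \<open>d\<close> preserve residues\<close>
    show "res (atgt (fprod2 c d)) (afun (fprod2 c d) x) = res (asrc (fprod2 c d)) x"
      if "x \<in> carrier (asrc (fprod2 c d))" for x
    proof -
      have "x \<in> carrier (fprod c d)" using that by simp
      then obtain u v where x: "x = enc (u, v)" "u \<in> carrier (asrc c)" "v \<in> carrier (asrc d)" "afun c u = afun d v"
        by (rule in_fprodE)
      then show ?thesis using arrD(8)[OF c x(2)] arrD(8)[OF d x(3)] eq by (simp add: fprod_ops)
    qed
  qed (use P arrD(1)[OF d] in \<open>auto simp: fprod_ops elim: in_fprodE\<close>)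
  have "arr_comp c (fprod1 c d) = arr_comp d (fprod2 c d)"
    by (rule arr_eqI) (use p1 p2 c d eq in \<open>auto elim!: in_fprodE\<close>)
  moreover have "\<exists>!z. z \<in> carrier (fprod c d) \<and> afun (fprod1 c d) z = x \<and> afun (fprod2 c d) z = y"
    if "x \<in> carrier (asrc c)" "y \<in> carrier (asrc d)" "afun c x = afun d y" for x y
    using that by (intro ex1I[of _ "enc (x, y)"]) (auto elim!: in_fprodE)
  ultimately show ?thesis using p1 p2 c d eq by (simp add: cartesian_def)
qed

lemma pair_arr_sel [simp]:
  "asrc (pair_arr c d p q) = asrc p" "atgt (pair_arr c d p q) = fprod c d"
  "z \<in> carrier (asrc p) \<Longrightarrow> afun (pair_arr c d p q) z = enc (afun p z, afun q z)"
  by (simp_all add: pair_arr_def)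

lemma pair_arr:
  assumes P: "art_alg \<Lambda> K (fprod c d)" and p: "arr p" and q: "arr q"
    and sel: "asrc p = asrc q" "atgt p = asrc c" "atgt q = asrc d"
    and eq: "arr_comp c p = arr_comp d q"
  shows "arr (pair_arr c d p q)"
    and "arr_comp (fprod1 c d) (pair_arr c d p q) = p"
    and "arr_comp (fprod2 c d) (pair_arr c d p q) = q"
proof -
  interpret Z: cring "asrc p" using arrD(3)[OF p] .
  have in_P: "enc (afun p z, afun q z) \<in> carrier (fprod c d)" if "z \<in> carrier (asrc p)" for z
  proof -
    have "afun (arr_comp c p) z = afun (arr_comp d q) z" using eq by simp
    then show ?thesis using that sel arrD(9)[OF p] arrD(9)[OF q] by simp
  qed
  have str: "str (asrc p) l \<in> carrier (asrc p)" if "l \<in> carrier \<Lambda>" for l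
    using art_algD(3)[OF arrD(1)[OF p]] that by (simp add: ring_hom_closed)
  show arr: "arr (pair_arr c d p q)"
  proof (rule arrI)
    show "afun (pair_arr c d p q) \<in> extensional (carrier (asrc (pair_arr c d p q)))"
      by (simp add: pair_arr_def)
  qed (use P arrD[OF p] arrD[OF q] sel in_P str Z.a_closed Z.m_closed Z.one_closed in
      \<open>simp_all add: fprod_ops\<close>)
  show "arr_comp (fprod1 c d) (pair_arr c d p q) = p" "arr_comp (fprod2 c d) (pair_arr c d p q) = q"
    using arrD(6)[OF p] arrD(6)[OF q] sel in_P p q
    by (auto intro!: alg_arr.equality ext simp: arr_comp_def compose_def pair_arr_def fprod1_def
        fprod2_def extensional_def restrict_def)
qed

text \<open>
  The comparison map into \<open>fprod c d\<close> is bijective, which transports the gluing axioms from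
  \<open>fprod c d\<close> to any other fiber product.
\<close>

lemma cartesian_iso:
  assumes cart: "cartesian c d p q" and P: "art_alg \<Lambda> K (fprod c d)"
  obtains \<theta> \<theta>' where "arr \<theta>" "asrc \<theta> = asrc p" "atgt \<theta> = fprod c d"
    "arr \<theta>'" "asrc \<theta>' = fprod c d" "atgt \<theta>' = asrc p"
    "arr_comp \<theta>' \<theta> = arr_id (asrc p)" "arr_comp \<theta> \<theta>' = arr_id (fprod c d)"
    "arr_comp (fprod1 c d) \<theta> = p" "arr_comp (fprod2 c d) \<theta> = q"
proof -
  let ?\<theta> = "pair_arr c d p q"
  note cd = cartesianD(1-3)[OF cart] and p = cartesianD(4)[OF cart] and q = cartesianD(5)[OF cart]
    and sel = cartesianD(6-8)[OF cart] and eq = cartesianD(9)[OF cart] and uniq = cartesian_ex1[OF cart]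
  note \<theta> = pair_arr[OF P p q sel eq]
  have "bij_betw (afun ?\<theta>) (carrier (asrc ?\<theta>)) (carrier (atgt ?\<theta>))"
    unfolding bij_betw_def
  proof
    show "inj_on (afun ?\<theta>) (carrier (asrc ?\<theta>))"
    proof (rule inj_onI)
      fix z w assume zw: "z \<in> carrier (asrc ?\<theta>)" "w \<in> carrier (asrc ?\<theta>)" "afun ?\<theta> z = afun ?\<theta> w"
      have "afun (arr_comp c p) z = afun (arr_comp d q) z" using eq by simp
      then show "z = w"
        using zw uniq[of "afun p z" "afun q z"] sel arrD(9)[OF p] arrD(9)[OF q] by auto
    qed
    have "y \<in> afun ?\<theta> ` carrier (asrc ?\<theta>)" if "y \<in> carrier (fprod c d)" for y
    proof -
      obtain a b where y: "y = enc (a, b)" "a \<in> carrier (asrc c)" "b \<in> carrier (asrc d)" "afun c a = afun d b"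
        using \<open>y \<in> carrier (fprod c d)\<close> by (rule in_fprodE)
      then obtain z where "z \<in> carrier (asrc p)" "afun p z = a" "afun q z = b"
        using uniq[OF y(2-4)] by auto
      then show ?thesis using y by (intro image_eqI[of _ _ z]) auto
    qed
    then show "afun ?\<theta> ` carrier (asrc ?\<theta>) = carrier (atgt ?\<theta>)"
      using arrD(9)[OF \<theta>(1)] by auto
  qed
  from arr_inverse[OF \<theta>(1) this] \<theta> show ?thesis
    by (metis that pair_arr_sel(1,2))
qed

lemma cartesian_jointly_monic:
  assumes cart: "cartesian c d p q" and f: "arr f" "arr g" "asrc f = asrc g" "atgt f = asrc p" "atgt g = asrc p"
    and eq: "arr_comp p f = arr_comp p g" "arr_comp q f = arr_comp q g"
  shows "f = g"
proof (rule arr_eqI)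
  fix x assume x: "x \<in> carrier (asrc f)"
  have 1: "afun p (afun f x) = afun p (afun g x)" "afun q (afun f x) = afun q (afun g x)"
    using arg_cong[OF eq(1), of "\<lambda>e. afun e x"] arg_cong[OF eq(2), of "\<lambda>e. afun e x"] x f(3) by simp_all
  have mem: "afun f x \<in> carrier (asrc p)" "afun g x \<in> carrier (asrc p)"
    using arrD(9)[OF f(1), of x] arrD(9)[OF f(2), of x] f x by auto
  have "afun (arr_comp c p) (afun f x) = afun (arr_comp d q) (afun f x)"
    using cart by (simp add: cartesian_def)
  then have "afun c (afun p (afun f x)) = afun d (afun q (afun f x))"
    using mem cart by (simp add: cartesian_def)
  moreover have "afun p (afun f x) \<in> carrier (asrc c)" "afun q (afun f x) \<in> carrier (asrc d)"
    using mem cart arrD(9)[of p] arrD(9)[of q] by (auto simp: cartesian_def)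
  ultimately have "\<exists>!z. z \<in> carrier (asrc p) \<and> afun p z = afun p (afun f x) \<and> afun q z = afun q (afun f x)"
    by (intro cartesian_ex1[OF cart])
  then show "afun f x = afun g x" using mem 1 by metis
qed (use f in auto)

subsection \<open>Arrows between the algebras \<open>k[V]\<close>\<close>

lemma sqz_unit_sel [simp]:
  "asrc (sqz_unit K V) = K" "atgt (sqz_unit K V) = sqz K V"
  "a \<in> carrier K \<Longrightarrow> afun (sqz_unit K V) a = enc (a, \<zero>\<^bsub>V\<^esub>)"
  by (simp_all add: sqz_unit_def)

lemma sqz_unit_arr [intro, simp]:
  assumes V: "module K V" and A: "art_alg \<Lambda> K (sqz K V)"
  shows "arr (sqz_unit K V)"
proof -
  interpret V: module K V by fact
  show ?thesis
  proof (rule arrI)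
    show "afun (sqz_unit K V) \<in> extensional (carrier (asrc (sqz_unit K V)))"
      by (simp add: sqz_unit_def)
  qed (use A art_alg_K str_K in \<open>simp_all add: V.smult_r_null ring_hom_closed res_K\<close>)
qed

lemma sqz_map_sel [simp]:
  "asrc (sqz_map K V W \<psi>) = sqz K V" "atgt (sqz_map K V W \<psi>) = sqz K W"
  "a \<in> carrier K \<Longrightarrow> v \<in> carrier V \<Longrightarrow> afun (sqz_map K V W \<psi>) (enc (a, v)) = enc (a, \<psi> v)"
  by (simp_all add: sqz_map_def)

lemma linear_mapD:
  assumes "linear_map K V W \<psi>"
  shows "\<And>x. x \<in> carrier V \<Longrightarrow> \<psi> x \<in> carrier W"
    "\<And>x y. x \<in> carrier V \<Longrightarrow> y \<in> carrier V \<Longrightarrow> \<psi> (x \<oplus>\<^bsub>V\<^esub> y) = \<psi> x \<oplus>\<^bsub>W\<^esub> \<psi> y"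
    "\<And>a x. a \<in> carrier K \<Longrightarrow> x \<in> carrier V \<Longrightarrow> \<psi> (a \<odot>\<^bsub>V\<^esub> x) = a \<odot>\<^bsub>W\<^esub> \<psi> x"
  using assms by (auto simp: linear_map_def)

lemma linear_map_zero:
  assumes "module K V" "module K W" "linear_map K V W \<psi>"
  shows "\<psi> \<zero>\<^bsub>V\<^esub> = \<zero>\<^bsub>W\<^esub>"
proof -
  interpret V: module K V by fact
  interpret W: module K W by fact
  have "\<psi> (\<zero>\<^bsub>K\<^esub> \<odot>\<^bsub>V\<^esub> \<zero>\<^bsub>V\<^esub>) = \<zero>\<^bsub>K\<^esub> \<odot>\<^bsub>W\<^esub> \<psi> \<zero>\<^bsub>V\<^esub>"
    by (rule linear_mapD(3)[OF assms(3)]) auto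
  then show ?thesis
    using linear_mapD(1)[OF assms(3), of "\<zero>\<^bsub>V\<^esub>"] by (simp add: V.smult_l_null W.smult_l_null)
qed

lemma sqz_map_arr [intro, simp]:
  assumes V: "module K V" "art_alg \<Lambda> K (sqz K V)" and W: "module K W" "art_alg \<Lambda> K (sqz K W)"
    and \<psi>: "linear_map K V W \<psi>"
  shows "arr (sqz_map K V W \<psi>)"
proof -
  interpret V: module K V by fact
  interpret W: module K W by fact
  note lin = linear_mapD[OF \<psi>] linear_map_zero[OF V(1) W(1) \<psi>]
  show ?thesis
  proof (rule arrI)
    show "afun (sqz_map K V W \<psi>) \<in> extensional (carrier (asrc (sqz_map K V W \<psi>)))"
      by (simp add: sqz_map_def)
    show "afun (sqz_map K V W \<psi>) (str (asrc (sqz_map K V W \<psi>)) l) = str (atgt (sqz_map K V W \<psi>)) l"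
      if "l \<in> carrier \<Lambda>" for l
      using lin that str_K by (simp add: ring_hom_closed)
  qed (use V W lin in \<open>auto simp: carrier_sqz\<close>)
qed

lemma sqz_map_id: "module K V \<Longrightarrow> art_alg \<Lambda> K (sqz K V) \<Longrightarrow> sqz_map K V V (\<lambda>v. v) = arr_id (sqz K V)"
  by (rule arr_eqI) (auto simp: linear_map_def carrier_sqz)

lemma linear_map_comp: "linear_map K U V \<psi> \<Longrightarrow> linear_map K V W \<chi> \<Longrightarrow> linear_map K U W (\<chi> \<circ> \<psi>)"
  by (auto simp: linear_map_def Pi_iff)

lemma sqz_map_comp:
  assumes "module K U" "art_alg \<Lambda> K (sqz K U)" "module K V" "art_alg \<Lambda> K (sqz K V)"
    "module K W" "art_alg \<Lambda> K (sqz K W)" "linear_map K U V \<psi>" "linear_map K V W \<chi>"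
  shows "sqz_map K U W (\<chi> \<circ> \<psi>) = arr_comp (sqz_map K V W \<chi>) (sqz_map K U V \<psi>)"
  by (rule arr_eqI)
    (use assms linear_map_comp[OF assms(7,8)] linear_mapD(1)[OF assms(7)] in \<open>auto simp: carrier_sqz\<close>)

lemma sqz_map_unit:
  assumes "module K V" "art_alg \<Lambda> K (sqz K V)" "module K W" "art_alg \<Lambda> K (sqz K W)" "linear_map K V W \<psi>"
  shows "arr_comp (sqz_map K V W \<psi>) (sqz_unit K V) = sqz_unit K W"
proof -
  interpret V: module K V by fact
  show ?thesis
    by (rule arr_eqI) (use assms linear_map_zero[OF assms(1,3,5)] in auto)
qed

subsection \<open>Kernels of small extensions\<close>

lemma small_extensionD:
  assumes "small_extension \<Lambda> K c"
  shows "arr c" "arr_surj c"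
    "\<And>x y. x \<in> arr_ker c \<Longrightarrow> y \<in> carrier (asrc c) \<Longrightarrow> res (asrc c) y = \<zero>\<^bsub>K\<^esub> \<Longrightarrow>
      y \<otimes>\<^bsub>asrc c\<^esub> x = \<zero>\<^bsub>asrc c\<^esub>"
proof -
  show c: "arr c" "arr_surj c" using assms by (simp_all add: small_extension_def)
  interpret A: cring "asrc c" using arrD(3)[OF c(1)] .
  fix x y assume x: "x \<in> arr_ker c" and y: "y \<in> carrier (asrc c)" "res (asrc c) y = \<zero>\<^bsub>K\<^esub>"
  then have "y \<in> max_ideal (asrc c)"
    by (simp only: max_ideal_eq_kernel_of_residue[OF arrD(1)[OF c(1)]] mem_a_kernel)
  then have "x \<otimes>\<^bsub>asrc c\<^esub> y = \<zero>\<^bsub>asrc c\<^esub>"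
    using assms x by (simp add: small_extension_def)
  then show "y \<otimes>\<^bsub>asrc c\<^esub> x = \<zero>\<^bsub>asrc c\<^esub>"
    using x y by (simp add: A.m_comm mem_arr_ker)
qed

text \<open>
  The kernel of a small extension is killed by the maximal ideal, so multiplication on it only sees
  residues; this makes it a vector space over \<open>K\<close>.
\<close>

lemma ker_mult_cong:
  assumes c: "small_extension \<Lambda> K c" and x: "x \<in> arr_ker c"
    and a: "a \<in> carrier (asrc c)" "b \<in> carrier (asrc c)" "res (asrc c) a = res (asrc c) b"
  shows "a \<otimes>\<^bsub>asrc c\<^esub> x = b \<otimes>\<^bsub>asrc c\<^esub> x"
proof -
  note c' = small_extensionD[OF c]
  interpret A: cring "asrc c" using arrD(3)[OF c'(1)] .
  have xA: "x \<in> carrier (asrc c)" using x by (simp add: mem_arr_ker)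
  have "afun (res_arr K (asrc c)) (a \<ominus>\<^bsub>asrc c\<^esub> b) =
      afun (res_arr K (asrc c)) a \<ominus>\<^bsub>K\<^esub> afun (res_arr K (asrc c)) b"
    using arr_minus[OF res_arr_arr[OF arrD(1)[OF c'(1)]], of a b] a by simp
  then have "res (asrc c) (a \<ominus>\<^bsub>asrc c\<^esub> b) = \<zero>\<^bsub>K\<^esub>"
    using a art_algD(4)[OF arrD(1)[OF c'(1)]] by (simp add: ring_hom_closed)
  then have "(a \<ominus>\<^bsub>asrc c\<^esub> b) \<otimes>\<^bsub>asrc c\<^esub> x = \<zero>\<^bsub>asrc c\<^esub>"
    using c'(3)[OF x] a by simp
  then have "a \<otimes>\<^bsub>asrc c\<^esub> x \<ominus>\<^bsub>asrc c\<^esub> b \<otimes>\<^bsub>asrc c\<^esub> x = \<zero>\<^bsub>asrc c\<^esub>"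
    using a xA by (simp add: A.minus_eq A.l_distr A.l_minus)
  then show ?thesis using a xA A.r_right_minus_eq by simp
qed

lemma ker_space_sel [simp]:
  "carrier (ker_space c) = arr_ker c" "ring.add (ker_space c) = ring.add (asrc c)"
  "\<zero>\<^bsub>ker_space c\<^esub> = \<zero>\<^bsub>asrc c\<^esub>"
  by (simp_all add: ker_space_def)

lemma ker_smult:
  assumes c: "small_extension \<Lambda> K c" and x: "x \<in> arr_ker c" and a: "a \<in> carrier (asrc c)"
  shows "res (asrc c) a \<odot>\<^bsub>ker_space c\<^esub> x = a \<otimes>\<^bsub>asrc c\<^esub> x"
proof -
  let ?b = "SOME b. b \<in> carrier (asrc c) \<and> res (asrc c) b = res (asrc c) a"
  have "?b \<in> carrier (asrc c) \<and> res (asrc c) ?b = res (asrc c) a"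
    by (rule someI[of _ a]) (use a in simp)
  then show ?thesis
    using ker_mult_cong[OF c x, of ?b a] a by (simp add: ker_space_def)
qed

lemma lift_residue:
  assumes "art_alg \<Lambda> K A" "a \<in> carrier K"
  obtains b where "b \<in> carrier A" "res A b = a"
  using art_algD(5)[OF assms(1)] assms(2) by (metis imageE)

lemma ker_closed:
  assumes c: "arr c" and x: "x \<in> arr_ker c"
  shows "x \<in> carrier (asrc c)"
    "y \<in> arr_ker c \<Longrightarrow> x \<oplus>\<^bsub>asrc c\<^esub> y \<in> arr_ker c"
    "a \<in> carrier (asrc c) \<Longrightarrow> a \<otimes>\<^bsub>asrc c\<^esub> x \<in> arr_ker c"
proof -
  interpret A: cring "asrc c" using arrD(3)[OF c] .
  interpret B: cring "atgt c" using arrD(4)[OF c] .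
  show "x \<in> carrier (asrc c)"
    "y \<in> arr_ker c \<Longrightarrow> x \<oplus>\<^bsub>asrc c\<^esub> y \<in> arr_ker c"
    "a \<in> carrier (asrc c) \<Longrightarrow> a \<otimes>\<^bsub>asrc c\<^esub> x \<in> arr_ker c"
    using x c by (auto simp: mem_arr_ker arrD(9,10,11))
qed

lemma module_ker_space:
  assumes c: "small_extension \<Lambda> K c"
  shows "module K (ker_space c)"
proof -
  note c' = small_extensionD[OF c]
  note A = arrD(1)[OF c'(1)] and cl = ker_closed[OF c'(1)]
  interpret A: cring "asrc c" using arrD(3)[OF c'(1)] .
  have hom: "res (asrc c) \<in> ring_hom (asrc c) K" using art_algD(4)[OF A] .
  have zero: "\<zero>\<^bsub>asrc c\<^esub> \<in> arr_ker c"
    using arrD(13)[OF c'(1)] by (simp add: mem_arr_ker)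
  show ?thesis
  proof (rule moduleI)
    show "abelian_group (ker_space c)"
    proof (rule abelian_groupI)
      fix x assume "x \<in> carrier (ker_space c)"
      then have x: "x \<in> arr_ker c" by simp
      have "(\<ominus>\<^bsub>asrc c\<^esub> \<one>\<^bsub>asrc c\<^esub>) \<otimes>\<^bsub>asrc c\<^esub> x \<in> arr_ker c"
        by (rule cl(3)[OF x]) simp
      then have "\<ominus>\<^bsub>asrc c\<^esub> x \<in> arr_ker c"
        using cl(1)[OF x] by (simp add: A.l_minus)
      then show "\<exists>y\<in>carrier (ker_space c). y \<oplus>\<^bsub>ker_space c\<^esub> x = \<zero>\<^bsub>ker_space c\<^esub>"
        using cl(1)[OF x] by (intro bexI[of _ "\<ominus>\<^bsub>asrc c\<^esub> x"]) (auto simp: A.l_neg)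
    qed (use zero cl in \<open>auto simp: A.a_ac\<close>)
    fix a assume "a \<in> carrier K"
    then obtain a' where a': "a' \<in> carrier (asrc c)" "a = res (asrc c) a'"
      using lift_residue[OF A] by metis
    show "a \<odot>\<^bsub>ker_space c\<^esub> x \<in> carrier (ker_space c)" if "x \<in> carrier (ker_space c)" for x
      using that a' cl(3) by (simp add: ker_smult[OF c])
    show "a \<odot>\<^bsub>ker_space c\<^esub> (x \<oplus>\<^bsub>ker_space c\<^esub> y) =
        a \<odot>\<^bsub>ker_space c\<^esub> x \<oplus>\<^bsub>ker_space c\<^esub> a \<odot>\<^bsub>ker_space c\<^esub> y"
      if "x \<in> carrier (ker_space c)" "y \<in> carrier (ker_space c)" for x y
      using that a' cl by (simp add: ker_smult[OF c] A.r_distr)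
    fix b assume "b \<in> carrier K"
    then obtain b' where b': "b' \<in> carrier (asrc c)" "b = res (asrc c) b'"
      using lift_residue[OF A] by metis
    fix x assume "x \<in> carrier (ker_space c)"
    then have x: "x \<in> arr_ker c" by simp
    have ab: "a \<oplus>\<^bsub>K\<^esub> b = res (asrc c) (a' \<oplus>\<^bsub>asrc c\<^esub> b')" "a \<otimes>\<^bsub>K\<^esub> b = res (asrc c) (a' \<otimes>\<^bsub>asrc c\<^esub> b')"
      using a' b' hom by (simp_all add: ring_hom_add ring_hom_mult)
    show "(a \<oplus>\<^bsub>K\<^esub> b) \<odot>\<^bsub>ker_space c\<^esub> x =
        a \<odot>\<^bsub>ker_space c\<^esub> x \<oplus>\<^bsub>ker_space c\<^esub> b \<odot>\<^bsub>ker_space c\<^esub> x"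
      unfolding ab using x a' b' cl(1)[OF x] by (simp add: ker_smult[OF c] A.l_distr)
    show "(a \<otimes>\<^bsub>K\<^esub> b) \<odot>\<^bsub>ker_space c\<^esub> x = a \<odot>\<^bsub>ker_space c\<^esub> (b \<odot>\<^bsub>ker_space c\<^esub> x)"
      unfolding ab using x a' b' cl(1)[OF x] cl(3)[OF x] by (simp add: ker_smult[OF c] A.m_assoc)
  next
    fix x assume "x \<in> carrier (ker_space c)"
    then have x: "x \<in> arr_ker c" by simp
    show "\<one>\<^bsub>K\<^esub> \<odot>\<^bsub>ker_space c\<^esub> x = x"
      using ker_smult[OF c x A.one_closed] cl(1)[OF x] ring_hom_one[OF hom] by simp
  qed (rule K.cring_axioms)
qed

text \<open>
  Subspaces of the kernel are ideals of \<open>A'\<close>, so the chain condition is inherited from \<open>A'\<close>.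
\<close>

lemma art_alg_sqz_ker:
  assumes c: "small_extension \<Lambda> K c"
  shows "art_alg \<Lambda> K (sqz K (ker_space c))"
proof (rule art_alg_sqz[OF module_ker_space[OF c]])
  note c' = small_extensionD[OF c]
  note A = arrD(1)[OF c'(1)]
  interpret A: cring "asrc c" using arrD(3)[OF c'(1)] .
  have ideal: "ideal J (asrc c)" if J: "submodule J K (ker_space c)" for J
  proof -
    interpret J: submodule J K "ker_space c" by fact
    have sub: "x \<in> arr_ker c" if "x \<in> J" for x using J.subset that by auto
    have JA: "x \<in> carrier (asrc c)" if "x \<in> J" for x
      using ker_closed(1)[OF c'(1) sub[OF that]] .
    have mult: "a \<otimes>\<^bsub>asrc c\<^esub> x \<in> J" if x: "x \<in> J" and a: "a \<in> carrier (asrc c)" for x a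
    proof -
      have "res (asrc c) a \<in> carrier K"
        using a art_algD(4)[OF A] by (simp add: ring_hom_closed)
      then show ?thesis
        using J.smult_closed[OF _ x, of "res (asrc c) a"] ker_smult[OF c sub[OF x] a] by simp
    qed
    show ?thesis
    proof (rule idealI)
      show "subgroup J (add_monoid (asrc c))"
      proof (rule A.add.subgroupI)
        show "\<ominus>\<^bsub>asrc c\<^esub> x \<in> J" if "x \<in> J" for x
          using mult[OF that, of "\<ominus>\<^bsub>asrc c\<^esub> \<one>\<^bsub>asrc c\<^esub>"] JA[OF that] by (simp add: A.l_minus)
        show "J \<noteq> {}" using J.one_closed by auto
        show "x \<oplus>\<^bsub>asrc c\<^esub> y \<in> J" if "x \<in> J" "y \<in> J" for x y
          using J.m_closed[OF that] by simp
      qed (use JA in auto)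
      show "x \<otimes>\<^bsub>asrc c\<^esub> a \<in> J" if "a \<in> J" "x \<in> carrier (asrc c)" for a x
        using mult that by simp
      show "a \<otimes>\<^bsub>asrc c\<^esub> x \<in> J" if "a \<in> J" "x \<in> carrier (asrc c)" for a x
        using mult[OF that] that JA by (simp add: A.m_comm)
    qed (rule A.ring_axioms)
  qed
  show "submodule_dcc (ker_space c)"
    unfolding submodule_dcc_def
  proof (intro allI impI)
    fix J :: "nat \<Rightarrow> 'r set"
    assume "\<forall>n. submodule (J n) K (ker_space c) \<and> J (Suc n) \<subseteq> J n"
    then have "\<forall>n. ideal (J n) (asrc c) \<and> J (Suc n) \<subseteq> J n" using ideal by blast
    then show "\<exists>n. \<forall>m\<ge>n. J m = J n"
      using A unfolding art_alg_def artinian_ring_def by blast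
  qed
qed

text \<open>
  Allows the law of a small extension and the law of \<open>k[V]\<close> to be treated at once: \<open>j\<close> is the
  identity for the former and \<open>v \<mapsto> (0, v)\<close> for the latter.
\<close>

definition kernel_iso :: "('l, 'r) alg_arr \<Rightarrow> ('r, 'r) module \<Rightarrow> ('r \<Rightarrow> 'r) \<Rightarrow> bool" where
  "kernel_iso c V j \<longleftrightarrow> bij_betw j (carrier V) (arr_ker c) \<and>
    (\<forall>v\<in>carrier V. \<forall>w\<in>carrier V. j (v \<oplus>\<^bsub>V\<^esub> w) = j v \<oplus>\<^bsub>asrc c\<^esub> j w)"

lemma kernel_isoD:
  assumes "kernel_iso c V j"
  shows "\<And>v. v \<in> carrier V \<Longrightarrow> j v \<in> arr_ker c"
    "\<And>v w. v \<in> carrier V \<Longrightarrow> w \<in> carrier V \<Longrightarrow> j v = j w \<Longrightarrow> v = w"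
    "\<And>x. x \<in> arr_ker c \<Longrightarrow> \<exists>v\<in>carrier V. j v = x"
    "\<And>v w. v \<in> carrier V \<Longrightarrow> w \<in> carrier V \<Longrightarrow> j (v \<oplus>\<^bsub>V\<^esub> w) = j v \<oplus>\<^bsub>asrc c\<^esub> j w"
proof -
  have bij: "bij_betw j (carrier V) (arr_ker c)" using assms by (simp add: kernel_iso_def)
  show "\<And>v. v \<in> carrier V \<Longrightarrow> j v \<in> arr_ker c" using bij bij_betwE by blast
  show "\<And>v w. v \<in> carrier V \<Longrightarrow> w \<in> carrier V \<Longrightarrow> j v = j w \<Longrightarrow> v = w"
    using bij by (auto simp: bij_betw_def dest: inj_onD)
  show "\<And>x. x \<in> arr_ker c \<Longrightarrow> \<exists>v\<in>carrier V. j v = x"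
    using bij by (metis bij_betw_imp_surj_on imageE)
  show "\<And>v w. v \<in> carrier V \<Longrightarrow> w \<in> carrier V \<Longrightarrow> j (v \<oplus>\<^bsub>V\<^esub> w) = j v \<oplus>\<^bsub>asrc c\<^esub> j w"
    using assms by (simp add: kernel_iso_def)
qed

lemma kernel_iso_ker_space: "kernel_iso c (ker_space c) (\<lambda>v. v)"
  by (simp add: kernel_iso_def bij_betw_def)

lemma small_extension_sqz:
  assumes V: "module K V" and A: "art_alg \<Lambda> K (sqz K V)"
  shows "small_extension \<Lambda> K (res_arr K (sqz K V))"
    and "kernel_iso (res_arr K (sqz K V)) V (\<lambda>v. enc (\<zero>\<^bsub>K\<^esub>, v))"
proof -
  interpret V: module K V by fact
  have ker: "z \<in> arr_ker (res_arr K (sqz K V)) \<longleftrightarrow> (\<exists>v\<in>carrier V. z = enc (\<zero>\<^bsub>K\<^esub>, v))" for z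
    unfolding mem_arr_ker by (auto simp: carrier_sqz)
  show "small_extension \<Lambda> K (res_arr K (sqz K V))"
    unfolding small_extension_def
  proof (intro conjI ballI)
    fix x y assume "x \<in> arr_ker (res_arr K (sqz K V))" "y \<in> max_ideal (asrc (res_arr K (sqz K V)))"
    moreover from this(2) have "y \<in> arr_ker (res_arr K (sqz K V))"
      using max_ideal_eq_kernel_of_residue[OF A] by (simp add: mem_a_kernel mem_arr_ker)
    ultimately show "x \<otimes>\<^bsub>asrc (res_arr K (sqz K V))\<^esub> y = \<zero>\<^bsub>asrc (res_arr K (sqz K V))\<^esub>"
      unfolding ker by (auto simp: V.smult_l_null)
  qed (use A res_arr_surj[OF A] in auto)
  show "kernel_iso (res_arr K (sqz K V)) V (\<lambda>v. enc (\<zero>\<^bsub>K\<^esub>, v))"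
    unfolding kernel_iso_def bij_betw_def
    by (auto simp: inj_on_def ker image_iff)
qed

subsection \<open>The map \<open>\<sigma>\<close>\<close>

abbreviation "Pr A V \<equiv> fprod (res_arr K A) (res_arr K (sqz K V))"
abbreviation "pr1 A V \<equiv> fprod1 (res_arr K A) (res_arr K (sqz K V))"
abbreviation "pr2 A V \<equiv> fprod2 (res_arr K A) (res_arr K (sqz K V))"

lemma sigma_sel [simp]:
  "asrc (sigma K A V j) = Pr A V" "atgt (sigma K A V j) = A"
  by (simp_all add: sigma_def Let_def)

lemma sigma_app:
  "x \<in> carrier A \<Longrightarrow> v \<in> carrier V \<Longrightarrow> a \<in> carrier K \<Longrightarrow> res A x = a \<Longrightarrow>
    afun (sigma K A V j) (enc (x, enc (a, v))) = x \<oplus>\<^bsub>A\<^esub> j v"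
  by (simp add: sigma_def Let_def)

lemma in_PrE:
  assumes "z \<in> carrier (Pr A V)"
  obtains x v where "z = enc (x, enc (res A x, v))" "x \<in> carrier A" "v \<in> carrier V"
    "res A x \<in> carrier K"
  using assms by (elim in_fprodE) (auto simp: carrier_sqz)

lemma cartesian_pr:
  assumes "art_alg \<Lambda> K A" "art_alg \<Lambda> K (sqz K V)" "art_alg \<Lambda> K (Pr A V)"
  shows "cartesian (res_arr K A) (res_arr K (sqz K V)) (pr1 A V) (pr2 A V)"
  using assms by (intro cartesian_fprod) auto

text \<open>
  The reason for the torsor statements.  Two elements of \<open>A'\<close> with the same image in \<open>A\<close> differ by a
  unique element of the kernel, so \<open>(x, \<pi>(x) + v) \<mapsto> (x + j v, x)\<close> identifies \<open>A' \<times>\<^sub>k k[V]\<close> with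
  \<open>A' \<times>\<^sub>A A'\<close>.
\<close>

lemma cartesian_sigma:
  assumes c: "small_extension \<Lambda> K c" and V: "art_alg \<Lambda> K (sqz K V)" and j: "kernel_iso c V j"
    and \<sigma>: "arr (sigma K (asrc c) V j)"
  shows "cartesian c c (sigma K (asrc c) V j) (pr1 (asrc c) V)"
proof -
  note c' = small_extensionD[OF c] and j' = kernel_isoD[OF j]
  note A = arrD(1)[OF c'(1)] and jA = ker_closed(1)[OF c'(1) j'(1)]
  interpret A: cring "asrc c" using arrD(3)[OF c'(1)] .
  interpret B: cring "atgt c" using arrD(4)[OF c'(1)] .
  have P: "art_alg \<Lambda> K (Pr (asrc c) V)" using arrD(1)[OF \<sigma>] by simp
  note pr = cartesianD[OF cartesian_pr[OF A V P]]
  have "arr_comp c (sigma K (asrc c) V j) = arr_comp c (pr1 (asrc c) V)"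
  proof (rule arr_eqI)
    fix z assume "z \<in> carrier (asrc (arr_comp c (sigma K (asrc c) V j)))"
    then have "z \<in> carrier (Pr (asrc c) V)" by simp
    then obtain x v where z: "z = enc (x, enc (res (asrc c) x, v))" "x \<in> carrier (asrc c)"
      "v \<in> carrier V" "res (asrc c) x \<in> carrier K"
      by (rule in_PrE)
    have "afun c (j v) = \<zero>\<^bsub>atgt c\<^esub>" using j'(1)[OF z(3)] by (simp add: mem_arr_ker)
    then show "afun (arr_comp c (sigma K (asrc c) V j)) z = afun (arr_comp c (pr1 (asrc c) V)) z"
      using z jA[OF z(3)] arrD(9,10)[OF c'(1)] by (simp add: sigma_app)
  qed (use c' \<sigma> pr in auto)
  moreover have "\<exists>!z. z \<in> carrier (asrc (sigma K (asrc c) V j)) \<and>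
      afun (sigma K (asrc c) V j) z = x \<and> afun (pr1 (asrc c) V) z = y"
    if xy: "x \<in> carrier (asrc c)" "y \<in> carrier (asrc c)" "afun c x = afun c y" for x y
  proof -
    have "x \<ominus>\<^bsub>asrc c\<^esub> y \<in> arr_ker c"
      using xy arr_minus[OF c'(1), of x y] arrD(9)[OF c'(1)] by (simp add: mem_arr_ker)
    then obtain v where v: "v \<in> carrier V" "j v = x \<ominus>\<^bsub>asrc c\<^esub> y" using j'(3) by blast
    have yx: "y \<oplus>\<^bsub>asrc c\<^esub> (x \<ominus>\<^bsub>asrc c\<^esub> y) = x"
      using xy by (simp add: A.minus_eq A.a_ac A.r_neg1 A.r_neg2 A.r_neg)
    have ry: "res (asrc c) y \<in> carrier K"
      using xy art_algD(4)[OF A] by (simp add: ring_hom_closed)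
    show ?thesis
    proof (rule ex1I[of _ "enc (y, enc (res (asrc c) y, v))"])
      show "enc (y, enc (res (asrc c) y, v)) \<in> carrier (asrc (sigma K (asrc c) V j)) \<and>
          afun (sigma K (asrc c) V j) (enc (y, enc (res (asrc c) y, v))) = x \<and>
          afun (pr1 (asrc c) V) (enc (y, enc (res (asrc c) y, v))) = y"
        using xy v yx ry by (simp add: sigma_app)
    next
      fix z
      assume z: "z \<in> carrier (asrc (sigma K (asrc c) V j)) \<and>
          afun (sigma K (asrc c) V j) z = x \<and> afun (pr1 (asrc c) V) z = y"
      then have "z \<in> carrier (Pr (asrc c) V)" by simp
      then obtain x' w where z': "z = enc (x', enc (res (asrc c) x', w))" "x' \<in> carrier (asrc c)"
        "w \<in> carrier V" "res (asrc c) x' \<in> carrier K"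
        by (rule in_PrE)
      then have "x' = y" using z by simp
      then have "y \<oplus>\<^bsub>asrc c\<^esub> j w = y \<oplus>\<^bsub>asrc c\<^esub> j v"
        using z sigma_app[OF z'(2,3,4) refl, of j] v yx unfolding z'(1) by simp
      then have "w = v"
        using j'(2)[OF z'(3) v(1)] jA z'(3) v(1) xy by (metis A.add.l_cancel)
      then show "z = enc (y, enc (res (asrc c) y, v))"
        using z' \<open>x' = y\<close> by simp
    qed
  qed
  ultimately show ?thesis
    using c' \<sigma> pr by (simp add: cartesian_def)
qed

definition Pr_map ::
  "('r, 'r) module \<Rightarrow> ('r, 'r) module \<Rightarrow> ('l, 'r) alg_arr \<Rightarrow> ('r \<Rightarrow> 'r) \<Rightarrow> ('l, 'r) alg_arr" where
  "Pr_map V W h \<psi> = pair_arr (res_arr K (atgt h)) (res_arr K (sqz K W))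
    (arr_comp h (pr1 (asrc h) V)) (arr_comp (sqz_map K V W \<psi>) (pr2 (asrc h) V))"

lemma Pr_map:
  assumes h: "arr h" and V: "module K V" "art_alg \<Lambda> K (sqz K V)"
    and W: "module K W" "art_alg \<Lambda> K (sqz K W)" and \<psi>: "linear_map K V W \<psi>"
    and P: "art_alg \<Lambda> K (Pr (asrc h) V)" and Q: "art_alg \<Lambda> K (Pr (atgt h) W)"
  shows "arr (Pr_map V W h \<psi>)" "asrc (Pr_map V W h \<psi>) = Pr (asrc h) V"
    "atgt (Pr_map V W h \<psi>) = Pr (atgt h) W"
    "arr_comp (pr1 (atgt h) W) (Pr_map V W h \<psi>) = arr_comp h (pr1 (asrc h) V)"
    "arr_comp (pr2 (atgt h) W) (Pr_map V W h \<psi>) = arr_comp (sqz_map K V W \<psi>) (pr2 (asrc h) V)"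
proof -
  note pr = cartesianD[OF cartesian_pr[OF arrD(1)[OF h] V(2) P]]
  have *: "arr (arr_comp h (pr1 (asrc h) V))" "arr (arr_comp (sqz_map K V W \<psi>) (pr2 (asrc h) V))"
    using h pr sqz_map_arr[OF V W \<psi>] by auto
  have eq: "arr_comp (res_arr K (atgt h)) (arr_comp h (pr1 (asrc h) V)) =
      arr_comp (res_arr K (sqz K W)) (arr_comp (sqz_map K V W \<psi>) (pr2 (asrc h) V))"
    using * by (simp add: arr_comp_res)
  note pair = pair_arr[OF Q * _ _ _ eq]
  show "arr (Pr_map V W h \<psi>)" "asrc (Pr_map V W h \<psi>) = Pr (asrc h) V"
    "atgt (Pr_map V W h \<psi>) = Pr (atgt h) W"
    "arr_comp (pr1 (atgt h) W) (Pr_map V W h \<psi>) = arr_comp h (pr1 (asrc h) V)"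
    "arr_comp (pr2 (atgt h) W) (Pr_map V W h \<psi>) = arr_comp (sqz_map K V W \<psi>) (pr2 (asrc h) V)"
    using pair by (simp_all add: Pr_map_def)
qed

text \<open>
  On elements: \<open>h (x + j v) = h x + i (\<psi> v)\<close>.
\<close>

lemma sigma_natural:
  assumes h: "arr h" and V: "module K V" "art_alg \<Lambda> K (sqz K V)"
    and W: "module K W" "art_alg \<Lambda> K (sqz K W)" and \<psi>: "linear_map K V W \<psi>"
    and \<sigma>: "arr (sigma K (asrc h) V j)" and \<tau>: "arr (sigma K (atgt h) W i)"
    and j: "j \<in> carrier V \<rightarrow> carrier (asrc h)"
    and compat: "\<And>v. v \<in> carrier V \<Longrightarrow> afun h (j v) = i (\<psi> v)"
  shows "arr_comp h (sigma K (asrc h) V j) = arr_comp (sigma K (atgt h) W i) (Pr_map V W h \<psi>)"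
proof -
  have P: "art_alg \<Lambda> K (Pr (asrc h) V)" "art_alg \<Lambda> K (Pr (atgt h) W)"
    using arrD(1)[OF \<sigma>] arrD(1)[OF \<tau>] by simp_all
  note H = Pr_map[OF h V W \<psi> P]
  note pr = cartesianD[OF cartesian_pr[OF arrD(1)[OF h] V(2) P(1)]]
  show ?thesis
  proof (rule arr_eqI)
    fix z assume "z \<in> carrier (asrc (arr_comp h (sigma K (asrc h) V j)))"
    then have zP: "z \<in> carrier (Pr (asrc h) V)" by simp
    then obtain x v where z: "z = enc (x, enc (res (asrc h) x, v))" "x \<in> carrier (asrc h)"
      "v \<in> carrier V" "res (asrc h) x \<in> carrier K"
      by (rule in_PrE)
    have jv: "j v \<in> carrier (asrc h)" using j z(3) by auto
    have "afun (Pr_map V W h \<psi>) z = enc (afun h x, enc (res (asrc h) x, \<psi> v))"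
      using z zP by (simp add: Pr_map_def)
    moreover have "afun (sigma K (atgt h) W i) (enc (afun h x, enc (res (asrc h) x, \<psi> v))) =
        afun h x \<oplus>\<^bsub>atgt h\<^esub> i (\<psi> v)"
      using z arrD(8,9)[OF h z(2)] linear_mapD(1)[OF \<psi> z(3)] by (intro sigma_app) auto
    ultimately have "afun (arr_comp (sigma K (atgt h) W i) (Pr_map V W h \<psi>)) z =
        afun h x \<oplus>\<^bsub>atgt h\<^esub> i (\<psi> v)"
      using zP H(2) by simp
    moreover have "afun (arr_comp h (sigma K (asrc h) V j)) z = afun h x \<oplus>\<^bsub>atgt h\<^esub> i (\<psi> v)"
      using zP z jv compat[OF z(3)] arrD(10)[OF h z(2) jv] by (simp add: sigma_app)
    ultimately show "afun (arr_comp h (sigma K (asrc h) V j)) z =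
        afun (arr_comp (sigma K (atgt h) W i) (Pr_map V W h \<psi>)) z"
      by simp
  qed (use h \<sigma> \<tau> H in auto)
qed

text \<open>
  On elements of \<open>(A' \<times>\<^sub>k k[V]) \<times>\<^sub>k k[V]\<close> this is \<open>(x + v) + w = x + (v + w)\<close>: the map \<open>\<tau>\<close> adds
  the first two entries, \<open>\<rho>\<close> forgets the first entry, and \<open>\<kappa>\<close> adds the last two.
\<close>

lemma sigma_assoc:
  assumes c: "small_extension \<Lambda> K c" and V: "module K V" "art_alg \<Lambda> K (sqz K V)"
    and j: "kernel_iso c V j"
    and \<sigma>: "arr (sigma K (asrc c) V j)" and \<sigma>0: "arr (sigma K (sqz K V) V (\<lambda>v. enc (\<zero>\<^bsub>K\<^esub>, v)))"
    and Q: "art_alg \<Lambda> K (Pr (Pr (asrc c) V) V)"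
  defines "q1 \<equiv> pr1 (Pr (asrc c) V) V" and "q2 \<equiv> pr2 (Pr (asrc c) V) V"
  obtains \<tau> \<rho> \<kappa> where "arr \<tau>" "arr \<rho>" "arr \<kappa>"
    "asrc \<tau> = Pr (Pr (asrc c) V) V" "asrc \<rho> = Pr (Pr (asrc c) V) V" "asrc \<kappa> = Pr (Pr (asrc c) V) V"
    "atgt \<tau> = Pr (asrc c) V" "atgt \<rho> = Pr (sqz K V) V" "atgt \<kappa> = Pr (asrc c) V"
    "arr_comp (pr1 (asrc c) V) \<tau> = arr_comp (sigma K (asrc c) V j) q1"
    "arr_comp (pr2 (asrc c) V) \<tau> = q2"
    "arr_comp (pr1 (sqz K V) V) \<rho> = arr_comp (pr2 (asrc c) V) q1"
    "arr_comp (pr2 (sqz K V) V) \<rho> = q2"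
    "arr_comp (pr1 (asrc c) V) \<kappa> = arr_comp (pr1 (asrc c) V) q1"
    "arr_comp (pr2 (asrc c) V) \<kappa> = arr_comp (sigma K (sqz K V) V (\<lambda>v. enc (\<zero>\<^bsub>K\<^esub>, v))) \<rho>"
    "arr_comp (sigma K (asrc c) V j) \<tau> = arr_comp (sigma K (asrc c) V j) \<kappa>"
proof -
  interpret V: module K V by fact
  let ?A = "asrc c" and ?s = "sigma K (asrc c) V j"
    and ?t = "sigma K (sqz K V) V (\<lambda>v. enc (\<zero>\<^bsub>K\<^esub>, v))"
  note c' = small_extensionD[OF c] and j' = kernel_isoD[OF j]
  note A = arrD(1)[OF c'(1)] and jA = ker_closed(1)[OF c'(1) j'(1)]
  interpret A: cring ?A using arrD(3)[OF c'(1)] .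
  have P: "art_alg \<Lambda> K (Pr ?A V)" and P0: "art_alg \<Lambda> K (Pr (sqz K V) V)"
    using arrD(1)[OF \<sigma>] arrD(1)[OF \<sigma>0] by simp_all
  note pr = cartesianD[OF cartesian_pr[OF A V(2) P]]
  have q: "arr q1" "arr q2" "asrc q1 = Pr (Pr ?A V) V" "asrc q2 = Pr (Pr ?A V) V"
    "atgt q1 = Pr ?A V" "atgt q2 = sqz K V"
    using cartesianD[OF cartesian_pr[OF P V(2) Q]] by (simp_all add: q1_def q2_def)
  define \<tau> where "\<tau> = pair_arr (res_arr K ?A) (res_arr K (sqz K V)) (arr_comp ?s q1) q2"
  define \<rho> where "\<rho> = pair_arr (res_arr K (sqz K V)) (res_arr K (sqz K V)) (arr_comp (pr2 ?A V) q1) q2"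
  define \<kappa> where "\<kappa> = pair_arr (res_arr K ?A) (res_arr K (sqz K V)) (arr_comp (pr1 ?A V) q1) (arr_comp ?t \<rho>)"
  have \<tau>: "arr \<tau>" "arr_comp (pr1 ?A V) \<tau> = arr_comp ?s q1" "arr_comp (pr2 ?A V) \<tau> = q2"
    unfolding \<tau>_def
    by (rule pair_arr[OF P], use q \<sigma> pr in \<open>auto simp: arr_comp_res\<close>)+
  have \<rho>: "arr \<rho>" "arr_comp (pr1 (sqz K V) V) \<rho> = arr_comp (pr2 ?A V) q1"
    "arr_comp (pr2 (sqz K V) V) \<rho> = q2"
    unfolding \<rho>_def
    by (rule pair_arr[OF P0], use q \<sigma> pr in \<open>auto simp: arr_comp_res\<close>)+
  have \<rho>_sel: "asrc \<rho> = Pr (Pr ?A V) V" "atgt \<rho> = Pr (sqz K V) V"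
    using q by (simp_all add: \<rho>_def)
  have \<kappa>: "arr \<kappa>" "arr_comp (pr1 ?A V) \<kappa> = arr_comp (pr1 ?A V) q1"
    "arr_comp (pr2 ?A V) \<kappa> = arr_comp ?t \<rho>"
    unfolding \<kappa>_def
    by (rule pair_arr[OF P], use q \<sigma>0 pr \<rho>(1) \<rho>_sel in \<open>auto simp: arr_comp_res\<close>)+
  have sel: "asrc \<tau> = Pr (Pr ?A V) V" "atgt \<tau> = Pr ?A V" "asrc \<kappa> = Pr (Pr ?A V) V" "atgt \<kappa> = Pr ?A V"
    using q by (simp_all add: \<tau>_def \<kappa>_def)
  have "arr_comp ?s \<tau> = arr_comp ?s \<kappa>"
  proof (rule arr_eqI)
    fix z assume "z \<in> carrier (asrc (arr_comp ?s \<tau>))"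
    then have zQ: "z \<in> carrier (Pr (Pr ?A V) V)" using sel by simp
    then obtain y w where z: "z = enc (y, enc (res (Pr ?A V) y, w))" "y \<in> carrier (Pr ?A V)"
      "w \<in> carrier V" "res (Pr ?A V) y \<in> carrier K"
      by (rule in_PrE)
    from z(2) obtain x v where y: "y = enc (x, enc (res ?A x, v))" "x \<in> carrier ?A" "v \<in> carrier V"
      "res ?A x \<in> carrier K"
      by (rule in_PrE)
    let ?r = "res ?A x"
    have res_y: "res (Pr ?A V) y = ?r" using y by (simp add: fprod_ops)
    have jv: "j v \<in> carrier ?A" "j w \<in> carrier ?A" using jA y z by auto
    have q1z: "afun q1 z = enc (x, enc (?r, v))" and q2z: "afun q2 z = enc (?r, w)"
      using zQ z y res_y by (simp_all add: q1_def q2_def)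
    have \<sigma>y: "afun ?s (enc (x, enc (?r, v))) = x \<oplus>\<^bsub>?A\<^esub> j v"
      using y by (simp add: sigma_app)
    have r\<sigma>: "res ?A (x \<oplus>\<^bsub>?A\<^esub> j v) = ?r"
      using arrD(8)[OF \<sigma>, of y] z(2) y \<sigma>y by (simp add: fprod_ops)
    have "afun \<tau> z = enc (x \<oplus>\<^bsub>?A\<^esub> j v, enc (?r, w))"
      using zQ q q1z q2z \<sigma>y by (simp add: \<tau>_def)
    then have 1: "afun (arr_comp ?s \<tau>) z = (x \<oplus>\<^bsub>?A\<^esub> j v) \<oplus>\<^bsub>?A\<^esub> j w"
      using zQ sel y z jv r\<sigma> by (simp add: sigma_app)
    have "afun \<rho> z = enc (enc (?r, v), enc (?r, w))"
      using zQ q q1z q2z z(2) y by (simp add: \<rho>_def)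
    then have "afun (arr_comp ?t \<rho>) z = enc (?r, v \<oplus>\<^bsub>V\<^esub> w)"
      using zQ \<rho>_sel y z by (simp add: sigma_app)
    then have "afun \<kappa> z = enc (x, enc (?r, v \<oplus>\<^bsub>V\<^esub> w))"
      using zQ q q1z z(2) y \<rho>_sel by (simp add: \<kappa>_def)
    then have "afun (arr_comp ?s \<kappa>) z = x \<oplus>\<^bsub>?A\<^esub> j (v \<oplus>\<^bsub>V\<^esub> w)"
      using zQ sel y z by (simp add: sigma_app)
    then show "afun (arr_comp ?s \<tau>) z = afun (arr_comp ?s \<kappa>) z"
      using 1 j'(4)[OF y(3) z(3)] jv y(2) by (simp add: A.a_assoc)
  qed (use \<tau> \<kappa> \<sigma> sel in auto)
  then show ?thesis
    using that[OF \<tau>(1) \<rho>(1) \<kappa>(1) sel(1) \<rho>_sel(1) sel(3) sel(2) \<rho>_sel(2) sel(4) \<tau>(2,3) \<rho>(2,3) \<kappa>(2,3)]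
    by simp
qed

subsection \<open>Maps of small extensions\<close>

text \<open>
  The value at \<open>c x\<close> has to be \<open>d (h' x)\<close>, and this depends on \<open>c x\<close> only because \<open>h'\<close> respects
  the kernels.
\<close>

lemma induced_arrow:
  assumes c: "small_extension \<Lambda> K c" and d: "small_extension \<Lambda> K d"
    and h': "h' \<in> Homs (art \<Lambda> K) (asrc c) (asrc d)" and ker: "afun h' ` arr_ker c \<subseteq> arr_ker d"
  shows "\<exists>!h. h \<in> Homs (art \<Lambda> K) (atgt c) (atgt d) \<and> arr_comp h c = arr_comp d h'"
proof -
  note c' = small_extensionD[OF c] and d' = small_extensionD[OF d]
  have h: "arr h'" "asrc h' = asrc c" "atgt h' = asrc d"
    using h' by (auto simp: Homs_def art_def)
  interpret A: cring "asrc c" using arrD(3)[OF c'(1)] .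
  interpret B: cring "asrc d" using arrD(3)[OF d'(1)] .
  interpret Bt: cring "atgt d" using arrD(4)[OF d'(1)] .
  interpret At: cring "atgt c" using arrD(4)[OF c'(1)] .
  let ?e = "arr_comp d h'"
  have e: "arr ?e" "asrc ?e = asrc c" "atgt ?e = atgt d" using h d' by auto
  have onto: "\<exists>x\<in>carrier (asrc c). afun c x = y" if "y \<in> carrier (atgt c)" for y
    using c'(2) that unfolding arr_surj_def by (metis imageE)
  have const: "afun ?e x = afun ?e y"
    if x: "x \<in> carrier (asrc c)" and y: "y \<in> carrier (asrc c)" and eq: "afun c x = afun c y" for x y
  proof -
    have "x \<ominus>\<^bsub>asrc c\<^esub> y \<in> arr_ker c"
      using x y eq arr_minus[OF c'(1), of x y] arrD(9)[OF c'(1)] by (simp add: mem_arr_ker)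
    then have "afun h' (x \<ominus>\<^bsub>asrc c\<^esub> y) \<in> arr_ker d" using ker by auto
    then have "afun ?e (x \<ominus>\<^bsub>asrc c\<^esub> y) = \<zero>\<^bsub>atgt d\<^esub>"
      using x y h by (simp add: mem_arr_ker)
    then have "afun ?e x \<ominus>\<^bsub>atgt d\<^esub> afun ?e y = \<zero>\<^bsub>atgt d\<^esub>"
      using arr_minus[OF e(1), of x y] x y e by simp
    then show ?thesis
      using arrD(9)[OF e(1), of x] arrD(9)[OF e(1), of y] x y e by (simp add: h)
  qed
  define h where "h = \<lparr>asrc = atgt c,
    afun = (\<lambda>y\<in>carrier (atgt c). afun ?e (SOME x. x \<in> carrier (asrc c) \<and> afun c x = y)), atgt = atgt d\<rparr>"
  have sel: "asrc h = atgt c" "atgt h = atgt d" by (simp_all add: h_def)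
  have app: "afun h (afun c x) = afun ?e x" if x: "x \<in> carrier (asrc c)" for x
  proof -
    let ?y = "SOME y. y \<in> carrier (asrc c) \<and> afun c y = afun c x"
    have "?y \<in> carrier (asrc c) \<and> afun c ?y = afun c x"
      by (rule someI[of _ x]) (use x in simp)
    then show ?thesis
      using const[of ?y x] x arrD(9)[OF c'(1) x] by (simp only: h_def alg_arr.simps restrict_apply if_True)
  qed
  have "arr h"
  proof (rule arrI, unfold sel)
    show "afun h \<in> extensional (carrier (atgt c))" by (simp add: h_def)
    fix y assume "y \<in> carrier (atgt c)"
    then obtain x where x: "x \<in> carrier (asrc c)" "y = afun c x" using onto by metis
    show "afun h y \<in> carrier (atgt d)"
      using arrD(9)[OF e(1)] x e by (simp only: app)
    show "res (atgt d) (afun h y) = res (atgt c) y"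
      using arrD(8)[OF e(1)] arrD(8)[OF c'(1)] x e by (simp only: app)
    fix y' assume "y' \<in> carrier (atgt c)"
    then obtain x' where x': "x' \<in> carrier (asrc c)" "y' = afun c x'" using onto by metis
    show "afun h (y \<oplus>\<^bsub>atgt c\<^esub> y') = afun h y \<oplus>\<^bsub>atgt d\<^esub> afun h y'"
      using arrD(10)[OF e(1), of x x'] arrD(10)[OF c'(1) x(1) x'(1)] app[of "x \<oplus>\<^bsub>asrc c\<^esub> x'"] x x' e
      by (simp only: app A.a_closed)
    show "afun h (y \<otimes>\<^bsub>atgt c\<^esub> y') = afun h y \<otimes>\<^bsub>atgt d\<^esub> afun h y'"
      using arrD(11)[OF e(1), of x x'] arrD(11)[OF c'(1) x(1) x'(1)] app[of "x \<otimes>\<^bsub>asrc c\<^esub> x'"] x x' e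
      by (simp only: app A.m_closed)
  next
    show "afun h \<one>\<^bsub>atgt c\<^esub> = \<one>\<^bsub>atgt d\<^esub>"
      using app[of "\<one>\<^bsub>asrc c\<^esub>"] arrD(12)[OF e(1)] arrD(12)[OF c'(1)] e by (simp only: A.one_closed)
    show "afun h (str (atgt c) l) = str (atgt d) l" if l: "l \<in> carrier \<Lambda>" for l
      using app[of "str (asrc c) l"] arrD(7)[OF e(1) l] arrD(7)[OF c'(1) l] e
        ring_hom_closed[OF art_algD(3)[OF arrD(1)[OF c'(1)]] l] by (simp only:)
  qed (use arrD(2)[OF c'(1)] arrD(2)[OF d'(1)] in auto)
  moreover have "arr_comp h c = ?e"
    by (rule arr_eqI) (use \<open>arr h\<close> c' e sel app in \<open>auto simp del: arr_comp_sel(3) simp: arr_comp_sel(3)[of _ c]\<close>)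
  moreover have "g = h" if g: "arr g" "asrc g = atgt c" "atgt g = atgt d" "arr_comp g c = ?e" for g
  proof (rule arr_eqI)
    fix y assume "y \<in> carrier (asrc g)"
    then obtain x where x: "x \<in> carrier (asrc c)" "y = afun c x" using onto g by metis
    then show "afun g y = afun h y"
      using arg_cong[OF g(4), of "\<lambda>f. afun f x"] app[OF x(1)] by simp
  qed (use g \<open>arr h\<close> sel in auto)
  moreover have Homs_iff: "g \<in> Homs (art \<Lambda> K) A B \<longleftrightarrow> arr g \<and> asrc g = A \<and> atgt g = B" for g A B
    by (auto simp: Homs_def art_def)
  ultimately show ?thesis
    unfolding Homs_iff using sel by (intro ex1I[of _ h]) blast+
qed

lemma linear_map_ker_space:
  assumes c: "small_extension \<Lambda> K c" and d: "small_extension \<Lambda> K d"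
    and h: "arr h" "asrc h = asrc c" "atgt h = asrc d" and ker: "afun h ` arr_ker c \<subseteq> arr_ker d"
  shows "linear_map K (ker_space c) (ker_space d) (afun h)"
  unfolding linear_map_def
proof (intro conjI ballI)
  note c' = small_extensionD[OF c]
  show "afun h \<in> carrier (ker_space c) \<rightarrow> carrier (ker_space d)" using ker by auto
  show "afun h (x \<oplus>\<^bsub>ker_space c\<^esub> y) = afun h x \<oplus>\<^bsub>ker_space d\<^esub> afun h y"
    if "x \<in> carrier (ker_space c)" "y \<in> carrier (ker_space c)" for x y
    using that ker_closed(1)[OF c'(1)] arrD(10)[OF h(1)] h by simp
  fix a x assume "a \<in> carrier K" "x \<in> carrier (ker_space c)"
  then obtain b where b: "b \<in> carrier (asrc c)" "a = res (asrc c) b" and x: "x \<in> arr_ker c"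
    using lift_residue[OF arrD(1)[OF c'(1)]] by (metis ker_space_sel(1))
  have "res (asrc d) (afun h b) = a" "afun h b \<in> carrier (asrc d)" "afun h x \<in> arr_ker d"
    using arrD(8,9)[OF h(1), of b] b h ker x by auto
  then have "a \<odot>\<^bsub>ker_space d\<^esub> afun h x = afun h b \<otimes>\<^bsub>asrc d\<^esub> afun h x"
    using ker_smult[OF d, of "afun h x" "afun h b"] by simp
  then show "afun h (a \<odot>\<^bsub>ker_space c\<^esub> x) = a \<odot>\<^bsub>ker_space d\<^esub> afun h x"
    using ker_smult[OF c x b(1)] b x ker_closed(1)[OF c'(1) x] arrD(11)[OF h(1)] h by simp
qed

end

section \<open>Calculus in a deformation stack\<close>

lemma bij_betw_ex1: "bij_betw f A B \<Longrightarrow> b \<in> B \<Longrightarrow> \<exists>!a. a \<in> A \<and> f a = b"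
  by (auto simp: bij_betw_def inj_on_def)

locale deformation = coefficients \<Lambda> K
  for \<Lambda> :: "'l ring" and K :: "('l, 'r) alg" +
  fixes S :: "('l, 'r, 'o, 'm) stack"
  assumes stack: "deformation_stack \<Lambda> K S"
begin

sublocale fib: fibered_in_groupoids S "opcat (art \<Lambda> K)"
  using stack by (simp add: deformation_stack_def)

abbreviation composite (infixr "\<cdot>" 75) where "g \<cdot> f \<equiv> Comp S g f"

lemma base_simps [simp]:
  "Obj (opcat (art \<Lambda> K)) = {A. art_alg \<Lambda> K A}" "Arr (opcat (art \<Lambda> K)) = {c. arr c}"
  "Dom (opcat (art \<Lambda> K)) = atgt" "Cod (opcat (art \<Lambda> K)) = asrc"
  "Ident (opcat (art \<Lambda> K)) = arr_id" "Comp (opcat (art \<Lambda> K)) g f = arr_comp f g"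
  by (auto simp: opcat_def art_def)

lemma Homs_base [simp]: "f \<in> Homs (opcat (art \<Lambda> K)) A B \<longleftrightarrow> arr f \<and> atgt f = A \<and> asrc f = B"
  by (auto simp: Homs_def)

lemma Homs_art: "f \<in> Homs (art \<Lambda> K) A B \<longleftrightarrow> arr f \<and> asrc f = A \<and> atgt f = B"
  by (auto simp: Homs_def art_def)

subsection \<open>Composition and cancellation\<close>

lemma Over_iff:
  "f \<in> Over S c x y \<longleftrightarrow> f \<in> Arr S \<and> Dom S f = x \<and> Cod S f = y \<and> proj_arr S f = c"
  by (auto simp: Over_def Homs_def)

lemma Fib_iff: "x \<in> Fib S A \<longleftrightarrow> x \<in> Obj S \<and> proj_ob S x = A"
  by (simp add: Fib_def)

lemma Mor_iff: "f \<in> Mor S x y \<longleftrightarrow> f \<in> Over S (arr_id (proj_ob S x)) x y"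
  by (simp add: Mor_def)

lemma proj_simps [simp]:
  assumes "f \<in> Arr S"
  shows "arr (proj_arr S f)" "atgt (proj_arr S f) = proj_ob S (Dom S f)"
    "asrc (proj_arr S f) = proj_ob S (Cod S f)" "Dom S f \<in> Obj S" "Cod S f \<in> Obj S"
  using fib.proj_arr_closed[of f "Dom S f" "Cod S f"] fib.S.dom_closed fib.S.cod_closed assms
  by (auto simp: Homs_def)

lemma OverD:
  assumes "f \<in> Over S c x y"
  shows "f \<in> Arr S" "Dom S f = x" "Cod S f = y" "proj_arr S f = c" "arr c"
    "x \<in> Obj S" "y \<in> Obj S" "proj_ob S x = atgt c" "proj_ob S y = asrc c"
    "x \<in> Fib S (atgt c)" "y \<in> Fib S (asrc c)"
  using assms proj_simps[of f] by (auto simp: Over_iff Fib_iff)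

lemma art_alg_Fib: "x \<in> Fib S A \<Longrightarrow> art_alg \<Lambda> K A"
  using fib.proj_ob_closed[of x] by (auto simp: Fib_iff)

lemma art_alg_proj_ob [simp]: "x \<in> Obj S \<Longrightarrow> art_alg \<Lambda> K (proj_ob S x)"
  using fib.proj_ob_closed[of x] by simp

lemma comp_simps [simp]:
  assumes "f \<in> Arr S" "g \<in> Arr S" "Cod S f = Dom S g"
  shows "g \<cdot> f \<in> Arr S" "Dom S (g \<cdot> f) = Dom S f" "Cod S (g \<cdot> f) = Cod S g"
    "proj_arr S (g \<cdot> f) = arr_comp (proj_arr S f) (proj_arr S g)"
  using fib.S.comp_closed[of f "Dom S f" "Cod S f" g "Cod S g"] assms
    fib.proj_comp[of f "Dom S f" "Cod S f" g "Cod S g"]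
  by (auto simp: Homs_def)

lemma comp_assoc [simp]:
  "f \<in> Arr S \<Longrightarrow> g \<in> Arr S \<Longrightarrow> h \<in> Arr S \<Longrightarrow> Cod S f = Dom S g \<Longrightarrow> Cod S g = Dom S h \<Longrightarrow>
    (h \<cdot> g) \<cdot> f = h \<cdot> g \<cdot> f"
  using fib.S.comp_assoc[of f "Dom S f" "Dom S g" g "Dom S h" h "Cod S h"] by (simp add: Homs_def)

lemma Ident_simps [simp]:
  assumes "x \<in> Obj S"
  shows "Ident S x \<in> Arr S" "Dom S (Ident S x) = x" "Cod S (Ident S x) = x"
    "proj_arr S (Ident S x) = arr_id (proj_ob S x)"
  using fib.S.ident_closed[OF assms] fib.proj_ident[OF assms] by (auto simp: Homs_def)

lemma comp_Ident [simp]: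
  "f \<in> Arr S \<Longrightarrow> x = Dom S f \<Longrightarrow> f \<cdot> Ident S x = f"
  "f \<in> Arr S \<Longrightarrow> x = Cod S f \<Longrightarrow> Ident S x \<cdot> f = f"
  using fib.S.ident_left[of f "Dom S f" "Cod S f"] fib.S.ident_right[of f "Dom S f" "Cod S f"]
  by (auto simp: Homs_def)

lemma Over_comp:
  "f \<in> Over S c x y \<Longrightarrow> g \<in> Over S d y z \<Longrightarrow> g \<cdot> f \<in> Over S (arr_comp c d) x z"
  by (simp add: Over_iff)

lemma Over_Ident: "x \<in> Fib S A \<Longrightarrow> Ident S x \<in> Over S (arr_id A) x x"
  by (auto simp: Over_iff Fib_iff)

text \<open>
  Composition is normalized to the right, so an equation between composites of length two has to be
  applied in front of a further factor.
\<close>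

lemma comp_eq_comp:
  assumes "g \<cdot> f = g' \<cdot> f'" and "f \<in> Arr S" "g \<in> Arr S" "Cod S f = Dom S g"
    and "f' \<in> Arr S" "g' \<in> Arr S" "Cod S f' = Dom S g'" and "e \<in> Arr S" "Cod S e = Dom S f"
    "Dom S f = Dom S f'"
  shows "g \<cdot> f \<cdot> e = g' \<cdot> f' \<cdot> e"
proof -
  have "(g \<cdot> f) \<cdot> e = (g' \<cdot> f') \<cdot> e" using assms(1) by simp
  then show ?thesis using assms(2-) by simp
qed

text \<open>
  Every morphism is cartesian; existence and uniqueness are used separately, as \<open>lift\<close> and
  \<open>cancel\<close>.
\<close>

lemma lift_ex1:
  assumes k: "k \<in> Over S d y z" and h: "h \<in> Over S e x z" and c: "arr c" "asrc c = atgt d"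
    and e: "e = arr_comp c d"
  shows "\<exists>!m. m \<in> Over S c x y \<and> k \<cdot> m = h"
proof -
  have "\<exists>!m. m \<in> Homs S x y \<and> proj_arr S m = c \<and> k \<cdot> m = h"
    by (rule fib.lift_unique[of c "atgt c" "asrc c" d "asrc d"])
      (use OverD[OF k] OverD[OF h] c e in \<open>auto simp: Homs_def\<close>)
  then show ?thesis
    by (simp add: Over_iff Homs_def conj_ac)
qed

lemma lift:
  assumes "k \<in> Over S d y z" "h \<in> Over S e x z" "arr c" "asrc c = atgt d" "e = arr_comp c d"
  obtains m where "m \<in> Over S c x y" "k \<cdot> m = h"
  using lift_ex1[OF assms] by auto

lemma cancel:
  assumes "k \<in> Over S d y z" "m \<in> Over S c x y" "n \<in> Over S c x y" "k \<cdot> m = k \<cdot> n"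
  shows "m = n"
proof -
  have "\<exists>!m. m \<in> Over S c x y \<and> k \<cdot> m = k \<cdot> n"
    by (rule lift_ex1[OF assms(1) Over_comp[OF assms(3,1)]])
      (use OverD[OF assms(1)] OverD[OF assms(3)] in auto)
  then show ?thesis using assms by auto
qed

lemma factor_thru:
  assumes "k \<in> Over S d y z" "h \<in> Over S e x z" "arr c" "asrc c = atgt d" "e = arr_comp c d"
  shows "factor_thru S c k h \<in> Over S c x y" "k \<cdot> factor_thru S c k h = h"
proof -
  have "Dom S h = x" "Dom S k = y" using OverD[OF assms(1)] OverD[OF assms(2)] by auto
  then show "factor_thru S c k h \<in> Over S c x y" "k \<cdot> factor_thru S c k h = h"
    using theI'[OF lift_ex1[OF assms]] by (simp_all add: factor_thru_def)
qed

lemma iso_inverse: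
  assumes t: "t \<in> Over S \<theta> x y" and \<theta>': "arr \<theta>'" "asrc \<theta>' = atgt \<theta>" "atgt \<theta>' = asrc \<theta>"
    and inv: "arr_comp \<theta>' \<theta> = arr_id (asrc \<theta>)" "arr_comp \<theta> \<theta>' = arr_id (atgt \<theta>)"
  obtains t' where "t' \<in> Over S \<theta>' y x" "t \<cdot> t' = Ident S y" "t' \<cdot> t = Ident S x"
proof -
  note [simp] = OverD[OF t]
  obtain t' where t': "t' \<in> Over S \<theta>' y x" "t \<cdot> t' = Ident S y"
    using lift[OF t, of "Ident S y" "arr_id (asrc \<theta>)" y \<theta>'] \<theta>' inv Over_Ident OverD(11)[OF t] by metis
  note [simp] = OverD[OF t'(1)]
  have "t' \<cdot> t = Ident S x"
  proof (rule cancel[OF t])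
    show "t' \<cdot> t \<in> Over S (arr_id (atgt \<theta>)) x x"
      using Over_comp[OF t t'(1)] inv by simp
    show "Ident S x \<in> Over S (arr_id (atgt \<theta>)) x x"
      by (rule Over_Ident[OF OverD(10)[OF t]])
    show "t \<cdot> t' \<cdot> t = t \<cdot> Ident S x"
      using comp_assoc[of t t' t] t'(2) by simp
  qed
  then show ?thesis using that t' by auto
qed

lemma Mor_inverse:
  assumes "m \<in> Mor S x y"
  obtains n where "n \<in> Mor S y x" "m \<cdot> n = Ident S y" "n \<cdot> m = Ident S x"
proof -
  have m: "m \<in> Over S (arr_id (proj_ob S x)) x y" using assms by (simp add: Mor_iff)
  obtain n where "n \<in> Over S (arr_id (proj_ob S x)) y x" "m \<cdot> n = Ident S y" "n \<cdot> m = Ident S x"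
    by (rule iso_inverse[OF m OverD(5)[OF m]])
      (use OverD[OF m] art_alg_Fib[OF OverD(10)[OF m]] in auto)
  moreover have "proj_ob S y = proj_ob S x" using OverD[OF m] by auto
  ultimately show ?thesis using that by (simp add: Mor_iff)
qed

lemma MorD:
  assumes "m \<in> Mor S x y"
  shows "m \<in> Arr S" "Dom S m = x" "Cod S m = y" "proj_arr S m = arr_id (proj_ob S x)"
    "x \<in> Obj S" "y \<in> Obj S" "proj_ob S y = proj_ob S x"
  using OverD[of m "arr_id (proj_ob S x)" x y] assms by (auto simp: Mor_iff)

lemma Mor_Ident: "x \<in> Obj S \<Longrightarrow> Ident S x \<in> Mor S x x"
  by (simp add: Mor_iff Over_iff)

lemma Mor_comp:
  assumes m: "m \<in> Mor S x y" and n: "n \<in> Mor S y z" shows "n \<cdot> m \<in> Mor S x z"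
proof -
  note [simp] = MorD[OF m] MorD[OF n]
  show ?thesis by (simp add: Mor_iff Over_iff)
qed

lemma Mor_comp_Over:
  assumes m: "m \<in> Over S c x y" and n: "n \<in> Mor S y z" shows "n \<cdot> m \<in> Over S c x z"
proof -
  note [simp] = OverD[OF m] MorD[OF n]
  show ?thesis by (simp add: Over_iff)
qed

lemma Over_comp_Mor:
  assumes m: "m \<in> Over S c y z" and n: "n \<in> Mor S x y" shows "m \<cdot> n \<in> Over S c x z"
proof -
  note [simp] = OverD[OF m] MorD(1-6)[OF n]
  have "proj_ob S x = atgt c" using MorD(7)[OF n] by simp
  then show ?thesis by (simp add: Over_iff)
qed

text \<open>
  Two morphisms over the same arrow with the same target differ by a unique isomorphism of their
  sources; this removes the dependence on chosen pullbacks.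
\<close>

lemma Mor_factor:
  assumes u: "u \<in> Over S c y z" and v: "v \<in> Over S c x z"
  obtains t where "t \<in> Mor S x y" "u \<cdot> t = v"
  by (rule lift[OF u v, of "arr_id (atgt c)"])
    (use OverD[OF u] OverD[OF v] arrD(2)[of c] that in \<open>auto simp: Mor_iff\<close>)

lemma Mor_epi:
  assumes t: "t \<in> Mor S x y" and m: "m \<in> Arr S" "n \<in> Arr S" "Dom S m = y" "Dom S n = y"
    and eq: "m \<cdot> t = n \<cdot> t"
  shows "m = n"
proof -
  obtain t' where t': "t' \<in> Mor S y x" "t \<cdot> t' = Ident S y" using Mor_inverse[OF t] by metis
  note [simp] = MorD[OF t] MorD[OF t'(1)]
  have "m \<cdot> t \<cdot> t' = n \<cdot> t \<cdot> t'"
    by (rule comp_eq_comp[OF eq]) (use m in auto)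
  then show ?thesis using t'(2) m by simp
qed

subsection \<open>Chosen pullbacks and restriction\<close>

lemma pullback:
  assumes "arr f" "y \<in> Fib S (asrc f)"
  shows "pullback S f y \<in> Over S f (restr_ob S f y) y" "restr_ob S f y \<in> Fib S (atgt f)"
proof -
  have "pullback S f y \<in> Arr S \<and> Cod S (pullback S f y) = y \<and> proj_arr S (pullback S f y) = f"
    using fib.pullback_ex[of f y] assms by (simp add: Fib_iff)
  then show "pullback S f y \<in> Over S f (restr_ob S f y) y"
    by (simp add: Over_iff restr_ob_def)
  then show "restr_ob S f y \<in> Fib S (atgt f)"
    using OverD(10) by blast
qed

lemma restr_along:
  assumes u: "u \<in> Over S c x y" and v: "v \<in> Over S c x' y'" and m: "m \<in> Mor S y y'"
  shows "restr_along S u v m \<in> Mor S x x'" "v \<cdot> restr_along S u v m = m \<cdot> u"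
proof -
  have c: "arr c" "art_alg \<Lambda> K (atgt c)" using OverD(5)[OF u] arrD(2) by auto
  have ob: "proj_ob S x = atgt c" using OverD(8)[OF u] .
  have "restr_along S u v m = factor_thru S (arr_id (proj_ob S x)) v (m \<cdot> u)"
    using OverD(2)[OF u] by (simp add: restr_along_def)
  moreover have "factor_thru S (arr_id (proj_ob S x)) v (m \<cdot> u) \<in> Over S (arr_id (proj_ob S x)) x x'"
    "v \<cdot> factor_thru S (arr_id (proj_ob S x)) v (m \<cdot> u) = m \<cdot> u"
    by (rule factor_thru[OF v Mor_comp_Over[OF u m]], use c ob in simp_all)+
  ultimately show "restr_along S u v m \<in> Mor S x x'" "v \<cdot> restr_along S u v m = m \<cdot> u"
    by (simp_all only: Mor_iff)
qed

lemma restr_along_eqI: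
  assumes u: "u \<in> Over S c x y" and v: "v \<in> Over S c x' y'" and m: "m \<in> Mor S y y'"
    and n: "n \<in> Mor S x x'" "v \<cdot> n = m \<cdot> u"
  shows "restr_along S u v m = n"
  using cancel[OF v, of "restr_along S u v m" _ x n] restr_along[OF u v m] n by (simp add: Mor_iff)

lemma restr_mor:
  assumes c: "arr c" and x: "x \<in> Fib S (asrc c)" and m: "m \<in> Mor S x y"
  shows "restr_mor S c m \<in> Mor S (restr_ob S c x) (restr_ob S c y)"
    "pullback S c y \<cdot> restr_mor S c m = m \<cdot> pullback S c x"
    "n \<in> Mor S (restr_ob S c x) (restr_ob S c y) \<Longrightarrow>
      restr_mor S c m = n \<longleftrightarrow> pullback S c y \<cdot> n = m \<cdot> pullback S c x"
proof -
  have y: "y \<in> Fib S (asrc c)" using x MorD[OF m] by (simp add: Fib_iff)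
  note px = pullback[OF c x] and py = pullback[OF c y]
  have def: "restr_mor S c m = restr_along S (pullback S c x) (pullback S c y) m"
    using MorD[OF m] by (simp add: restr_mor_def)
  show 1: "restr_mor S c m \<in> Mor S (restr_ob S c x) (restr_ob S c y)"
    "pullback S c y \<cdot> restr_mor S c m = m \<cdot> pullback S c x"
    unfolding def using restr_along[OF px(1) py(1) m] by auto
  show "restr_mor S c m = n \<longleftrightarrow> pullback S c y \<cdot> n = m \<cdot> pullback S c x"
    if "n \<in> Mor S (restr_ob S c x) (restr_ob S c y)"
    using 1 restr_along_eqI[OF px(1) py(1) m that] def by auto
qed

text \<open>
  Whether an automorphism restricts to the identity can be tested on any morphism over the arrow,
  not only on the chosen pullback, since the two differ by an isomorphism.
\<close>

lemma restr_mor_iff: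
  assumes m: "m \<in> Mor S x x" and u: "u \<in> Over S c z x" and \<phi>: "\<phi> = Ident S (restr_ob S c x)"
  shows "restr_mor S c m = \<phi> \<longleftrightarrow> m \<cdot> u = u"
proof -
  note [simp] = OverD[OF u] MorD[OF m]
  have c: "arr c" and x: "x \<in> Fib S (asrc c)" by (simp_all add: Fib_iff)
  note p = pullback[OF c x]
  note [simp] = OverD[OF p(1)]
  obtain t where t: "t \<in> Mor S (restr_ob S c x) z" "u \<cdot> t = pullback S c x"
    using Mor_factor[OF u p(1)] .
  note [simp] = MorD[OF t(1)]
  have "restr_mor S c m = \<phi> \<longleftrightarrow> pullback S c x = m \<cdot> pullback S c x"
    unfolding \<phi> by (subst restr_mor(3)[OF c x m]) (auto simp: Mor_iff Over_iff)
  also have "\<dots> \<longleftrightarrow> u \<cdot> t = (m \<cdot> u) \<cdot> t"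
    using t(2) by simp
  also have "\<dots> \<longleftrightarrow> m \<cdot> u = u"
    using Mor_epi[OF t(1), of u "m \<cdot> u"] by (auto simp del: comp_assoc)
  finally show ?thesis .
qed

subsection \<open>Objects over the residue field\<close>

lemma point: "point S \<in> Fib S K"
  using stack by (simp add: deformation_stack_def)

lemma Fib_K_unique: "x \<in> Fib S K \<Longrightarrow> y \<in> Fib S K \<Longrightarrow> \<exists>!m. m \<in> Mor S x y"
  using stack by (simp add: deformation_stack_def)

text \<open>
  Objects over the residue field have no automorphisms but the identity, so all compatibility
  conditions over \<open>k\<close> hold by themselves.
\<close>

lemma Over_res_unique:
  assumes u: "u \<in> Over S c x y" "v \<in> Over S c x y" and c: "atgt c = K"
  shows "u = v"
proof -
  obtain t where t: "t \<in> Mor S x x" "u \<cdot> t = v" using Mor_factor[OF u] .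
  have "x \<in> Fib S K" using OverD(10)[OF u(1)] c by simp
  then have "t = Ident S x" using Fib_K_unique t(1) Mor_Ident[of x] by (metis Fib_iff)
  then show ?thesis using t(2) OverD[OF u(1)] by simp
qed

lemma Over_res_ex:
  assumes c: "arr c" "atgt c = K" and x: "x \<in> Fib S (asrc c)" and z: "z \<in> Fib S K"
  obtains u where "u \<in> Over S c z x"
proof -
  note p = pullback[OF c(1) x]
  obtain t where "t \<in> Mor S z (restr_ob S c x)" using Fib_K_unique[OF z, of "restr_ob S c x"] p c by auto
  then show ?thesis using that Over_comp_Mor[OF p(1)] by blast
qed

subsection \<open>Cartesian squares of algebras give pushout squares of objects\<close>

text \<open>
  The gluing axiom for morphisms, freed from chosen pullbacks.  The axiom speaks of morphisms between
  restrictions that agree over \<open>A\<close>; composing with the morphisms from restrictions turns such a pair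
  into the two legs \<open>g1\<close>, \<open>g2\<close> of a cocone, and agreement over \<open>A\<close> into \<open>g1 \<cdot> a1 = g2 \<cdot> a2\<close>.
\<close>

lemma glue_in_fprod:
  assumes c: "arr c" and d: "arr d" and eq: "atgt c = atgt d" and surj: "arr_surj d"
    and x: "x \<in> Fib S (fprod c d)" and y: "y \<in> Fib S (fprod c d)"
    and u1: "u1 \<in> Over S (fprod1 c d) x1 x" and u2: "u2 \<in> Over S (fprod2 c d) x2 x"
    and a1: "a1 \<in> Over S c x0 x1" and a2: "a2 \<in> Over S d x0 x2" and ua: "u1 \<cdot> a1 = u2 \<cdot> a2"
    and g1: "g1 \<in> Over S (fprod1 c d) x1 y" and g2: "g2 \<in> Over S (fprod2 c d) x2 y"
    and ga: "g1 \<cdot> a1 = g2 \<cdot> a2"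
  shows "\<exists>!m. m \<in> Mor S x y \<and> m \<cdot> u1 = g1 \<and> m \<cdot> u2 = g2"
proof -
  let ?p1 = "fprod1 c d" and ?p2 = "fprod2 c d"
  note [simp] = OverD[OF u1] OverD[OF u2] OverD[OF a1] OverD[OF a2] OverD[OF g1] OverD[OF g2]
  have p: "arr ?p1" "arr ?p2" by (rule OverD[OF u1] OverD[OF u2])+
  have sq: "arr_comp c ?p1 = arr_comp d ?p2"
    using cartesianD(9)[OF cartesian_fprod[OF c d eq art_alg_Fib[OF x]]] .
  have arrc: "arr (arr_comp c ?p1)" using p c by auto
  have xp: "x \<in> Fib S (asrc ?p1)" "x \<in> Fib S (asrc ?p2)" "x \<in> Fib S (asrc (arr_comp c ?p1))"
    and yp: "y \<in> Fib S (asrc ?p1)" "y \<in> Fib S (asrc ?p2)" "y \<in> Fib S (asrc (arr_comp c ?p1))"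
    using x y by simp_all
  define P1 P2 P0 Q1 Q2 Q0 where "P1 = pullback S ?p1 x" and "P2 = pullback S ?p2 x"
    and "P0 = pullback S (arr_comp c ?p1) x" and "Q1 = pullback S ?p1 y"
    and "Q2 = pullback S ?p2 y" and "Q0 = pullback S (arr_comp c ?p1) y"
  let ?X1 = "restr_ob S ?p1 x" and ?X2 = "restr_ob S ?p2 x" and ?X0 = "restr_ob S (arr_comp c ?p1) x"
    and ?Y1 = "restr_ob S ?p1 y" and ?Y2 = "restr_ob S ?p2 y" and ?Y0 = "restr_ob S (arr_comp c ?p1) y"
  have P: "P1 \<in> Over S ?p1 ?X1 x" "P2 \<in> Over S ?p2 ?X2 x" "P0 \<in> Over S (arr_comp c ?p1) ?X0 x"
    and Q: "Q1 \<in> Over S ?p1 ?Y1 y" "Q2 \<in> Over S ?p2 ?Y2 y" "Q0 \<in> Over S (arr_comp c ?p1) ?Y0 y"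
    unfolding P1_def P2_def P0_def Q1_def Q2_def Q0_def
    using pullback(1) p arrc xp yp by blast+
  note [simp] = OverD[OF P(1)] OverD[OF P(2)] OverD[OF P(3)] OverD[OF Q(1)] OverD[OF Q(2)] OverD[OF Q(3)]
  obtain t1 where t1: "t1 \<in> Mor S ?X1 x1" "u1 \<cdot> t1 = P1" using Mor_factor[OF u1 P(1)] .
  obtain t2 where t2: "t2 \<in> Mor S ?X2 x2" "u2 \<cdot> t2 = P2" using Mor_factor[OF u2 P(2)] .
  note [simp] = MorD[OF t1(1)] MorD[OF t2(1)]
  obtain m1 where m1: "m1 \<in> Mor S ?X1 ?Y1" "Q1 \<cdot> m1 = g1 \<cdot> t1"
    using Mor_factor[OF Q(1) Over_comp_Mor[OF g1 t1(1)]] .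
  obtain m2 where m2: "m2 \<in> Mor S ?X2 ?Y2" "Q2 \<cdot> m2 = g2 \<cdot> t2"
    using Mor_factor[OF Q(2) Over_comp_Mor[OF g2 t2(1)]] .
  note [simp] = MorD[OF m1(1)] MorD[OF m2(1)]
  have restr1: "restr_mor S ?p1 m = m1 \<longleftrightarrow> m \<cdot> u1 = g1" if m: "m \<in> Mor S x y" for m
  proof -
    note [simp] = MorD[OF m]
    have "restr_mor S ?p1 m = m1 \<longleftrightarrow> Q1 \<cdot> m1 = m \<cdot> P1"
      unfolding P1_def Q1_def by (rule restr_mor(3)[OF p(1) xp(1) m m1(1)])
    also have "\<dots> \<longleftrightarrow> g1 \<cdot> t1 = (m \<cdot> u1) \<cdot> t1" using t1(2) m1(2) by simp
    also have "\<dots> \<longleftrightarrow> m \<cdot> u1 = g1" using Mor_epi[OF t1(1), of g1 "m \<cdot> u1"] by auto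
    finally show ?thesis .
  qed
  have restr2: "restr_mor S ?p2 m = m2 \<longleftrightarrow> m \<cdot> u2 = g2" if m: "m \<in> Mor S x y" for m
  proof -
    note [simp] = MorD[OF m]
    have "restr_mor S ?p2 m = m2 \<longleftrightarrow> Q2 \<cdot> m2 = m \<cdot> P2"
      unfolding P2_def Q2_def by (rule restr_mor(3)[OF p(2) xp(2) m m2(1)])
    also have "\<dots> \<longleftrightarrow> g2 \<cdot> t2 = (m \<cdot> u2) \<cdot> t2" using t2(2) m2(2) by simp
    also have "\<dots> \<longleftrightarrow> m \<cdot> u2 = g2" using Mor_epi[OF t2(1), of g2 "m \<cdot> u2"] by auto
    finally show ?thesis .
  qed
  define F1 F2 G1 G2 where "F1 = factor_thru S c P1 P0" and "F2 = factor_thru S d P2 P0"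
    and "G1 = factor_thru S c Q1 Q0" and "G2 = factor_thru S d Q2 Q0"
  have F1: "F1 \<in> Over S c ?X0 ?X1" "P1 \<cdot> F1 = P0"
    unfolding F1_def using factor_thru[OF P(1,3) c] by simp_all
  have F2: "F2 \<in> Over S d ?X0 ?X2" "P2 \<cdot> F2 = P0"
    unfolding F2_def using factor_thru[OF P(2,3) d] sq by simp_all
  have G1: "G1 \<in> Over S c ?Y0 ?Y1" "Q1 \<cdot> G1 = Q0"
    unfolding G1_def using factor_thru[OF Q(1,3) c] by simp_all
  have G2: "G2 \<in> Over S d ?Y0 ?Y2" "Q2 \<cdot> G2 = Q0"
    unfolding G2_def using factor_thru[OF Q(2,3) d] sq by simp_all
  note [simp] = OverD[OF F1(1)] OverD[OF F2(1)] OverD[OF G1(1)] OverD[OF G2(1)]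
  define r1 r2 where "r1 = restr_along S F1 G1 m1" and "r2 = restr_along S F2 G2 m2"
  have r1: "r1 \<in> Mor S ?X0 ?Y0" "G1 \<cdot> r1 = m1 \<cdot> F1"
    unfolding r1_def using restr_along[OF F1(1) G1(1) m1(1)] by auto
  have r2: "r2 \<in> Mor S ?X0 ?Y0" "G2 \<cdot> r2 = m2 \<cdot> F2"
    unfolding r2_def using restr_along[OF F2(1) G2(1) m2(1)] by auto
  note [simp] = MorD[OF r1(1)] MorD[OF r2(1)]
  have "r1 = r2"
  proof -
    have "u1 \<cdot> a1 \<in> Over S (arr_comp c ?p1) x0 x" by (simp add: Over_iff)
    then obtain s where s: "s \<in> Mor S ?X0 x0" "(u1 \<cdot> a1) \<cdot> s = P0"
      using Mor_factor P(3) by blast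
    note [simp] = MorD[OF s(1)]
    have s1: "a1 \<cdot> s = t1 \<cdot> F1"
    proof (rule cancel[OF u1])
      show "a1 \<cdot> s \<in> Over S c ?X0 x1" "t1 \<cdot> F1 \<in> Over S c ?X0 x1"
        using Over_comp_Mor[OF a1 s(1)] Mor_comp_Over[OF F1(1) t1(1)] by auto
      show "u1 \<cdot> a1 \<cdot> s = u1 \<cdot> t1 \<cdot> F1"
        using s(2) F1(2) comp_assoc[of F1 t1 u1] t1(2) by simp
    qed
    have s2: "a2 \<cdot> s = t2 \<cdot> F2"
    proof (rule cancel[OF u2])
      show "a2 \<cdot> s \<in> Over S d ?X0 x2" "t2 \<cdot> F2 \<in> Over S d ?X0 x2"
        using Over_comp_Mor[OF a2 s(1)] Mor_comp_Over[OF F2(1) t2(1)] by auto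
      show "u2 \<cdot> a2 \<cdot> s = u2 \<cdot> t2 \<cdot> F2"
        using s(2) F2(2) comp_assoc[of F2 t2 u2] t2(2) ua by simp
    qed
    have "Q0 \<cdot> r1 = Q1 \<cdot> m1 \<cdot> F1" using G1(2)[symmetric] r1(2) by simp
    also have "\<dots> = g1 \<cdot> t1 \<cdot> F1" using comp_eq_comp[OF m1(2), of F1] by simp
    also have "\<dots> = g1 \<cdot> a1 \<cdot> s" using s1 by simp
    also have "\<dots> = g2 \<cdot> a2 \<cdot> s" using comp_eq_comp[OF ga, of s] by simp
    also have "\<dots> = g2 \<cdot> t2 \<cdot> F2" using s2 by simp
    also have "\<dots> = Q2 \<cdot> m2 \<cdot> F2" using comp_eq_comp[OF m2(2), of F2] by simp
    also have "\<dots> = Q0 \<cdot> r2" using G2(2)[symmetric] r2(2) by simp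
    finally show ?thesis
      using cancel[OF Q(3)] r1(1) r2(1) by (simp add: Mor_iff)
  qed
  moreover have "restr_further S ?p1 c x y m1 = r1" "restr_further S ?p2 d x y m2 = r2"
    using sq by (simp_all add: restr_further_def r1_def r2_def F1_def F2_def G1_def G2_def
        P1_def P2_def P0_def Q1_def Q2_def Q0_def)
  ultimately have mem: "(m1, m2) \<in> {(m', m''). m' \<in> Mor S ?X1 ?Y1 \<and> m'' \<in> Mor S ?X2 ?Y2 \<and>
      restr_further S ?p1 c x y m' = restr_further S ?p2 d x y m''}"
    using m1(1) m2(1) by simp
  have "glues_morphisms S c d"
    using stack c d eq surj by (simp add: deformation_stack_def)
  then have "bij_betw (\<lambda>m. (restr_mor S ?p1 m, restr_mor S ?p2 m)) (Mor S x y)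
      {(m', m''). m' \<in> Mor S ?X1 ?Y1 \<and> m'' \<in> Mor S ?X2 ?Y2 \<and>
        restr_further S ?p1 c x y m' = restr_further S ?p2 d x y m''}"
    using x y by (simp add: glues_morphisms_def)
  then have "\<exists>!m. m \<in> Mor S x y \<and> (restr_mor S ?p1 m, restr_mor S ?p2 m) = (m1, m2)"
    using mem by (rule bij_betw_ex1)
  then show ?thesis
    using restr1 restr2 by (metis (no_types, lifting) Pair_inject)
qed

lemma glue_object_in_fprod:
  assumes c: "arr c" and d: "arr d" and eq: "atgt c = atgt d" and surj: "arr_surj d"
    and a1: "a1 \<in> Over S c x0 x1" and a2: "a2 \<in> Over S d x0 x2"
  obtains w u1 u2 where "w \<in> Fib S (fprod c d)" "u1 \<in> Over S (fprod1 c d) x1 w"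
    "u2 \<in> Over S (fprod2 c d) x2 w" "u1 \<cdot> a1 = u2 \<cdot> a2"
proof -
  note [simp] = OverD[OF a1] OverD[OF a2]
  have x1: "x1 \<in> Fib S (asrc c)" and x2: "x2 \<in> Fib S (asrc d)" by (simp_all add: Fib_iff)
  note q1 = pullback[OF c x1] and q2 = pullback[OF d x2]
  note [simp] = OverD[OF q1(1)] OverD[OF q2(1)]
  obtain t1 where t1: "t1 \<in> Mor S (restr_ob S c x1) x0" "a1 \<cdot> t1 = pullback S c x1"
    using Mor_factor[OF a1 q1(1)] .
  obtain t2 where t2: "t2 \<in> Mor S x0 (restr_ob S d x2)" "pullback S d x2 \<cdot> t2 = a2"
    using Mor_factor[OF q2(1) a2] .
  note [simp] = MorD[OF t1(1)] MorD[OF t2(1)]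
  have "t2 \<cdot> t1 \<in> Mor S (restr_ob S c x1) (restr_ob S d x2)" using Mor_comp[OF t1(1) t2(1)] .
  moreover have "glues_objects S c d"
    using stack c d eq surj by (simp add: deformation_stack_def)
  ultimately obtain w u1 u2 where w: "w \<in> Fib S (fprod c d)" "u1 \<in> Over S (fprod1 c d) x1 w"
    "u2 \<in> Over S (fprod2 c d) x2 w"
    and eq: "u1 \<cdot> pullback S c x1 = (u2 \<cdot> pullback S d x2) \<cdot> t2 \<cdot> t1"
    unfolding glues_objects_def using x1 x2 by blast
  note [simp] = OverD[OF w(2)] OverD[OF w(3)]
  have "(u1 \<cdot> a1) \<cdot> t1 = (u2 \<cdot> a2) \<cdot> t1"
    using eq t1(2) t2(2)[symmetric] by simp
  then have "u1 \<cdot> a1 = u2 \<cdot> a2"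
    by (rule Mor_epi[OF t1(1), rotated -1]) simp_all
  then show ?thesis using that w by blast
qed

lemma cartesian_glue:
  assumes cart: "cartesian c d p q" and surj: "arr_surj d"
    and a1: "a1 \<in> Over S c x0 x1" and a2: "a2 \<in> Over S d x0 x2"
  obtains w u1 u2 where "u1 \<in> Over S p x1 w" "u2 \<in> Over S q x2 w" "u1 \<cdot> a1 = u2 \<cdot> a2"
proof -
  note cd = cartesianD[OF cart]
  obtain w v1 v2 where w: "w \<in> Fib S (fprod c d)" and v1: "v1 \<in> Over S (fprod1 c d) x1 w"
    and v2: "v2 \<in> Over S (fprod2 c d) x2 w" and va: "v1 \<cdot> a1 = v2 \<cdot> a2"
    using glue_object_in_fprod[OF cd(1-3) surj a1 a2] .
  obtain \<theta> \<theta>' where \<theta>: "arr \<theta>" "asrc \<theta> = asrc p" "atgt \<theta> = fprod c d"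
    "arr \<theta>'" "asrc \<theta>' = fprod c d" "atgt \<theta>' = asrc p"
    "arr_comp \<theta>' \<theta> = arr_id (asrc p)" "arr_comp \<theta> \<theta>' = arr_id (fprod c d)"
    "arr_comp (fprod1 c d) \<theta> = p" "arr_comp (fprod2 c d) \<theta> = q"
    using cartesian_iso[OF cart art_alg_Fib[OF w]] .
  note f = OverD(5)[OF v1] OverD(5)[OF v2]
  have p': "arr_comp p \<theta>' = fprod1 c d" and q': "arr_comp q \<theta>' = fprod2 c d"
    using arr_comp_assoc[of \<theta>' \<theta> "fprod1 c d"] arr_comp_assoc[of \<theta>' \<theta> "fprod2 c d"] \<theta> f by simp_all
  have t: "pullback S \<theta>' w \<in> Over S \<theta>' (restr_ob S \<theta>' w) w"
    using pullback(1)[OF \<theta>(4)] w \<theta>(5) by simp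
  obtain u1 where u1: "u1 \<in> Over S p x1 (restr_ob S \<theta>' w)" "pullback S \<theta>' w \<cdot> u1 = v1"
    using lift[OF t v1 cd(4)] \<theta> p' by metis
  obtain u2 where u2: "u2 \<in> Over S q x2 (restr_ob S \<theta>' w)" "pullback S \<theta>' w \<cdot> u2 = v2"
    using lift[OF t v2 cd(5)] \<theta> cd q' by metis
  note [simp] = OverD[OF u1(1)] OverD[OF u2(1)] OverD[OF t] OverD[OF a1] OverD[OF a2]
  have "u1 \<cdot> a1 = u2 \<cdot> a2"
  proof (rule cancel[OF t])
    show "u1 \<cdot> a1 \<in> Over S (arr_comp c p) x0 (restr_ob S \<theta>' w)"
      "u2 \<cdot> a2 \<in> Over S (arr_comp c p) x0 (restr_ob S \<theta>' w)"
      using Over_comp[OF a1 u1(1)] Over_comp[OF a2 u2(1)] cd(9) by simp_all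
    show "pullback S \<theta>' w \<cdot> u1 \<cdot> a1 = pullback S \<theta>' w \<cdot> u2 \<cdot> a2"
      using va u1(2)[symmetric] u2(2)[symmetric] by simp
  qed
  then show ?thesis using that u1(1) u2(1) by blast
qed

text \<open>
  The universal property of a glued object \<open>w\<close>, for morphisms to objects over any algebra.  It is
  reduced to \<open>glue_in_fprod\<close> by moving \<open>w\<close> along the isomorphism with the standard fiber product and
  by replacing \<open>y\<close> with its pullback there.
\<close>

lemma cartesian_pushout:
  assumes cart: "cartesian c d p q" and surj: "arr_surj d"
    and a1: "a1 \<in> Over S c x0 x1" and a2: "a2 \<in> Over S d x0 x2"
    and u1: "u1 \<in> Over S p x1 w" and u2: "u2 \<in> Over S q x2 w" and ua: "u1 \<cdot> a1 = u2 \<cdot> a2"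
    and f: "arr f" "atgt f = asrc p"
    and g1: "g1 \<in> Over S (arr_comp p f) x1 y" and g2: "g2 \<in> Over S (arr_comp q f) x2 y"
    and ga: "g1 \<cdot> a1 = g2 \<cdot> a2"
  shows "\<exists>!m. m \<in> Over S f w y \<and> m \<cdot> u1 = g1 \<and> m \<cdot> u2 = g2"
proof -
  note cd = cartesianD[OF cart]
  have "\<exists>w. w \<in> Fib S (fprod c d)"
    using glue_object_in_fprod[OF cd(1-3) surj a1 a2] by metis
  then have fp: "art_alg \<Lambda> K (fprod c d)" using art_alg_Fib by blast
  obtain \<theta> \<theta>' where \<theta>: "arr \<theta>" "asrc \<theta> = asrc p" "atgt \<theta> = fprod c d"
    "arr \<theta>'" "asrc \<theta>' = fprod c d" "atgt \<theta>' = asrc p"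
    "arr_comp \<theta>' \<theta> = arr_id (asrc p)" "arr_comp \<theta> \<theta>' = arr_id (fprod c d)"
    "arr_comp (fprod1 c d) \<theta> = p" "arr_comp (fprod2 c d) \<theta> = q"
    using cartesian_iso[OF cart fp] .
  note fpr = cartesianD[OF cartesian_fprod[OF cd(1-3) fp]]
  note [simp] = OverD[OF u1] OverD[OF u2] OverD[OF a1] OverD[OF a2] OverD[OF g1] OverD[OF g2]
  have w: "w \<in> Fib S (asrc \<theta>)" using \<theta>(2) by (simp add: Fib_iff)
  have yf: "y \<in> Fib S (asrc (arr_comp \<theta> f))" by (simp add: Fib_iff)
  have \<theta>f: "arr (arr_comp \<theta> f)" using \<theta> f by simp
  define t where "t = pullback S \<theta> w"
  let ?w = "restr_ob S \<theta> w"
  have t: "t \<in> Over S \<theta> ?w w" unfolding t_def using pullback(1)[OF \<theta>(1) w] .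
  define r where "r = pullback S (arr_comp \<theta> f) y"
  let ?y = "restr_ob S (arr_comp \<theta> f) y"
  have r: "r \<in> Over S (arr_comp \<theta> f) ?y y" unfolding r_def using pullback(1)[OF \<theta>f yf] .
  obtain t' where t': "t' \<in> Over S \<theta>' w ?w" "t \<cdot> t' = Ident S w" "t' \<cdot> t = Ident S ?w"
    using iso_inverse[OF t \<theta>(4)] \<theta> by auto
  note [simp] = OverD[OF t] OverD[OF r] OverD[OF t'(1)]
  have pf: "arr_comp p f = arr_comp (fprod1 c d) (arr_comp \<theta> f)"
    "arr_comp q f = arr_comp (fprod2 c d) (arr_comp \<theta> f)"
    using \<theta> f by (simp_all add: arr_comp_assoc)
  obtain v1 where v1: "v1 \<in> Over S (fprod1 c d) x1 ?w" "t \<cdot> v1 = u1"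
    using lift[OF t u1 fpr(4)] \<theta> by (metis fprod_sel(1))
  obtain v2 where v2: "v2 \<in> Over S (fprod2 c d) x2 ?w" "t \<cdot> v2 = u2"
    using lift[OF t u2 fpr(5)] \<theta> by (metis fprod_sel(3))
  obtain h1 where h1: "h1 \<in> Over S (fprod1 c d) x1 ?y" "r \<cdot> h1 = g1"
    using lift[OF r g1 fpr(4)] \<theta> pf by (metis fprod_sel(1) arr_comp_sel(2))
  obtain h2 where h2: "h2 \<in> Over S (fprod2 c d) x2 ?y" "r \<cdot> h2 = g2"
    using lift[OF r g2 fpr(5)] \<theta> pf by (metis fprod_sel(3) arr_comp_sel(2))
  note [simp] = OverD[OF v1(1)] OverD[OF v2(1)] OverD[OF h1(1)] OverD[OF h2(1)]
  have va: "v1 \<cdot> a1 = v2 \<cdot> a2"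
  proof (rule cancel[OF t])
    show "v1 \<cdot> a1 \<in> Over S (arr_comp c (fprod1 c d)) x0 ?w"
      "v2 \<cdot> a2 \<in> Over S (arr_comp c (fprod1 c d)) x0 ?w"
      using Over_comp[OF a1 v1(1)] Over_comp[OF a2 v2(1)] fpr(9) by simp_all
    show "t \<cdot> v1 \<cdot> a1 = t \<cdot> v2 \<cdot> a2"
      using ua v1(2)[symmetric] v2(2)[symmetric] by simp
  qed
  have ha: "h1 \<cdot> a1 = h2 \<cdot> a2"
  proof (rule cancel[OF r])
    show "h1 \<cdot> a1 \<in> Over S (arr_comp c (fprod1 c d)) x0 ?y"
      "h2 \<cdot> a2 \<in> Over S (arr_comp c (fprod1 c d)) x0 ?y"
      using Over_comp[OF a1 h1(1)] Over_comp[OF a2 h2(1)] fpr(9) by simp_all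
    show "r \<cdot> h1 \<cdot> a1 = r \<cdot> h2 \<cdot> a2"
      using ga h1(2)[symmetric] h2(2)[symmetric] by simp
  qed
  have wF: "?w \<in> Fib S (fprod c d)" and yF: "?y \<in> Fib S (fprod c d)" using \<theta> by (simp_all add: Fib_iff)
  note glue = glue_in_fprod[OF cd(1-3) surj wF yF v1(1) v2(1) a1 a2 va h1(1) h2(1) ha]
  then obtain m0 where m0: "m0 \<in> Mor S ?w ?y" "m0 \<cdot> v1 = h1" "m0 \<cdot> v2 = h2" by auto
  note [simp] = MorD[OF m0(1)]
  show ?thesis
  proof (rule ex1I)
    have "proj_arr S (r \<cdot> m0 \<cdot> t') = f"
    proof -
      have "arr_comp \<theta>' (arr_comp \<theta> f) = f"
        using \<theta> f by (simp add: arr_comp_assoc)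
      moreover have "arr_comp \<theta>' (arr_id (fprod c d)) = \<theta>'" using \<theta> by simp
      ultimately show ?thesis using \<theta> by simp
    qed
    then have "r \<cdot> m0 \<cdot> t' \<in> Over S f w y" by (simp add: Over_iff)
    moreover have "(r \<cdot> m0 \<cdot> t') \<cdot> u1 = g1"
    proof -
      have "(r \<cdot> m0 \<cdot> t') \<cdot> u1 = r \<cdot> m0 \<cdot> (t' \<cdot> t) \<cdot> v1" using v1(2)[symmetric] by simp
      also have "\<dots> = g1" unfolding t'(3) using m0(2) h1(2) by simp
      finally show ?thesis .
    qed
    moreover have "(r \<cdot> m0 \<cdot> t') \<cdot> u2 = g2"
    proof -
      have "(r \<cdot> m0 \<cdot> t') \<cdot> u2 = r \<cdot> m0 \<cdot> (t' \<cdot> t) \<cdot> v2" using v2(2)[symmetric] by simp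
      also have "\<dots> = g2" unfolding t'(3) using m0(3) h2(2) by simp
      finally show ?thesis .
    qed
    ultimately show "r \<cdot> m0 \<cdot> t' \<in> Over S f w y \<and> (r \<cdot> m0 \<cdot> t') \<cdot> u1 = g1 \<and> (r \<cdot> m0 \<cdot> t') \<cdot> u2 = g2"
      by blast
  next
    fix m assume "m \<in> Over S f w y \<and> m \<cdot> u1 = g1 \<and> m \<cdot> u2 = g2"
    then have m: "m \<in> Over S f w y" "m \<cdot> u1 = g1" "m \<cdot> u2 = g2" by auto
    note [simp] = OverD[OF m(1)]
    obtain n where n: "n \<in> Mor S ?w ?y" "r \<cdot> n = m \<cdot> t"
      using Mor_factor[OF r Over_comp[OF t m(1)]] .
    note [simp] = MorD[OF n(1)]
    have "n \<cdot> v1 = h1"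
    proof (rule cancel[OF r])
      show "n \<cdot> v1 \<in> Over S (fprod1 c d) x1 ?y" using Mor_comp_Over[OF v1(1) n(1)] .
      have "r \<cdot> n \<cdot> v1 = m \<cdot> t \<cdot> v1" using comp_eq_comp[OF n(2), of v1] by simp
      then show "r \<cdot> n \<cdot> v1 = r \<cdot> h1" using v1(2) m(2) h1(2) by simp
    qed (rule h1)
    moreover have "n \<cdot> v2 = h2"
    proof (rule cancel[OF r])
      show "n \<cdot> v2 \<in> Over S (fprod2 c d) x2 ?y" using Mor_comp_Over[OF v2(1) n(1)] .
      have "r \<cdot> n \<cdot> v2 = m \<cdot> t \<cdot> v2" using comp_eq_comp[OF n(2), of v2] by simp
      then show "r \<cdot> n \<cdot> v2 = r \<cdot> h2" using v2(2) m(3) h2(2) by simp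
    qed (rule h2)
    ultimately have "n = m0" using glue n(1) m0 by blast
    then have "(m \<cdot> t) \<cdot> t' = (r \<cdot> m0) \<cdot> t'" using n(2) by simp
    then show "m = r \<cdot> m0 \<cdot> t'" using t'(2) by simp
  qed
qed

section \<open>Addition laws\<close>

subsection \<open>Gluing over the residue field\<close>

lemma star_ex:
  assumes x: "x \<in> Fib S A" and y: "y \<in> Fib S (sqz K V)"
  obtains w u1 u2 where "u1 \<in> Over S (pr1 A V) x w" "u2 \<in> Over S (pr2 A V) y w"
proof -
  note A = art_alg_Fib[OF x] and B = art_alg_Fib[OF y]
  obtain a1 where a1: "a1 \<in> Over S (res_arr K A) (point S) x"
    using Over_res_ex[of "res_arr K A" x "point S"] A x point by auto
  obtain a2 where a2: "a2 \<in> Over S (res_arr K (sqz K V)) (point S) y"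
    using Over_res_ex[of "res_arr K (sqz K V)" y "point S"] B y point by auto
  show ?thesis
    using glue_object_in_fprod[OF _ _ _ res_arr_surj[OF B] a1 a2] A B that by auto
qed

text \<open>
  A morphism out of \<open>x * y\<close> is the same as a pair of morphisms out of \<open>x\<close> and \<open>y\<close>: the compatibility
  required by \<open>cartesian_pushout\<close> takes place over \<open>k\<close>.
\<close>

lemma star_pushout:
  assumes u1: "u1 \<in> Over S (pr1 A V) x w" and u2: "u2 \<in> Over S (pr2 A V) y w"
    and f: "arr f" "atgt f = Pr A V"
    and g1: "g1 \<in> Over S (arr_comp (pr1 A V) f) x t" and g2: "g2 \<in> Over S (arr_comp (pr2 A V) f) y t"
  shows "\<exists>!m. m \<in> Over S f w t \<and> m \<cdot> u1 = g1 \<and> m \<cdot> u2 = g2"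
proof -
  have x: "x \<in> Fib S A" and y: "y \<in> Fib S (sqz K V)" and w: "w \<in> Fib S (Pr A V)"
    using OverD(10)[OF u1] OverD(10)[OF u2] OverD(11)[OF u1] by simp_all
  note A = art_alg_Fib[OF x] and B = art_alg_Fib[OF y] and P = art_alg_Fib[OF w]
  note cart = cartesian_pr[OF A B P] note pr = cartesianD[OF cart]
  obtain a1 where a1: "a1 \<in> Over S (res_arr K A) (point S) x"
    using Over_res_ex[of "res_arr K A" x "point S"] A x point by auto
  obtain a2 where a2: "a2 \<in> Over S (res_arr K (sqz K V)) (point S) y"
    using Over_res_ex[of "res_arr K (sqz K V)" y "point S"] B y point by auto
  have "u1 \<cdot> a1 = u2 \<cdot> a2"
    by (rule Over_res_unique[OF Over_comp[OF a1 u1]]) (use Over_comp[OF a2 u2] pr(9) in simp_all)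
  moreover have "g1 \<cdot> a1 = g2 \<cdot> a2"
    by (rule Over_res_unique[OF Over_comp[OF a1 g1]])
      (use Over_comp[OF a2 g2] pr f in \<open>simp_all add: arr_comp_assoc\<close>)
  ultimately show ?thesis
    using cartesian_pushout[OF cart res_arr_surj[OF B] a1 a2 u1 u2 _ f(1) _ g1 g2] f(2) by simp
qed

lemma zeta_Fib: "module K V \<Longrightarrow> art_alg \<Lambda> K (sqz K V) \<Longrightarrow> zeta K S V \<in> Fib S (sqz K V)"
  using pullback(2)[of "sqz_unit K V" "point S"] point by (simp add: zeta_def)

subsection \<open>The law of a small extension\<close>

text \<open>
  Addition laws are kept with their small extension and the identification \<open>j\<close> of \<open>V\<close> with its
  kernel, so that the law on \<open>k[V]\<close> and the law on \<open>A'\<close> are instances of the same notion.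
\<close>

definition small_law :: "('l, 'r) alg_arr \<Rightarrow> ('r, 'r) module \<Rightarrow> ('r \<Rightarrow> 'r) \<Rightarrow> ('o, 'm) law \<Rightarrow> bool" where
  "small_law c V j L \<longleftrightarrow> small_extension \<Lambda> K c \<and> module K V \<and> art_alg \<Lambda> K (sqz K V) \<and>
    kernel_iso c V j \<and> addition_law K S (asrc c) V j L"

lemma law_ext: "small_extension \<Lambda> K c \<Longrightarrow> ext_law K S c L \<Longrightarrow> small_law c (ker_space c) (\<lambda>v. v) L"
  by (simp add: small_law_def ext_law_def module_ker_space art_alg_sqz_ker kernel_iso_ker_space)

lemma law_sqz:
  "module K V \<Longrightarrow> art_alg \<Lambda> K (sqz K V) \<Longrightarrow> sqz_law K S V L \<Longrightarrow>
    small_law (res_arr K (sqz K V)) V (\<lambda>v. enc (\<zero>\<^bsub>K\<^esub>, v)) L"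
  by (simp add: small_law_def sqz_law_def small_extension_sqz)

lemma lawD:
  assumes "small_law c V j L"
  shows "small_extension \<Lambda> K c" "module K V" "art_alg \<Lambda> K (sqz K V)" "kernel_iso c V j" "arr c"
    "arr_surj c" "zeta K S V \<in> Fib S (sqz K V)"
    "\<And>x. x \<in> Fib S (asrc c) \<Longrightarrow> sum_ob L x (zeta K S V) = x"
    "\<And>x x' f. f \<in> Mor S x x' \<Longrightarrow> x \<in> Fib S (asrc c) \<Longrightarrow> sum_mor S L f (Ident S (zeta K S V)) = f"
proof -
  show "small_extension \<Lambda> K c" "module K V" "art_alg \<Lambda> K (sqz K V)" "kernel_iso c V j"
    using assms by (simp_all add: small_law_def)
  then show "arr c" "arr_surj c" "zeta K S V \<in> Fib S (sqz K V)"
    by (simp_all add: small_extensionD zeta_Fib)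
  show "\<And>x. x \<in> Fib S (asrc c) \<Longrightarrow> sum_ob L x (zeta K S V) = x"
    using assms by (simp add: small_law_def addition_law_def)
  show "sum_mor S L f (Ident S (zeta K S V)) = f" if f: "f \<in> Mor S x x'" and x: "x \<in> Fib S (asrc c)" for x x' f
  proof -
    have "x' \<in> Fib S (asrc c)" using MorD[OF f] x by (simp add: Fib_iff)
    then show ?thesis using assms f x by (simp add: small_law_def addition_law_def)
  qed
qed

lemma law_arrows:
  assumes "small_law c V j L" "x \<in> Fib S (asrc c)" "y \<in> Fib S (sqz K V)"
  shows "star1 L x y \<in> Over S (pr1 (asrc c) V) x (star_ob L x y)"
    "star2 L x y \<in> Over S (pr2 (asrc c) V) y (star_ob L x y)"
    "sum_arr L x y \<in> Over S (sigma K (asrc c) V j) (sum_ob L x y) (star_ob L x y)"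
  using assms by (simp_all add: small_law_def addition_law_def)

text \<open>
  An object over \<open>A'\<close> can be added to \<open>\<zeta>\<close>, and the resulting morphism over \<open>\<sigma>\<close> shows that \<open>\<sigma>\<close> is an
  arrow of the base.
\<close>

lemma law_sigma:
  assumes "small_law c V j L" "x \<in> Fib S (asrc c)"
  shows "arr (sigma K (asrc c) V j)" "cartesian c c (sigma K (asrc c) V j) (pr1 (asrc c) V)"
    "art_alg \<Lambda> K (Pr (asrc c) V)"
    "cartesian (res_arr K (asrc c)) (res_arr K (sqz K V)) (pr1 (asrc c) V) (pr2 (asrc c) V)"
proof -
  note L = lawD[OF assms(1)]
  show 1: "arr (sigma K (asrc c) V j)"
    using OverD(5)[OF law_arrows(3)[OF assms L(7)]] .
  show "cartesian c c (sigma K (asrc c) V j) (pr1 (asrc c) V)"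
    by (rule cartesian_sigma[OF L(1,3,4) 1])
  show 2: "art_alg \<Lambda> K (Pr (asrc c) V)" using arrD(1)[OF 1] by simp
  show "cartesian (res_arr K (asrc c)) (res_arr K (sqz K V)) (pr1 (asrc c) V) (pr2 (asrc c) V)"
    using cartesian_pr[OF art_alg_Fib[OF assms(2)] L(3) 2] .
qed

lemma sum_ob_Fib:
  assumes "small_law c V j L" "x \<in> Fib S (asrc c)" "y \<in> Fib S (sqz K V)"
  shows "sum_ob L x y \<in> Fib S (asrc c)"
  using OverD(10)[OF law_arrows(3)[OF assms]] by simp

subsection \<open>Sums of morphisms, possibly between different laws\<close>

text \<open>
  \<open>n = f + g\<close> for morphisms \<open>f\<close>, \<open>g\<close> lying over arbitrary arrows and with possibly different laws
  \<open>M\<close> at the sources and \<open>L\<close> at the targets; \<open>m\<close> is \<open>f * g\<close>.  With \<open>L = M\<close> over the identity it is the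
  sum of morphisms; two laws on one extension compare different choices; two different
  extensions express functoriality.
\<close>

definition sum_rel :: "('o, 'm) law \<Rightarrow> ('o, 'm) law \<Rightarrow> 'm \<Rightarrow> 'm \<Rightarrow> 'm \<Rightarrow> bool" where
  "sum_rel L M f g n \<longleftrightarrow>
    (\<exists>m. m \<in> Arr S \<and> Dom S m = star_ob M (Dom S f) (Dom S g) \<and> Cod S m = star_ob L (Cod S f) (Cod S g) \<and>
      m \<cdot> star1 M (Dom S f) (Dom S g) = star1 L (Cod S f) (Cod S g) \<cdot> f \<and>
      m \<cdot> star2 M (Dom S f) (Dom S g) = star2 L (Cod S f) (Cod S g) \<cdot> g \<and>
      n \<in> Over S (proj_arr S f) (sum_ob M (Dom S f) (Dom S g)) (sum_ob L (Cod S f) (Cod S g)) \<and>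
      sum_arr L (Cod S f) (Cod S g) \<cdot> n = m \<cdot> sum_arr M (Dom S f) (Dom S g))"

text \<open>
  \<open>f * g\<close> comes from the universal property of the star object over the map of fiber products
  induced by \<open>h\<close> and \<open>\<psi>\<close>, and it descends to the sums because \<open>\<sigma>\<close> is natural.
\<close>

lemma sum_rel_ex:
  assumes L: "small_law c V j L" and M: "small_law d W i M"
    and f: "f \<in> Over S h x' x" and h: "asrc h = asrc c" "atgt h = asrc d"
    and g: "g \<in> Over S (sqz_map K V W \<psi>) y' y" and \<psi>: "linear_map K V W \<psi>"
    and compat: "\<And>v. v \<in> carrier V \<Longrightarrow> afun h (j v) = i (\<psi> v)"
  obtains n where "sum_rel L M f g n" "n \<in> Over S h (sum_ob M x' y') (sum_ob L x y)"
proof -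
  note L' = lawD[OF L] and M' = lawD[OF M]
  have x: "x \<in> Fib S (asrc c)" "x' \<in> Fib S (asrc d)" and y: "y \<in> Fib S (sqz K V)" "y' \<in> Fib S (sqz K W)"
    using OverD(10,11)[OF f] OverD(10,11)[OF g] h by simp_all
  note a = law_arrows[OF L x(1) y(1)] and b = law_arrows[OF M x(2) y(2)]
  note [simp] = OverD(1-5)[OF f] OverD(1-5)[OF g] OverD(1-4)[OF a(1)] OverD(1-4)[OF a(2)] OverD(1-4)[OF a(3)]
    OverD(1-4)[OF b(1)] OverD(1-4)[OF b(2)] OverD(1-4)[OF b(3)]
  note \<sigma> = law_sigma[OF L x(1)] and \<tau> = law_sigma[OF M x(2)]
  have P: "art_alg \<Lambda> K (Pr (asrc h) V)" "art_alg \<Lambda> K (Pr (atgt h) W)" using \<sigma>(3) \<tau>(3) h by simp_all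
  note H = Pr_map[OF OverD(5)[OF f] L'(2,3) M'(2,3) \<psi> P, unfolded h]
  have "j \<in> carrier V \<rightarrow> carrier (asrc h)"
    using kernel_isoD(1)[OF L'(4)] ker_closed(1)[OF L'(5)] h by auto
  then have nat: "arr_comp h (sigma K (asrc c) V j) = arr_comp (sigma K (asrc d) W i) (Pr_map V W h \<psi>)"
    using sigma_natural[where j = j and i = i, OF OverD(5)[OF f] L'(2,3) M'(2,3) \<psi>] compat \<sigma>(1) \<tau>(1) h
    by simp
  have "star1 L x y \<cdot> f \<in> Over S (arr_comp (pr1 (asrc d) W) (Pr_map V W h \<psi>)) x' (star_ob L x y)"
    "star2 L x y \<cdot> g \<in> Over S (arr_comp (pr2 (asrc d) W) (Pr_map V W h \<psi>)) y' (star_ob L x y)"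
    using Over_comp[OF f a(1)] Over_comp[OF g a(2)] H(4,5) by simp_all
  from star_pushout[OF b(1,2) H(1) H(3) this] obtain m where
    m: "m \<in> Over S (Pr_map V W h \<psi>) (star_ob M x' y') (star_ob L x y)"
    and eq: "m \<cdot> star1 M x' y' = star1 L x y \<cdot> f" "m \<cdot> star2 M x' y' = star2 L x y \<cdot> g"
    by blast
  obtain n where n: "n \<in> Over S h (sum_ob M x' y') (sum_ob L x y)"
    "sum_arr L x y \<cdot> n = m \<cdot> sum_arr M x' y'"
    by (rule lift[OF a(3) Over_comp[OF b(3) m] OverD(5)[OF f]]) (use nat h in auto)
  have "sum_rel L M f g n"
    unfolding sum_rel_def using m eq n by (intro exI[of _ m]) (auto simp: Over_iff)
  then show ?thesis using that n by blast
qed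

text \<open>
  The two projections are jointly monic, so the equations for \<open>m\<close> already determine the arrow over
  which \<open>m\<close> lies.
\<close>

lemma sum_rel_unique:
  assumes L: "small_law c V j L" and M: "small_law d W i M"
    and f: "f \<in> Arr S" "Dom S f \<in> Fib S (asrc d)" "Cod S f \<in> Fib S (asrc c)"
    and g: "g \<in> Arr S" "Dom S g \<in> Fib S (sqz K W)" "Cod S g \<in> Fib S (sqz K V)"
    and n: "sum_rel L M f g n" and n': "sum_rel L M f g n'"
  shows "n = n'"
proof -
  let ?x' = "Dom S f" and ?y' = "Dom S g" and ?x = "Cod S f" and ?y = "Cod S g"
  obtain m where m: "m \<in> Arr S" "Dom S m = star_ob M ?x' ?y'" "Cod S m = star_ob L ?x ?y"
    "m \<cdot> star1 M ?x' ?y' = star1 L ?x ?y \<cdot> f" "m \<cdot> star2 M ?x' ?y' = star2 L ?x ?y \<cdot> g"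
    and n: "n \<in> Over S (proj_arr S f) (sum_ob M ?x' ?y') (sum_ob L ?x ?y)"
      "sum_arr L ?x ?y \<cdot> n = m \<cdot> sum_arr M ?x' ?y'"
    using n by (auto simp: sum_rel_def)
  obtain m' where m': "m' \<in> Arr S" "Dom S m' = star_ob M ?x' ?y'" "Cod S m' = star_ob L ?x ?y"
    "m' \<cdot> star1 M ?x' ?y' = star1 L ?x ?y \<cdot> f" "m' \<cdot> star2 M ?x' ?y' = star2 L ?x ?y \<cdot> g"
    and n': "n' \<in> Over S (proj_arr S f) (sum_ob M ?x' ?y') (sum_ob L ?x ?y)"
      "sum_arr L ?x ?y \<cdot> n' = m' \<cdot> sum_arr M ?x' ?y'"
    using n' by (auto simp: sum_rel_def)
  note a = law_arrows[OF L f(3) g(3)] and b = law_arrows[OF M f(2) g(2)]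
  note [simp] = OverD(1-4)[OF a(1)] OverD(1-4)[OF a(2)] OverD(1-4)[OF b(1)] OverD(1-4)[OF b(2)]
  note [simp] = m(1-3) m'(1-3)
  have tgt: "atgt (proj_arr S m) = Pr (asrc d) W" "atgt (proj_arr S m') = Pr (asrc d) W"
    using OverD(9)[OF b(1)] by simp_all
  have src: "asrc (proj_arr S m) = asrc (proj_arr S m')" by simp
  have 1: "arr_comp (pr1 (asrc d) W) (proj_arr S m) = proj_arr S (m \<cdot> star1 M ?x' ?y')"
    "arr_comp (pr2 (asrc d) W) (proj_arr S m) = proj_arr S (m \<cdot> star2 M ?x' ?y')"
    "arr_comp (pr1 (asrc d) W) (proj_arr S m') = proj_arr S (m' \<cdot> star1 M ?x' ?y')"
    "arr_comp (pr2 (asrc d) W) (proj_arr S m') = proj_arr S (m' \<cdot> star2 M ?x' ?y')"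
    by (simp_all add: m(1-3) m'(1-3))
  have "proj_arr S m = proj_arr S m'"
    by (rule cartesian_jointly_monic[OF law_sigma(4)[OF M f(2)]])
      (use tgt src 1 m(4,5) m'(4,5) in simp_all)
  then have mO: "m \<in> Over S (proj_arr S m) (star_ob M ?x' ?y') (star_ob L ?x ?y)"
    "m' \<in> Over S (proj_arr S m) (star_ob M ?x' ?y') (star_ob L ?x ?y)"
    by (simp_all add: Over_iff)
  have "star1 L ?x ?y \<cdot> f \<in> Over S (arr_comp (pr1 (asrc d) W) (proj_arr S m)) ?x' (star_ob L ?x ?y)"
    "star2 L ?x ?y \<cdot> g \<in> Over S (arr_comp (pr2 (asrc d) W) (proj_arr S m)) ?y' (star_ob L ?x ?y)"
    using Over_comp[OF b(1) mO(1)] Over_comp[OF b(2) mO(1)] m(4,5) by simp_all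
  from star_pushout[OF b(1,2) _ tgt(1) this] mO m(4,5) m'(4,5) have "m = m'"
    by (metis proj_simps(1) m(1))
  then show "n = n'"
    using cancel[OF a(3) n(1) n'(1)] n(2) n'(2) by simp
qed

lemma sum_rel_comp:
  assumes L: "small_law c V j L" and M: "small_law d W i M" and N: "small_law e U k N"
    and f: "f \<in> Arr S" "Cod S f \<in> Fib S (asrc c)" "Dom S f \<in> Fib S (asrc d)"
    and g: "g \<in> Arr S" "Cod S g \<in> Fib S (sqz K V)" "Dom S g \<in> Fib S (sqz K W)"
    and f': "f' \<in> Arr S" "Cod S f' = Dom S f" "Dom S f' \<in> Fib S (asrc e)"
    and g': "g' \<in> Arr S" "Cod S g' = Dom S g" "Dom S g' \<in> Fib S (sqz K U)"
    and n: "sum_rel L M f g n" and n': "sum_rel M N f' g' n'"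
  shows "sum_rel L N (f \<cdot> f') (g \<cdot> g') (n \<cdot> n')"
proof -
  let ?x' = "Dom S f" and ?y' = "Dom S g" and ?x = "Cod S f" and ?y = "Cod S g"
    and ?x'' = "Dom S f'" and ?y'' = "Dom S g'"
  obtain m where m: "m \<in> Arr S" "Dom S m = star_ob M ?x' ?y'" "Cod S m = star_ob L ?x ?y"
    "m \<cdot> star1 M ?x' ?y' = star1 L ?x ?y \<cdot> f" "m \<cdot> star2 M ?x' ?y' = star2 L ?x ?y \<cdot> g"
    and n: "n \<in> Over S (proj_arr S f) (sum_ob M ?x' ?y') (sum_ob L ?x ?y)"
      "sum_arr L ?x ?y \<cdot> n = m \<cdot> sum_arr M ?x' ?y'"
    using n by (auto simp: sum_rel_def)
  obtain m' where m': "m' \<in> Arr S" "Dom S m' = star_ob N ?x'' ?y''" "Cod S m' = star_ob M ?x' ?y'"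
    "m' \<cdot> star1 N ?x'' ?y'' = star1 M ?x' ?y' \<cdot> f'" "m' \<cdot> star2 N ?x'' ?y'' = star2 M ?x' ?y' \<cdot> g'"
    and n': "n' \<in> Over S (proj_arr S f') (sum_ob N ?x'' ?y'') (sum_ob M ?x' ?y')"
      "sum_arr M ?x' ?y' \<cdot> n' = m' \<cdot> sum_arr N ?x'' ?y''"
    using n' f'(2) g'(2) by (auto simp: sum_rel_def)
  note a = law_arrows[OF L f(2) g(2)] and b = law_arrows[OF M f(3) g(3)] and e = law_arrows[OF N f'(3) g'(3)]
  note [simp] = OverD(1-4)[OF a(1)] OverD(1-4)[OF a(2)] OverD(1-4)[OF a(3)] OverD(1-4)[OF b(1)]
    OverD(1-4)[OF b(2)] OverD(1-4)[OF b(3)] OverD(1-4)[OF e(1)] OverD(1-4)[OF e(2)] OverD(1-4)[OF e(3)]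
  note [simp] = m(1-3) m'(1-3) f(1) g(1) f'(1,2) g'(1,2) OverD(1-4)[OF n(1)] OverD(1-4)[OF n'(1)]
  have "m \<cdot> m' \<cdot> star1 N ?x'' ?y'' = star1 L ?x ?y \<cdot> f \<cdot> f'"
    using comp_eq_comp[OF m(4), of f'] m'(4) by simp
  moreover have "m \<cdot> m' \<cdot> star2 N ?x'' ?y'' = star2 L ?x ?y \<cdot> g \<cdot> g'"
    using comp_eq_comp[OF m(5), of g'] m'(5) by simp
  moreover have "sum_arr L ?x ?y \<cdot> n \<cdot> n' = m \<cdot> m' \<cdot> sum_arr N ?x'' ?y''"
    using comp_eq_comp[OF n(2), of n'] n'(2) by simp
  ultimately show ?thesis
    unfolding sum_rel_def by (intro exI[of _ "m \<cdot> m'"]) (simp add: Over_iff)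
qed

lemma sum_rel_Mor_ex:
  assumes L: "small_law c V j L" and M: "small_law c V j M"
    and f: "f \<in> Mor S x' x" "x \<in> Fib S (asrc c)" and g: "g \<in> Mor S y' y" "y \<in> Fib S (sqz K V)"
  obtains n where "sum_rel L M f g n" "n \<in> Mor S (sum_ob M x' y') (sum_ob L x y)"
proof -
  note L' = lawD[OF L]
  have f': "f \<in> Over S (arr_id (asrc c)) x' x" and x': "x' \<in> Fib S (asrc c)"
    using f MorD[OF f(1)] by (simp_all add: Over_iff Fib_iff)
  have g': "g \<in> Over S (sqz_map K V V (\<lambda>v. v)) y' y" and y': "y' \<in> Fib S (sqz K V)"
    using g MorD[OF g(1)] sqz_map_id[OF L'(2,3)] by (simp_all add: Over_iff Fib_iff)
  obtain n where n: "sum_rel L M f g n" "n \<in> Over S (arr_id (asrc c)) (sum_ob M x' y') (sum_ob L x y)"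
    by (rule sum_rel_ex[OF L M f' _ _ g'])
      (use kernel_isoD(1)[OF L'(4)] ker_closed(1)[OF L'(5)] in \<open>auto simp: linear_map_def\<close>)
  then show ?thesis
    using that sum_ob_Fib[OF M x' y'] by (simp add: Mor_iff Fib_iff)
qed

lemma star_mor:
  assumes L: "small_law c V j L"
    and f: "f \<in> Mor S x' x" "x \<in> Fib S (asrc c)" and g: "g \<in> Mor S y' y" "y \<in> Fib S (sqz K V)"
  shows "star_mor S L f g \<in> Mor S (star_ob L x' y') (star_ob L x y)"
    "star_mor S L f g \<cdot> star1 L x' y' = star1 L x y \<cdot> f"
    "star_mor S L f g \<cdot> star2 L x' y' = star2 L x y \<cdot> g"
    "sum_mor S L f g \<in> Mor S (sum_ob L x' y') (sum_ob L x y)"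
    "sum_arr L x y \<cdot> sum_mor S L f g = star_mor S L f g \<cdot> sum_arr L x' y'"
proof -
  note L' = lawD[OF L]
  have x': "x' \<in> Fib S (asrc c)" and y': "y' \<in> Fib S (sqz K V)"
    using f g MorD[OF f(1)] MorD[OF g(1)] by (simp_all add: Fib_iff)
  note a = law_arrows[OF L f(2) g(2)] and b = law_arrows[OF L x' y']
  note [simp] = MorD(1-4)[OF f(1)] MorD(1-4)[OF g(1)]
  have pob: "proj_ob S (star_ob L x' y') = Pr (asrc c) V"
    using OverD(9)[OF b(1)] by simp
  note P = law_sigma(3)[OF L x']
  have id: "arr (arr_id (Pr (asrc c) V))" "atgt (arr_id (Pr (asrc c) V)) = Pr (asrc c) V"
    using P by simp_all
  note pr = cartesianD[OF law_sigma(4)[OF L x']]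
  have g12: "star1 L x y \<cdot> f \<in> Over S (arr_comp (pr1 (asrc c) V) (arr_id (Pr (asrc c) V))) x' (star_ob L x y)"
    "star2 L x y \<cdot> g \<in> Over S (arr_comp (pr2 (asrc c) V) (arr_id (Pr (asrc c) V))) y' (star_ob L x y)"
    using Over_comp_Mor[OF a(1) f(1)] Over_comp_Mor[OF a(2) g(1)] pr by simp_all
  have "\<exists>!m. m \<in> Mor S (star_ob L x' y') (star_ob L x y) \<and>
      m \<cdot> star1 L x' y' = star1 L x y \<cdot> f \<and> m \<cdot> star2 L x' y' = star2 L x y \<cdot> g"
    using star_pushout[OF b(1,2) id g12] unfolding Mor_iff pob .
  from theI'[OF this] show m: "star_mor S L f g \<in> Mor S (star_ob L x' y') (star_ob L x y)"
    "star_mor S L f g \<cdot> star1 L x' y' = star1 L x y \<cdot> f"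
    "star_mor S L f g \<cdot> star2 L x' y' = star2 L x y \<cdot> g"
    by (simp_all add: star_mor_def)
  have "sum_mor S L f g = restr_along S (sum_arr L x' y') (sum_arr L x y) (star_mor S L f g)"
    by (simp add: sum_mor_def)
  then show "sum_mor S L f g \<in> Mor S (sum_ob L x' y') (sum_ob L x y)"
    "sum_arr L x y \<cdot> sum_mor S L f g = star_mor S L f g \<cdot> sum_arr L x' y'"
    using restr_along[OF b(3) a(3) m(1)] by simp_all
qed

lemma sum_rel_sum_mor:
  assumes L: "small_law c V j L"
    and f: "f \<in> Mor S x' x" "x \<in> Fib S (asrc c)" and g: "g \<in> Mor S y' y" "y \<in> Fib S (sqz K V)"
  shows "sum_rel L L f g (sum_mor S L f g)"
proof -
  note m = star_mor[OF L f g]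
  have F: "x' \<in> Fib S (asrc c)" "y' \<in> Fib S (sqz K V)"
    using f g MorD[OF f(1)] MorD[OF g(1)] by (simp_all add: Fib_iff)
  then have pob: "proj_ob S x' = asrc c" "proj_ob S (sum_ob L x' y') = asrc c"
    using sum_ob_Fib[OF L F] by (simp_all add: Fib_iff)
  show ?thesis
    unfolding sum_rel_def using m MorD[OF m(1)] MorD(1-4)[OF f(1)] MorD(1-4)[OF g(1)]
    by (intro exI[of _ "star_mor S L f g"]) (simp add: Mor_iff pob)
qed

lemma sum_mor_eqI:
  assumes L: "small_law c V j L"
    and f: "f \<in> Mor S x' x" "x \<in> Fib S (asrc c)" and g: "g \<in> Mor S y' y" "y \<in> Fib S (sqz K V)"
    and n: "sum_rel L L f g n"
  shows "sum_mor S L f g = n"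
  by (rule sum_rel_unique[OF L L _ _ _ _ _ _ sum_rel_sum_mor[OF L f g] n])
    (use f g MorD[OF f(1)] MorD[OF g(1)] in \<open>simp_all add: Fib_iff\<close>)

text \<open>
  Addition is a functor of two variables; this is what the Eckmann--Hilton argument and the passage
  from sums to composites use.
\<close>

lemma sum_mor_comp:
  assumes L: "small_law c V j L"
    and f: "f \<in> Mor S x' x" "f' \<in> Mor S x'' x'" "x \<in> Fib S (asrc c)"
    and g: "g \<in> Mor S y' y" "g' \<in> Mor S y'' y'" "y \<in> Fib S (sqz K V)"
  shows "sum_mor S L (f \<cdot> f') (g \<cdot> g') = sum_mor S L f g \<cdot> sum_mor S L f' g'"
proof -
  have F: "x' \<in> Fib S (asrc c)" "x'' \<in> Fib S (asrc c)" "y' \<in> Fib S (sqz K V)" "y'' \<in> Fib S (sqz K V)"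
    using f g MorD[OF f(1)] MorD[OF f(2)] MorD[OF g(1)] MorD[OF g(2)] by (simp_all add: Fib_iff)
  show ?thesis
    by (rule sum_mor_eqI[OF L Mor_comp[OF f(2,1)] f(3) Mor_comp[OF g(2,1)] g(3)],
        rule sum_rel_comp[OF L L L _ _ _ _ _ _ _ _ _ _ _ _
          sum_rel_sum_mor[OF L f(1,3) g(1,3)] sum_rel_sum_mor[OF L f(2) F(1) g(2) F(3)]])
      (use f g F MorD[OF f(1)] MorD[OF f(2)] MorD[OF g(1)] MorD[OF g(2)] in simp_all)
qed

subsection \<open>Sums of extensions\<close>

text \<open>
  The morphism \<open>\<phi>\<^sub>1\<^sub>2\<close> that makes \<open>x + y\<close> an extension of the object that \<open>x\<close> extends.
\<close>

definition leg :: "('l, 'r) alg_arr \<Rightarrow> ('o, 'm) law \<Rightarrow> 'o \<Rightarrow> 'm \<Rightarrow> 'o \<Rightarrow> 'm" where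
  "leg c L x \<phi> y = factor_thru S c (sum_arr L x y) (star1 L x y \<cdot> \<phi>)"

lemma pair_sum_eq: "pair_sum S c L p y = (sum_ob L (fst p) y, leg c L (fst p) (snd p) y)"
  by (simp add: pair_sum_def leg_def)

lemma leg:
  assumes L: "small_law c V j L" and \<phi>: "\<phi> \<in> Over S c \<eta> x" and y: "y \<in> Fib S (sqz K V)"
  shows "leg c L x \<phi> y \<in> Over S c \<eta> (sum_ob L x y)"
    "sum_arr L x y \<cdot> leg c L x \<phi> y = star1 L x y \<cdot> \<phi>"
proof -
  note x = OverD(11)[OF \<phi>]
  note a = law_arrows[OF L x y]
  show "leg c L x \<phi> y \<in> Over S c \<eta> (sum_ob L x y)"
    "sum_arr L x y \<cdot> leg c L x \<phi> y = star1 L x y \<cdot> \<phi>"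
    unfolding leg_def
    by (rule factor_thru[OF a(3) Over_comp[OF \<phi> a(1)]],
        use OverD(5)[OF \<phi>] cartesianD(9)[OF law_sigma(2)[OF L x]] in simp_all)+
qed

text \<open>
  Sums of morphisms respect the morphisms from the object being extended.  For \<open>k\<close> an identity
  this makes addition well defined on classes of extensions, and in general it is the functoriality
  of the action.
\<close>

lemma sum_rel_leg:
  assumes L: "small_law c V j L" and M: "small_law d W i M"
    and f: "f \<in> Over S h x' x" and g: "g \<in> Arr S" "Dom S g = y'" "Cod S g = y"
      "y' \<in> Fib S (sqz K W)" "y \<in> Fib S (sqz K V)"
    and n: "sum_rel L M f g n"
    and \<phi>: "\<phi> \<in> Over S c \<eta> x" and \<phi>': "\<phi>' \<in> Over S d \<eta>' x'"
    and k: "k \<in> Arr S" "Dom S k = \<eta>'" "Cod S k = \<eta>" and eq: "f \<cdot> \<phi>' = \<phi> \<cdot> k"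
  shows "n \<cdot> leg d M x' \<phi>' y' = leg c L x \<phi> y \<cdot> k"
proof -
  note a = law_arrows[OF L OverD(11)[OF \<phi>] g(5)] and b = law_arrows[OF M OverD(11)[OF \<phi>'] g(4)]
  note p = leg[OF L \<phi> g(5)] and p' = leg[OF M \<phi>' g(4)]
  note [simp] = OverD(1-4)[OF f] OverD(1-4)[OF \<phi>] OverD(1-4)[OF \<phi>'] OverD(1-4)[OF p(1)] OverD(1-4)[OF p'(1)] g(1-3) k
  note [simp] = OverD(1-4)[OF a(1)] OverD(1-4)[OF a(3)] OverD(1-4)[OF b(1)] OverD(1-4)[OF b(3)]
  obtain m where m: "m \<in> Arr S" "Dom S m = star_ob M x' y'" "Cod S m = star_ob L x y"
    "m \<cdot> star1 M x' y' = star1 L x y \<cdot> f"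
    and n: "n \<in> Over S h (sum_ob M x' y') (sum_ob L x y)" "sum_arr L x y \<cdot> n = m \<cdot> sum_arr M x' y'"
    using n by (auto simp: sum_rel_def)
  note [simp] = m(1-3) OverD(1-4)[OF n(1)]
  show ?thesis
  proof (rule cancel[OF a(3)])
    have "arr_comp d h = arr_comp (proj_arr S k) c"
      using arg_cong[OF eq, of "proj_arr S"] by simp
    then show "n \<cdot> leg d M x' \<phi>' y' \<in> Over S (arr_comp d h) \<eta>' (sum_ob L x y)"
      "leg c L x \<phi> y \<cdot> k \<in> Over S (arr_comp d h) \<eta>' (sum_ob L x y)"
      by (simp_all add: Over_iff)
    have "sum_arr L x y \<cdot> n \<cdot> leg d M x' \<phi>' y' = m \<cdot> sum_arr M x' y' \<cdot> leg d M x' \<phi>' y'"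
      using comp_eq_comp[OF n(2), of "leg d M x' \<phi>' y'"] by simp
    also have "\<dots> = m \<cdot> star1 M x' y' \<cdot> \<phi>'" using p'(2) by simp
    also have "\<dots> = star1 L x y \<cdot> f \<cdot> \<phi>'" using comp_eq_comp[OF m(4), of \<phi>'] by simp
    also have "\<dots> = star1 L x y \<cdot> \<phi> \<cdot> k" using eq by simp
    also have "\<dots> = sum_arr L x y \<cdot> leg c L x \<phi> y \<cdot> k" using comp_eq_comp[OF p(2), of k] by simp
    finally show "sum_arr L x y \<cdot> n \<cdot> leg d M x' \<phi>' y' = sum_arr L x y \<cdot> leg c L x \<phi> y \<cdot> k" .
  qed
qed

text \<open>
  The second universal property of the star object, from \<open>A' \<times>\<^sub>k k[V] = A' \<times>\<^sub>A A'\<close>: a morphism out of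
  \<open>x * y\<close> is a pair of morphisms out of \<open>x + y\<close> and \<open>x\<close> that agree over \<open>A\<close>.
\<close>

lemma torsor_pushout:
  assumes L: "small_law c V j L" and \<phi>1: "\<phi>1 \<in> Over S c \<eta> x1" and \<phi>2: "\<phi>2 \<in> Over S c \<eta> x2"
    and u1: "u1 \<in> Over S (sigma K (asrc c) V j) x1 w" and u2: "u2 \<in> Over S (pr1 (asrc c) V) x2 w"
    and u\<phi>: "u1 \<cdot> \<phi>1 = u2 \<cdot> \<phi>2"
    and g1: "g1 \<in> Over S (sigma K (asrc c) V j) x1 t" and g2: "g2 \<in> Over S (pr1 (asrc c) V) x2 t"
    and g\<phi>: "g1 \<cdot> \<phi>1 = g2 \<cdot> \<phi>2"
  shows "\<exists>!m. m \<in> Mor S w t \<and> m \<cdot> u1 = g1 \<and> m \<cdot> u2 = g2"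
proof -
  note sq = law_sigma(2)[OF L OverD(11)[OF \<phi>1]]
  note P = law_sigma(3)[OF L OverD(11)[OF \<phi>1]]
  have ob: "proj_ob S w = Pr (asrc c) V" using OverD(9)[OF u1] by simp
  show ?thesis
    using cartesian_pushout[OF sq lawD(6)[OF L] \<phi>1 \<phi>2 u1 u2 u\<phi>, of "arr_id (Pr (asrc c) V)" g1 t g2]
      g1 g2 g\<phi> P cartesianD(4,5)[OF sq] unfolding Mor_iff ob by simp
qed

text \<open>
  Two extensions \<open>z\<close>, \<open>x\<close> of \<open>\<eta>\<close> glue over \<open>A' \<times>\<^sub>A A'\<close>; read over \<open>A' \<times>\<^sub>k k[V]\<close>, the glued object is
  \<open>x * y\<close> with \<open>y\<close> its restriction to \<open>k[V]\<close>, and its pushforward along \<open>\<sigma>\<close> is \<open>z\<close>.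
\<close>

lemma sum_transitive:
  assumes L: "small_law c V j L" and \<phi>: "\<phi> \<in> Over S c \<eta> x" and \<chi>: "\<chi> \<in> Over S c \<eta> z"
  obtains y n where "y \<in> Fib S (sqz K V)" "n \<in> Mor S (sum_ob L x y) z" "n \<cdot> leg c L x \<phi> y = \<chi>"
proof -
  note x = OverD(11)[OF \<phi>]
  note sq = law_sigma(2)[OF L x]
  obtain w u1 u2 where u1: "u1 \<in> Over S (sigma K (asrc c) V j) z w"
    and u2: "u2 \<in> Over S (pr1 (asrc c) V) x w" and u\<phi>: "u1 \<cdot> \<chi> = u2 \<cdot> \<phi>"
    using cartesian_glue[OF sq lawD(6)[OF L] \<chi> \<phi>] .
  have w: "w \<in> Fib S (asrc (pr2 (asrc c) V))" using OverD(11)[OF u2] by simp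
  note pr = cartesianD[OF law_sigma(4)[OF L x]]
  note b = pullback[OF pr(5) w]
  let ?b = "pullback S (pr2 (asrc c) V) w" and ?y = "restr_ob S (pr2 (asrc c) V) w"
  have y: "?y \<in> Fib S (sqz K V)" using b(2) by simp
  note a = law_arrows[OF L x y] and p = leg[OF L \<phi> y]
  have id: "arr (arr_id (Pr (asrc c) V))" "atgt (arr_id (Pr (asrc c) V)) = Pr (asrc c) V"
    using law_sigma(3)[OF L x] by simp_all
  have g: "u2 \<in> Over S (arr_comp (pr1 (asrc c) V) (arr_id (Pr (asrc c) V))) x w"
    "?b \<in> Over S (arr_comp (pr2 (asrc c) V) (arr_id (Pr (asrc c) V))) ?y w"
    using u2 b(1) pr by simp_all
  have ob: "arr_id (Pr (asrc c) V) = arr_id (proj_ob S (star_ob L x ?y))" using OverD(9)[OF a(1)] by simp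
  obtain m where m: "m \<in> Mor S (star_ob L x ?y) w" "m \<cdot> star1 L x ?y = u2"
    using star_pushout[OF a(1,2) id g] unfolding Mor_iff ob by blast
  obtain n where n: "n \<in> Mor S (sum_ob L x ?y) z" "u1 \<cdot> n = m \<cdot> sum_arr L x ?y"
    using Mor_factor[OF u1 Mor_comp_Over[OF a(3) m(1)]] .
  note [simp] = OverD(1-4)[OF u1] OverD(1-4)[OF u2] OverD(1-4)[OF a(1)] OverD(1-4)[OF a(3)] OverD(1-4)[OF p(1)]
    MorD(1-4)[OF m(1)] MorD(1-4)[OF n(1)] OverD(1-4)[OF \<phi>] OverD(1-4)[OF \<chi>]
  have "n \<cdot> leg c L x \<phi> ?y = \<chi>"
  proof (rule cancel[OF u1 Mor_comp_Over[OF p(1) n(1)] \<chi>])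
    have "u1 \<cdot> n \<cdot> leg c L x \<phi> ?y = m \<cdot> sum_arr L x ?y \<cdot> leg c L x \<phi> ?y"
      using comp_eq_comp[OF n(2), of "leg c L x \<phi> ?y"] by simp
    also have "\<dots> = (m \<cdot> star1 L x ?y) \<cdot> \<phi>" using p(2) by simp
    also have "\<dots> = u1 \<cdot> \<chi>" unfolding m(2) using u\<phi> by simp
    finally show "u1 \<cdot> n \<cdot> leg c L x \<phi> ?y = u1 \<cdot> \<chi>" .
  qed
  then show ?thesis using that y n(1) by blast
qed

text \<open>
  An isomorphism \<open>x + y \<cong> x + y'\<close> of extensions glues with the identity of \<open>x\<close> to a morphism
  \<open>x * y \<rightarrow> x * y'\<close>, which restricts to \<open>k[V]\<close>.
\<close>

lemma sum_free:
  assumes L: "small_law c V j L" and \<phi>: "\<phi> \<in> Over S c \<eta> x" and y: "y \<in> Fib S (sqz K V)"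
    and y': "y' \<in> Fib S (sqz K V)" and n: "n \<in> Mor S (sum_ob L x y) (sum_ob L x y')"
    and eq: "n \<cdot> leg c L x \<phi> y = leg c L x \<phi> y'"
  shows "Mor S y y' \<noteq> {}"
proof -
  note x = OverD(11)[OF \<phi>]
  note a = law_arrows[OF L x y] and b = law_arrows[OF L x y']
  note p = leg[OF L \<phi> y] and p' = leg[OF L \<phi> y']
  note [simp] = OverD(1-4)[OF a(1)] OverD(1-4)[OF a(3)] OverD(1-4)[OF p(1)] MorD(1-4)[OF n]
    OverD(1-4)[OF b(1)] OverD(1-4)[OF b(3)] OverD(1-4)[OF p'(1)] OverD(1-4)[OF \<phi>]
  have "(sum_arr L x y' \<cdot> n) \<cdot> leg c L x \<phi> y = star1 L x y' \<cdot> \<phi>"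
    using eq p'(2) by simp
  from torsor_pushout[OF L p(1) \<phi> a(3,1) p(2) Over_comp_Mor[OF b(3) n] b(1) this]
  obtain m where m: "m \<in> Mor S (star_ob L x y) (star_ob L x y')" by blast
  show ?thesis using Mor_factor[OF b(2) Mor_comp_Over[OF a(2) m]] by blast
qed

text \<open>
  The triple gluing over \<open>(A' \<times>\<^sub>k k[V]) \<times>\<^sub>k k[V]\<close> has both iterated sums as pushforwards, along the
  two equal maps of \<open>sigma_assoc\<close>.
\<close>

lemma sum_assoc:
  assumes L: "small_law c V j L" and L0: "small_law (res_arr K (sqz K V)) V (\<lambda>v. enc (\<zero>\<^bsub>K\<^esub>, v)) L0"
    and \<phi>: "\<phi> \<in> Over S c \<eta> x" and y: "y \<in> Fib S (sqz K V)" and z: "z \<in> Fib S (sqz K V)"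
  obtains n where "n \<in> Mor S (sum_ob L (sum_ob L x y) z) (sum_ob L x (sum_ob L0 y z))"
    "n \<cdot> leg c L (sum_ob L x y) (leg c L x \<phi> y) z = leg c L x \<phi> (sum_ob L0 y z)"
proof -
  let ?A = "asrc c" and ?s = "sigma K (asrc c) V j" and ?t = "sigma K (sqz K V) V (\<lambda>v. enc (\<zero>\<^bsub>K\<^esub>, v))"
  note x = OverD(11)[OF \<phi>]
  note \<sigma> = law_sigma[OF L x] note pr = cartesianD[OF \<sigma>(4)]
  have y0: "y \<in> Fib S (asrc (res_arr K (sqz K V)))" using y by simp
  note \<tau> = law_sigma[OF L0 y0]
  have \<sigma>0: "arr ?t" using \<tau>(1) by simp
  have yz: "sum_ob L0 y z \<in> Fib S (sqz K V)" using sum_ob_Fib[OF L0 y0 z] by simp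
  note xy = sum_ob_Fib[OF L x y]
  note a = law_arrows[OF L x y] and b = law_arrows[OF L0 y0 z, unfolded res_arr_sel]
    and d = law_arrows[OF L xy z] and e = law_arrows[OF L x yz]
  note p = leg[OF L \<phi> y] note q = leg[OF L p(1) z] and r = leg[OF L \<phi> yz]
  have w: "star_ob L x y \<in> Fib S (Pr ?A V)" using OverD(11)[OF a(1)] by simp
  let ?q1 = "pr1 (Pr ?A V) V" and ?q2 = "pr2 (Pr ?A V) V"
  obtain W e1 e2 where e1: "e1 \<in> Over S ?q1 (star_ob L x y) W" and e2: "e2 \<in> Over S ?q2 z W"
    using star_ex[OF w z] .
  have Q: "art_alg \<Lambda> K (Pr (Pr ?A V) V)" using art_alg_Fib[OF OverD(11)[OF e1]] by simp
  obtain t \<rho> \<kappa> where arrs: "arr t" "arr \<rho>" "arr \<kappa>"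
    and src: "asrc t = Pr (Pr ?A V) V" "asrc \<rho> = Pr (Pr ?A V) V" "asrc \<kappa> = Pr (Pr ?A V) V"
    and tgt: "atgt t = Pr ?A V" "atgt \<rho> = Pr (sqz K V) V" "atgt \<kappa> = Pr ?A V"
    and t: "arr_comp (pr1 ?A V) t = arr_comp ?s ?q1" "arr_comp (pr2 ?A V) t = ?q2"
    and \<rho>: "arr_comp (pr1 (sqz K V) V) \<rho> = arr_comp (pr2 ?A V) ?q1" "arr_comp (pr2 (sqz K V) V) \<rho> = ?q2"
    and \<kappa>: "arr_comp (pr1 ?A V) \<kappa> = arr_comp (pr1 ?A V) ?q1" "arr_comp (pr2 ?A V) \<kappa> = arr_comp ?t \<rho>"
    and assoc: "arr_comp ?s t = arr_comp ?s \<kappa>"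
    by (rule sigma_assoc[OF lawD(1-4)[OF L] \<sigma>(1) \<sigma>0 Q])
  note [simp] = OverD(1-4)[OF \<phi>] OverD(1-4)[OF a(1)] OverD(1-4)[OF a(2)] OverD(1-4)[OF a(3)]
    OverD(1-4)[OF b(1)] OverD(1-4)[OF b(2)] OverD(1-4)[OF b(3)] OverD(1-4)[OF d(1)] OverD(1-4)[OF d(2)]
    OverD(1-4)[OF d(3)] OverD(1-4)[OF e(1)] OverD(1-4)[OF e(2)] OverD(1-4)[OF e(3)] OverD(1-4)[OF e1]
    OverD(1-4)[OF e2] OverD(1-4)[OF p(1)] OverD(1-4)[OF q(1)] OverD(1-4)[OF r(1)]
  \<comment> \<open>both iterated sums are pushforwards of the triple gluing \<open>W\<close>, along \<open>\<sigma>\<close> after \<open>t\<close> resp. \<open>\<kappa>\<close>\<close>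
  have "e1 \<cdot> sum_arr L x y \<in> Over S (arr_comp (pr1 ?A V) t) (sum_ob L x y) W"
    "e2 \<in> Over S (arr_comp (pr2 ?A V) t) z W"
    using Over_comp[OF a(3) e1] e2 t by simp_all
  from star_pushout[OF d(1,2) arrs(1) tgt(1) this] obtain m1 where
    m1: "m1 \<in> Over S t (star_ob L (sum_ob L x y) z) W" "m1 \<cdot> star1 L (sum_ob L x y) z = e1 \<cdot> sum_arr L x y"
    by blast
  have "e1 \<cdot> star2 L x y \<in> Over S (arr_comp (pr1 (sqz K V) V) \<rho>) y W"
    "e2 \<in> Over S (arr_comp (pr2 (sqz K V) V) \<rho>) z W"
    using Over_comp[OF a(2) e1] e2 \<rho> by simp_all
  from star_pushout[OF b(1,2) arrs(2) tgt(2) this] obtain m0 where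
    m0: "m0 \<in> Over S \<rho> (star_ob L0 y z) W" by blast
  have "e1 \<cdot> star1 L x y \<in> Over S (arr_comp (pr1 ?A V) \<kappa>) x W"
    "m0 \<cdot> sum_arr L0 y z \<in> Over S (arr_comp (pr2 ?A V) \<kappa>) (sum_ob L0 y z) W"
    using Over_comp[OF a(1) e1] Over_comp[OF b(3) m0] \<kappa> by simp_all
  from star_pushout[OF e(1,2) arrs(3) tgt(3) this] obtain m2 where
    m2: "m2 \<in> Over S \<kappa> (star_ob L x (sum_ob L0 y z)) W"
      "m2 \<cdot> star1 L x (sum_ob L0 y z) = e1 \<cdot> star1 L x y"
    by blast
  note [simp] = OverD(1-4)[OF m1(1)] OverD(1-4)[OF m2(1)]
  let ?S1 = "sum_arr L (sum_ob L x y) z" and ?S2 = "sum_arr L x (sum_ob L0 y z)"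
  let ?l1 = "leg c L (sum_ob L x y) (leg c L x \<phi> y) z" and ?l2 = "leg c L x \<phi> (sum_ob L0 y z)"
  have 1: "m1 \<cdot> ?S1 \<in> Over S (arr_comp ?s \<kappa>) (sum_ob L (sum_ob L x y) z) W"
    using Over_comp[OF d(3) m1(1)] assoc by simp
  have 2: "m2 \<cdot> ?S2 \<in> Over S (arr_comp ?s \<kappa>) (sum_ob L x (sum_ob L0 y z)) W"
    using Over_comp[OF e(3) m2(1)] by simp
  obtain n where n: "n \<in> Mor S (sum_ob L (sum_ob L x y) z) (sum_ob L x (sum_ob L0 y z))"
    "(m2 \<cdot> ?S2) \<cdot> n = m1 \<cdot> ?S1"
    using Mor_factor[OF 2 1] .
  note [simp] = MorD(1-4)[OF n(1)]
  have "n \<cdot> ?l1 = ?l2"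
  proof (rule cancel[OF 2 Mor_comp_Over[OF q(1) n(1)] r(1)])
    have "(m2 \<cdot> ?S2) \<cdot> n \<cdot> ?l1 = m1 \<cdot> ?S1 \<cdot> ?l1"
      using comp_eq_comp[OF n(2), of ?l1] by simp
    also have "\<dots> = m1 \<cdot> star1 L (sum_ob L x y) z \<cdot> leg c L x \<phi> y" using q(2) by simp
    also have "\<dots> = e1 \<cdot> sum_arr L x y \<cdot> leg c L x \<phi> y"
      using comp_eq_comp[OF m1(2), of "leg c L x \<phi> y"] by simp
    also have "\<dots> = e1 \<cdot> star1 L x y \<cdot> \<phi>" using p(2) by simp
    also have "\<dots> = m2 \<cdot> star1 L x (sum_ob L0 y z) \<cdot> \<phi>" using comp_eq_comp[OF m2(2), of \<phi>] by simp
    also have "\<dots> = (m2 \<cdot> ?S2) \<cdot> ?l2" using r(2) by simp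
    finally show "(m2 \<cdot> ?S2) \<cdot> n \<cdot> ?l1 = (m2 \<cdot> ?S2) \<cdot> ?l2" .
  qed
  then show ?thesis using that n(1) by blast
qed

section \<open>The tangent groups\<close>

subsection \<open>Isomorphism classes\<close>

lemma mem_iso_class: "y \<in> iso_class S x \<longleftrightarrow> Mor S x y \<noteq> {}"
  using MorD(6) by (auto simp: iso_class_def)

lemma Mor_sym: "Mor S x y \<noteq> {} \<Longrightarrow> Mor S y x \<noteq> {}"
  using Mor_inverse by blast

lemma Mor_trans: "Mor S x y \<noteq> {} \<Longrightarrow> Mor S y z \<noteq> {} \<Longrightarrow> Mor S x z \<noteq> {}"
  using Mor_comp by blast

lemma self_in_iso_class: "x \<in> Obj S \<Longrightarrow> x \<in> iso_class S x"
  using Mor_Ident by (auto simp: mem_iso_class)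

lemma iso_class_eqI:
  assumes m: "m \<in> Mor S x y" shows "iso_class S x = iso_class S y"
proof (rule Set.set_eqI)
  fix z
  have "Mor S x y \<noteq> {}" "Mor S y x \<noteq> {}" using m Mor_sym[of x y] by blast+
  then show "z \<in> iso_class S x \<longleftrightarrow> z \<in> iso_class S y"
    using Mor_trans[of x y z] Mor_trans[of y x z] unfolding mem_iso_class by blast
qed

lemma iso_class_Fib: "x \<in> Fib S A \<Longrightarrow> y \<in> iso_class S x \<Longrightarrow> y \<in> Fib S A"
  using MorD(6,7) by (fastforce simp: mem_iso_class Fib_iff)

lemma UN_iso_class:
  assumes x: "x \<in> Obj S" and f: "\<And>y. Mor S x y \<noteq> {} \<Longrightarrow> F y = F x"
  shows "(\<Union>y\<in>iso_class S x. F y) = F x"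
  using self_in_iso_class[OF x] f unfolding mem_iso_class[symmetric] by blast

lemma sum_ob_cong:
  assumes L: "small_law c V j L" and M: "small_law c V j M" and x: "x \<in> Fib S (asrc c)" and y: "y \<in> Fib S (sqz K V)"
    and "Mor S x x' \<noteq> {}" "Mor S y y' \<noteq> {}"
  shows "iso_class S (sum_ob M x' y') = iso_class S (sum_ob L x y)"
proof -
  obtain f g where f: "f \<in> Mor S x' x" and g: "g \<in> Mor S y' y" using assms(5,6) Mor_sym by blast
  obtain n where n: "n \<in> Mor S (sum_ob M x' y') (sum_ob L x y)"
    by (rule sum_rel_Mor_ex[OF L M f x g y])
  then show ?thesis by (rule iso_class_eqI)
qed

subsection \<open>The group \<open>T\<close>\<close>

lemma T_mult:
  assumes L: "small_law (res_arr K (sqz K V)) V (\<lambda>v. enc (\<zero>\<^bsub>K\<^esub>, v)) L"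
    and x: "x \<in> Fib S (sqz K V)" and y: "y \<in> Fib S (sqz K V)"
  shows "iso_class S x \<otimes>\<^bsub>T_group K S V L\<^esub> iso_class S y = iso_class S (sum_ob L x y)"
proof -
  have x0: "x \<in> Fib S (asrc (res_arr K (sqz K V)))" using x by simp
  have xy: "x \<in> Obj S" "y \<in> Obj S" using x y by (simp_all add: Fib_iff)
  have "iso_class S x \<otimes>\<^bsub>T_group K S V L\<^esub> iso_class S y =
      (\<Union>x'\<in>iso_class S x. \<Union>y'\<in>iso_class S y. iso_class S (sum_ob L x' y'))"
    by (simp add: T_group_def)
  also have "\<dots> = (\<Union>x'\<in>iso_class S x. iso_class S (sum_ob L x' y))"
  proof (rule SUP_cong[OF refl])
    fix x' assume "x' \<in> iso_class S x"
    then have "x' \<in> Fib S (asrc (res_arr K (sqz K V)))" using iso_class_Fib[OF x0] by blast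
    then show "(\<Union>y'\<in>iso_class S y. iso_class S (sum_ob L x' y')) = iso_class S (sum_ob L x' y)"
      using Mor_Ident by (intro UN_iso_class[OF xy(2)] sum_ob_cong[OF L L _ y]) (auto simp: Fib_iff)
  qed
  also have "\<dots> = iso_class S (sum_ob L x y)"
    using Mor_Ident[OF xy(2)] by (intro UN_iso_class[OF xy(1)] sum_ob_cong[OF L L x0 y]) auto
  finally show ?thesis .
qed

lemma extension_of_point:
  assumes "small_law (res_arr K (sqz K V)) V j L" and x: "x \<in> Fib S (sqz K V)"
  obtains \<phi> where "\<phi> \<in> Over S (res_arr K (sqz K V)) (point S) x"
  by (rule Over_res_ex[of "res_arr K (sqz K V)" x "point S"]) (use x point art_alg_Fib[OF x] that in auto)

text \<open>
  Inverses come from transitivity: applied to the extensions \<open>x\<close> and \<open>\<zeta>\<close> of the point along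
  \<open>k[V] \<rightarrow> k\<close>, it gives \<open>y\<close> with \<open>x + y \<cong> \<zeta>\<close>.
\<close>

lemma T_comm_group:
  assumes V: "module K V" "art_alg \<Lambda> K (sqz K V)" and L: "sqz_law K S V L"
  shows "comm_group (T_group K S V L)"
proof -
  note law = law_sqz[OF V L]
  note L' = lawD[OF law, simplified]
  let ?T = "T_group K S V L"
  have car: "carrier ?T = iso_class S ` Fib S (sqz K V)" and one: "\<one>\<^bsub>?T\<^esub> = iso_class S (zeta K S V)"
    by (simp_all add: T_group_def)
  have sum: "sum_ob L x y \<in> Fib S (sqz K V)" if "x \<in> Fib S (sqz K V)" "y \<in> Fib S (sqz K V)" for x y
    using sum_ob_Fib[OF law _ that(2)] that by simp
  have comm: "sum_ob L x y = sum_ob L y x" if "x \<in> Fib S (sqz K V)" "y \<in> Fib S (sqz K V)" for x y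
    using L that by (simp add: sqz_law_def)
  note mult = T_mult[OF law]
  show ?thesis
  proof (rule comm_groupI, unfold car one)
    fix P Q assume "P \<in> iso_class S ` Fib S (sqz K V)" "Q \<in> iso_class S ` Fib S (sqz K V)"
    then obtain x y where x: "x \<in> Fib S (sqz K V)" "P = iso_class S x"
      and y: "y \<in> Fib S (sqz K V)" "Q = iso_class S y" by blast
    show "P \<otimes>\<^bsub>?T\<^esub> Q \<in> iso_class S ` Fib S (sqz K V)"
      using x y mult sum by blast
    show "P \<otimes>\<^bsub>?T\<^esub> Q = Q \<otimes>\<^bsub>?T\<^esub> P"
      using x y mult comm by simp
    fix R assume "R \<in> iso_class S ` Fib S (sqz K V)"
    then obtain z where z: "z \<in> Fib S (sqz K V)" "R = iso_class S z" by blast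
    obtain \<phi> where \<phi>: "\<phi> \<in> Over S (res_arr K (sqz K V)) (point S) x"
      using extension_of_point[OF law x(1)] .
    obtain n where n: "n \<in> Mor S (sum_ob L (sum_ob L x y) z) (sum_ob L x (sum_ob L y z))"
      using sum_assoc[OF law law \<phi> y(1) z(1)] .
    then have "iso_class S (sum_ob L (sum_ob L x y) z) = iso_class S (sum_ob L x (sum_ob L y z))"
      by (rule iso_class_eqI)
    then show "(P \<otimes>\<^bsub>?T\<^esub> Q) \<otimes>\<^bsub>?T\<^esub> R = P \<otimes>\<^bsub>?T\<^esub> (Q \<otimes>\<^bsub>?T\<^esub> R)"
      using x y z by (simp add: mult sum)
  next
    show "iso_class S (zeta K S V) \<in> iso_class S ` Fib S (sqz K V)" using L'(7) by blast
    fix P assume "P \<in> iso_class S ` Fib S (sqz K V)"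
    then obtain x where x: "x \<in> Fib S (sqz K V)" "P = iso_class S x" by blast
    show "iso_class S (zeta K S V) \<otimes>\<^bsub>?T\<^esub> P = P"
      using x L'(7,8) by (simp add: mult comm[OF L'(7)])
    obtain \<phi> where \<phi>: "\<phi> \<in> Over S (res_arr K (sqz K V)) (point S) x"
      using extension_of_point[OF law x(1)] .
    obtain \<chi> where \<chi>: "\<chi> \<in> Over S (res_arr K (sqz K V)) (point S) (zeta K S V)"
      using extension_of_point[OF law L'(7)] .
    obtain y n where y: "y \<in> Fib S (sqz K V)" and n: "n \<in> Mor S (sum_ob L x y) (zeta K S V)"
      using sum_transitive[OF law \<phi> \<chi>] .
    have "iso_class S y \<otimes>\<^bsub>?T\<^esub> P = iso_class S (zeta K S V)"
      using x y iso_class_eqI[OF n] comm[OF y x(1)] by (simp add: mult)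
    then show "\<exists>Q\<in>iso_class S ` Fib S (sqz K V). Q \<otimes>\<^bsub>?T\<^esub> P = iso_class S (zeta K S V)"
      using y by blast
  qed
qed

lemma T_mult_indep:
  assumes V: "module K V" "art_alg \<Lambda> K (sqz K V)" and L: "sqz_law K S V L" and L': "sqz_law K S V L'"
    and P: "P \<in> carrier (T_group K S V L)" and Q: "Q \<in> carrier (T_group K S V L)"
  shows "P \<otimes>\<^bsub>T_group K S V L'\<^esub> Q = P \<otimes>\<^bsub>T_group K S V L\<^esub> Q"
proof -
  note law = law_sqz[OF V L] and law' = law_sqz[OF V L']
  obtain x y where x: "x \<in> Fib S (sqz K V)" "P = iso_class S x"
    and y: "y \<in> Fib S (sqz K V)" "Q = iso_class S y" using P Q by (auto simp: T_group_def)
  have "iso_class S (sum_ob L' x y) = iso_class S (sum_ob L x y)"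
    by (rule sum_ob_cong[OF law law' _ y(1)]) (use x y Mor_Ident in \<open>auto simp: Fib_iff\<close>)
  then show ?thesis using x y T_mult[OF law] T_mult[OF law'] by simp
qed

subsection \<open>The group \<open>A\<close>\<close>

text \<open>
  Eckmann--Hilton: \<open>\<alpha> + \<beta> = (\<alpha> \<circ> id) + (id \<circ> \<beta>) = (\<alpha> + id) \<circ> (id + \<beta>) = \<alpha> \<circ> \<beta>\<close>.
\<close>

lemma sum_mor_zeta:
  assumes V: "module K V" "art_alg \<Lambda> K (sqz K V)" and L: "sqz_law K S V L"
    and \<alpha>: "\<alpha> \<in> Aut S (zeta K S V)" and \<beta>: "\<beta> \<in> Aut S (zeta K S V)"
  shows "sum_mor S L \<alpha> \<beta> = \<alpha> \<cdot> \<beta>"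
proof -
  note law = law_sqz[OF V L]
  let ?z = "zeta K S V"
  have z: "?z \<in> Fib S (asrc (res_arr K (sqz K V)))" "?z \<in> Fib S (sqz K V)" using lawD(7)[OF law] by simp_all
  then have id: "Ident S ?z \<in> Aut S ?z" using Mor_Ident by (simp add: Fib_iff)
  note unit = lawD(9)[OF law _ z(1)]
  have comm: "sum_mor S L (Ident S ?z) \<beta> = sum_mor S L \<beta> (Ident S ?z)"
    using L z(2) id \<beta> by (simp add: sqz_law_def)
  have "sum_mor S L (\<alpha> \<cdot> Ident S ?z) (Ident S ?z \<cdot> \<beta>) =
      sum_mor S L \<alpha> (Ident S ?z) \<cdot> sum_mor S L (Ident S ?z) \<beta>"
    by (rule sum_mor_comp[OF law \<alpha> id z(1) id \<beta> z(2)])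
  then show ?thesis
    using unit[OF \<alpha>] unit[OF \<beta>] comm MorD[OF \<alpha>] MorD[OF \<beta>] by simp
qed

lemma A_comm_group:
  assumes V: "module K V" "art_alg \<Lambda> K (sqz K V)" and L: "sqz_law K S V L"
  shows "comm_group (A_group K S V L)"
proof -
  note law = law_sqz[OF V L]
  let ?z = "zeta K S V"
  have z: "?z \<in> Fib S (sqz K V)" using lawD(7)[OF law] .
  then have zO: "?z \<in> Obj S" by (simp add: Fib_iff)
  note sum = sum_mor_zeta[OF V L]
  have comm: "sum_mor S L \<alpha> \<beta> = sum_mor S L \<beta> \<alpha>" if "\<alpha> \<in> Aut S ?z" "\<beta> \<in> Aut S ?z" for \<alpha> \<beta>
    using L z that by (simp add: sqz_law_def)
  show ?thesis
  proof (rule comm_groupI)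
    fix \<alpha> assume "\<alpha> \<in> carrier (A_group K S V L)"
    then have \<alpha>: "\<alpha> \<in> Aut S ?z" by (simp add: A_group_def)
    obtain \<beta> where "\<beta> \<in> Aut S ?z" "\<beta> \<cdot> \<alpha> = Ident S ?z" using Mor_inverse[OF \<alpha>] by metis
    then show "\<exists>\<beta>\<in>carrier (A_group K S V L). \<beta> \<otimes>\<^bsub>A_group K S V L\<^esub> \<alpha> = \<one>\<^bsub>A_group K S V L\<^esub>"
      using \<alpha> by (auto simp: A_group_def sum)
    fix \<beta> assume "\<beta> \<in> carrier (A_group K S V L)"
    then show "\<alpha> \<otimes>\<^bsub>A_group K S V L\<^esub> \<beta> = \<beta> \<otimes>\<^bsub>A_group K S V L\<^esub> \<alpha>"
      using comm[OF \<alpha>] by (simp add: A_group_def)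
  qed (use zO in \<open>auto simp: A_group_def sum Mor_comp Mor_Ident MorD\<close>)
qed

subsection \<open>Functoriality of \<open>T\<close> and \<open>A\<close>\<close>

text \<open>
  Any morphism over \<open>k[V] \<rightarrow> k[W]\<close> computes the map on classes, so chosen pullbacks can be
  composed freely.
\<close>

lemma T_map_eq:
  assumes g: "g \<in> Over S (sqz_map K V W \<psi>) y' y" and ar: "arr (sqz_map K V W \<psi>)"
  shows "T_map K S V W \<psi> (iso_class S y) = iso_class S y'"
proof -
  have "iso_class S (restr_ob S (sqz_map K V W \<psi>) z) = iso_class S y'" if "Mor S y z \<noteq> {}" for z
  proof -
    obtain m where m: "m \<in> Mor S y z" using \<open>Mor S y z \<noteq> {}\<close> by blast
    have "z \<in> Fib S (asrc (sqz_map K V W \<psi>))"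
      using OverD[OF g] MorD[OF m] by (simp add: Fib_iff)
    note p = pullback[OF ar this]
    obtain t where t: "t \<in> Mor S y' (restr_ob S (sqz_map K V W \<psi>) z)"
      using Mor_factor[OF p(1) Mor_comp_Over[OF g m]] .
    then show ?thesis by (rule iso_class_eqI[symmetric])
  qed
  then show ?thesis
    unfolding T_map_def using UN_iso_class[OF OverD(7)[OF g]] Mor_Ident[OF OverD(7)[OF g]]
    by (metis (mono_tags, lifting) empty_iff)
qed

lemma T_map_ex:
  assumes ar: "arr (sqz_map K V W \<psi>)" and P: "P \<in> iso_class S ` Fib S (sqz K V)"
  obtains y y' g where "P = iso_class S y" "y \<in> Fib S (sqz K V)" "y' \<in> Fib S (sqz K W)"
    "g \<in> Over S (sqz_map K V W \<psi>) y' y" "T_map K S V W \<psi> P = iso_class S y'"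
proof -
  obtain y where y: "y \<in> Fib S (asrc (sqz_map K V W \<psi>))" "P = iso_class S y" using P by auto
  note p = pullback[OF ar y(1)]
  show ?thesis using that[OF y(2) _ _ p(1)] y p T_map_eq[OF p(1) ar] by simp
qed

lemma T_map_hom:
  assumes V: "module K V" "art_alg \<Lambda> K (sqz K V)" and W: "module K W" "art_alg \<Lambda> K (sqz K W)"
    and \<psi>: "linear_map K V W \<psi>" and L: "sqz_law K S V L" and M: "sqz_law K S W M"
  shows "T_map K S V W \<psi> \<in> hom (T_group K S V L) (T_group K S W M)"
proof (rule homI)
  note ar = sqz_map_arr[OF V W \<psi>]
  note law = law_sqz[OF V L] and law' = law_sqz[OF W M]
  fix P assume "P \<in> carrier (T_group K S V L)"
  then have "P \<in> iso_class S ` Fib S (sqz K V)" by (simp add: T_group_def)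
  then obtain x x' f where x: "P = iso_class S x" "x \<in> Fib S (sqz K V)" "x' \<in> Fib S (sqz K W)"
    "f \<in> Over S (sqz_map K V W \<psi>) x' x" "T_map K S V W \<psi> P = iso_class S x'"
    by (rule T_map_ex[OF ar])
  then show "T_map K S V W \<psi> P \<in> carrier (T_group K S W M)" by (simp add: T_group_def)
  fix Q assume "Q \<in> carrier (T_group K S V L)"
  then have "Q \<in> iso_class S ` Fib S (sqz K V)" by (simp add: T_group_def)
  then obtain y y' g where y: "Q = iso_class S y" "y \<in> Fib S (sqz K V)" "y' \<in> Fib S (sqz K W)"
    "g \<in> Over S (sqz_map K V W \<psi>) y' y" "T_map K S V W \<psi> Q = iso_class S y'"
    by (rule T_map_ex[OF ar])
  obtain n where n: "n \<in> Over S (sqz_map K V W \<psi>) (sum_ob M x' y') (sum_ob L x y)"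
    by (rule sum_rel_ex[OF law law' x(4) _ _ y(4) \<psi>]) auto
  show "T_map K S V W \<psi> (P \<otimes>\<^bsub>T_group K S V L\<^esub> Q) =
      T_map K S V W \<psi> P \<otimes>\<^bsub>T_group K S W M\<^esub> T_map K S V W \<psi> Q"
    using T_mult[OF law x(2) y(2)] T_mult[OF law' x(3) y(3)] T_map_eq[OF n ar] x y by simp
qed

lemma zeta_arr:
  assumes V: "module K V" "art_alg \<Lambda> K (sqz K V)" and W: "module K W" "art_alg \<Lambda> K (sqz K W)"
    and \<psi>: "linear_map K V W \<psi>"
  shows "zeta_arr K S V W \<psi> \<in> Over S (sqz_map K V W \<psi>) (zeta K S W) (zeta K S V)"
    "pullback S (sqz_unit K V) (point S) \<cdot> zeta_arr K S V W \<psi> = pullback S (sqz_unit K W) (point S)"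
    "pullback S (sqz_unit K V) (point S) \<in> Over S (sqz_unit K V) (zeta K S V) (point S)"
proof -
  have p: "pullback S (sqz_unit K V) (point S) \<in> Over S (sqz_unit K V) (zeta K S V) (point S)"
    "pullback S (sqz_unit K W) (point S) \<in> Over S (sqz_unit K W) (zeta K S W) (point S)"
    using pullback(1)[OF sqz_unit_arr[OF V], of "point S"] pullback(1)[OF sqz_unit_arr[OF W], of "point S"] point
    by (simp_all add: zeta_def)
  then show "zeta_arr K S V W \<psi> \<in> Over S (sqz_map K V W \<psi>) (zeta K S W) (zeta K S V)"
    "pullback S (sqz_unit K V) (point S) \<cdot> zeta_arr K S V W \<psi> = pullback S (sqz_unit K W) (point S)"
    "pullback S (sqz_unit K V) (point S) \<in> Over S (sqz_unit K V) (zeta K S V) (point S)"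
    unfolding zeta_arr_def
    using factor_thru[OF p sqz_map_arr[OF V W \<psi>]] sqz_map_unit[OF V W \<psi>] by simp_all
qed

lemma A_map:
  assumes V: "module K V" "art_alg \<Lambda> K (sqz K V)" and W: "module K W" "art_alg \<Lambda> K (sqz K W)"
    and \<psi>: "linear_map K V W \<psi>" and \<alpha>: "\<alpha> \<in> Aut S (zeta K S V)"
  shows "A_map K S V W \<psi> \<alpha> \<in> Aut S (zeta K S W)"
    "zeta_arr K S V W \<psi> \<cdot> A_map K S V W \<psi> \<alpha> = \<alpha> \<cdot> zeta_arr K S V W \<psi>"
  unfolding A_map_def
  using restr_along[OF zeta_arr(1)[OF V W \<psi>] zeta_arr(1)[OF V W \<psi>] \<alpha>] by auto

lemma A_map_eqI:
  assumes V: "module K V" "art_alg \<Lambda> K (sqz K V)" and W: "module K W" "art_alg \<Lambda> K (sqz K W)"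
    and \<psi>: "linear_map K V W \<psi>" and \<alpha>: "\<alpha> \<in> Aut S (zeta K S V)"
    and \<beta>: "\<beta> \<in> Aut S (zeta K S W)" "zeta_arr K S V W \<psi> \<cdot> \<beta> = \<alpha> \<cdot> zeta_arr K S V W \<psi>"
  shows "A_map K S V W \<psi> \<alpha> = \<beta>"
  unfolding A_map_def
  by (rule restr_along_eqI[OF zeta_arr(1)[OF V W \<psi>] zeta_arr(1)[OF V W \<psi>] \<alpha> \<beta>])

lemma A_map_hom:
  assumes V: "module K V" "art_alg \<Lambda> K (sqz K V)" and W: "module K W" "art_alg \<Lambda> K (sqz K W)"
    and \<psi>: "linear_map K V W \<psi>" and L: "sqz_law K S V L" and M: "sqz_law K S W M"
  shows "A_map K S V W \<psi> \<in> hom (A_group K S V L) (A_group K S W M)"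
proof (rule homI)
  let ?z = "zeta_arr K S V W \<psi>"
  note z = zeta_arr(1)[OF V W \<psi>] and A = A_map[OF V W \<psi>]
  fix \<alpha> assume "\<alpha> \<in> carrier (A_group K S V L)"
  then have \<alpha>: "\<alpha> \<in> Aut S (zeta K S V)" by (simp add: A_group_def)
  note a = A[OF \<alpha>]
  show "A_map K S V W \<psi> \<alpha> \<in> carrier (A_group K S W M)" using a by (simp add: A_group_def)
  fix \<beta> assume "\<beta> \<in> carrier (A_group K S V L)"
  then have \<beta>: "\<beta> \<in> Aut S (zeta K S V)" by (simp add: A_group_def)
  note b = A[OF \<beta>]
  note [simp] = OverD(1-3)[OF z] MorD(1-3)[OF \<alpha>] MorD(1-3)[OF \<beta>] MorD(1-3)[OF a(1)] MorD(1-3)[OF b(1)]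
  have "?z \<cdot> A_map K S V W \<psi> \<alpha> \<cdot> A_map K S V W \<psi> \<beta> = (\<alpha> \<cdot> \<beta>) \<cdot> ?z"
    using comp_eq_comp[OF a(2), of "A_map K S V W \<psi> \<beta>"] b(2) by simp
  then have "A_map K S V W \<psi> (\<alpha> \<cdot> \<beta>) = A_map K S V W \<psi> \<alpha> \<cdot> A_map K S V W \<psi> \<beta>"
    by (rule A_map_eqI[OF V W \<psi> Mor_comp[OF \<beta> \<alpha>] Mor_comp[OF b(1) a(1)]])
  then show "A_map K S V W \<psi> (\<alpha> \<otimes>\<^bsub>A_group K S V L\<^esub> \<beta>) =
      A_map K S V W \<psi> \<alpha> \<otimes>\<^bsub>A_group K S W M\<^esub> A_map K S V W \<psi> \<beta>"
    using sum_mor_zeta[OF V L \<alpha> \<beta>] sum_mor_zeta[OF W M a(1) b(1)] by (simp add: A_group_def)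
qed

lemma T_A_map_id:
  assumes V: "module K V" "art_alg \<Lambda> K (sqz K V)"
  shows "P \<in> iso_class S ` Fib S (sqz K V) \<Longrightarrow> T_map K S V V (\<lambda>v. v) P = P"
    "\<alpha> \<in> Aut S (zeta K S V) \<Longrightarrow> A_map K S V V (\<lambda>v. v) \<alpha> = \<alpha>"
proof -
  have lin: "linear_map K V V (\<lambda>v. v)" by (simp add: linear_map_def)
  note id = sqz_map_id[OF V] and ar = sqz_map_arr[OF V V lin] and z = zeta_arr[OF V V lin]
  show "T_map K S V V (\<lambda>v. v) P = P" if P: "P \<in> iso_class S ` Fib S (sqz K V)"
  proof -
    obtain x where x: "x \<in> Fib S (sqz K V)" "P = iso_class S x" using P by blast
    have "Ident S x \<in> Over S (sqz_map K V V (\<lambda>v. v)) x x" using Over_Ident[OF x(1)] id by simp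
    then show ?thesis using T_map_eq ar x by blast
  qed
  show "A_map K S V V (\<lambda>v. v) \<alpha> = \<alpha>" if \<alpha>: "\<alpha> \<in> Aut S (zeta K S V)"
  proof -
    have zF: "zeta K S V \<in> Fib S (sqz K V)" using zeta_Fib[OF V] .
    then have zO: "zeta K S V \<in> Obj S" by (simp add: Fib_iff)
    have "zeta_arr K S V V (\<lambda>v. v) = Ident S (zeta K S V)"
      by (rule cancel[OF z(3,1)]) (use z(2) OverD[OF z(3)] Over_Ident[OF zF] id in auto)
    then show ?thesis
      by (intro A_map_eqI[OF V V lin \<alpha> \<alpha>]) (use MorD[OF \<alpha>] in simp)
  qed
qed

lemma T_A_map_comp:
  assumes U: "module K U" "art_alg \<Lambda> K (sqz K U)" and V: "module K V" "art_alg \<Lambda> K (sqz K V)"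
    and W: "module K W" "art_alg \<Lambda> K (sqz K W)"
    and \<psi>: "linear_map K U V \<psi>" and \<chi>: "linear_map K V W \<chi>"
  shows "P \<in> iso_class S ` Fib S (sqz K U) \<Longrightarrow>
      T_map K S U W (\<chi> \<circ> \<psi>) P = T_map K S V W \<chi> (T_map K S U V \<psi> P)"
    "\<alpha> \<in> Aut S (zeta K S U) \<Longrightarrow> A_map K S U W (\<chi> \<circ> \<psi>) \<alpha> = A_map K S V W \<chi> (A_map K S U V \<psi> \<alpha>)"
proof -
  note lin = linear_map_comp[OF \<psi> \<chi>]
  note comp = sqz_map_comp[OF U V W \<psi> \<chi>]
  note ar = sqz_map_arr[OF U W lin] sqz_map_arr[OF U V \<psi>] sqz_map_arr[OF V W \<chi>]
  note z = zeta_arr[OF U W lin] and z1 = zeta_arr[OF U V \<psi>] and z2 = zeta_arr[OF V W \<chi>]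
  show "T_map K S U W (\<chi> \<circ> \<psi>) P = T_map K S V W \<chi> (T_map K S U V \<psi> P)"
    if P: "P \<in> iso_class S ` Fib S (sqz K U)"
  proof -
    obtain x x' f where x: "P = iso_class S x" "x \<in> Fib S (sqz K U)" "x' \<in> Fib S (sqz K V)"
      "f \<in> Over S (sqz_map K U V \<psi>) x' x" "T_map K S U V \<psi> P = iso_class S x'"
      by (rule T_map_ex[OF ar(2) P])
    have x': "x' \<in> Fib S (asrc (sqz_map K V W \<chi>))" using x(3) by simp
    note p = pullback[OF ar(3) x']
    have "f \<cdot> pullback S (sqz_map K V W \<chi>) x' \<in>
        Over S (sqz_map K U W (\<chi> \<circ> \<psi>)) (restr_ob S (sqz_map K V W \<chi>) x') x"
      using Over_comp[OF p(1) x(4)] comp by simp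
    then show ?thesis
      using T_map_eq[OF _ ar(1)] T_map_eq[OF p(1) ar(3)] x by metis
  qed
  show "A_map K S U W (\<chi> \<circ> \<psi>) \<alpha> = A_map K S V W \<chi> (A_map K S U V \<psi> \<alpha>)" if \<alpha>: "\<alpha> \<in> Aut S (zeta K S U)"
  proof -
    note a = A_map[OF U V \<psi> \<alpha>]
    note b = A_map[OF V W \<chi> a(1)]
    note [simp] = OverD(1-3)[OF z(1)] OverD(1-3)[OF z1(1)] OverD(1-3)[OF z2(1)] OverD(1-3)[OF z1(3)]
      OverD(1-3)[OF z2(3)] MorD(1-3)[OF \<alpha>] MorD(1-3)[OF a(1)] MorD(1-3)[OF b(1)]
    let ?z1 = "zeta_arr K S U V \<psi>" and ?z2 = "zeta_arr K S V W \<chi>"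
    have eq: "zeta_arr K S U W (\<chi> \<circ> \<psi>) = ?z1 \<cdot> ?z2"
    proof (rule cancel[OF z(3,1)])
      show "?z1 \<cdot> ?z2 \<in> Over S (sqz_map K U W (\<chi> \<circ> \<psi>)) (zeta K S W) (zeta K S U)"
        using Over_comp[OF z2(1) z1(1)] comp by simp
      show "pullback S (sqz_unit K U) (point S) \<cdot> zeta_arr K S U W (\<chi> \<circ> \<psi>) =
          pullback S (sqz_unit K U) (point S) \<cdot> ?z1 \<cdot> ?z2"
        using comp_eq_comp[of "pullback S (sqz_unit K U) (point S)" ?z1
            "pullback S (sqz_unit K V) (point S)" "Ident S (zeta K S V)" ?z2] z(2) z1(2) z2(2) OverD(6)[OF z1(3)]
        by (simp flip: comp_assoc)
    qed
    have "(?z1 \<cdot> ?z2) \<cdot> A_map K S V W \<chi> (A_map K S U V \<psi> \<alpha>) = ?z1 \<cdot> A_map K S U V \<psi> \<alpha> \<cdot> ?z2"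
      using b(2) by simp
    also have "\<dots> = \<alpha> \<cdot> ?z1 \<cdot> ?z2"
      using comp_eq_comp[OF a(2), of ?z2] by simp
    finally show ?thesis
      unfolding eq[symmetric] by (rule A_map_eqI[OF U W lin \<alpha> b(1)])
  qed
qed

end

section \<open>The torsors of extensions\<close>

lemma pseudotorsorI:
  fixes G (structure)
  assumes G: "group G"
    and ext: "\<And>g. g \<in> carrier G \<Longrightarrow> act g \<in> extensional E"
    and closed: "\<And>g x. g \<in> carrier G \<Longrightarrow> x \<in> E \<Longrightarrow> act g x \<in> E"
    and one: "\<And>x. x \<in> E \<Longrightarrow> act \<one> x = x"
    and mult: "\<And>g h x. g \<in> carrier G \<Longrightarrow> h \<in> carrier G \<Longrightarrow> x \<in> E \<Longrightarrow> act (g \<otimes> h) x = act g (act h x)"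
    and trans: "\<And>x y. x \<in> E \<Longrightarrow> y \<in> E \<Longrightarrow> \<exists>g\<in>carrier G. act g x = y"
    and free: "\<And>g h x. g \<in> carrier G \<Longrightarrow> h \<in> carrier G \<Longrightarrow> x \<in> E \<Longrightarrow> act g x = act h x \<Longrightarrow> g = h"
  shows "pseudotorsor G E act"
proof -
  interpret G: group G by fact
  have inv: "act (inv g) (act g x) = x" "act g (act (inv g) x) = x" if "g \<in> carrier G" "x \<in> E" for g x
    using that mult[of "inv g" g x] mult[of g "inv g" x] one[OF that(2)] by simp_all
  have Bij: "act g \<in> Bij E" if "g \<in> carrier G" for g
  proof -
    have "bij_betw (act g) E E"
      by (rule bij_betwI[of _ _ _ "act (inv g)"]) (use that inv closed in auto)
    then show ?thesis using ext that by (simp add: Bij_def)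
  qed
  have "act (g \<otimes> h) = compose E (act g) (act h)" if "g \<in> carrier G" "h \<in> carrier G" for g h
    by (rule extensionalityI[of _ E]) (use that ext mult in \<open>auto simp: compose_def\<close>)
  then have "act \<in> hom G (BijGroup E)"
    using Bij by (intro homI) (auto simp: BijGroup_def)
  then have "group_action G E act"
    using G group_BijGroup by (simp add: group_action_def group_hom_def group_hom_axioms_def)
  moreover have "\<exists>!g. g \<in> carrier G \<and> act g x = y" if "x \<in> E" "y \<in> E" for x y
    using trans[OF that] free that by metis
  ultimately show ?thesis by (simp add: pseudotorsor_def)
qed

context deformation
begin

subsection \<open>Classes of extensions\<close>

lemma ext_pairs_iff: "p \<in> ext_pairs S c \<eta> \<longleftrightarrow> snd p \<in> Over S c \<eta> (fst p)"
  using OverD(11)[of "snd p" c \<eta> "fst p"] by (auto simp: ext_pairs_def split_beta)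

lemma mem_ext_class:
  "q \<in> ext_class S c \<eta> p \<longleftrightarrow> q \<in> ext_pairs S c \<eta> \<and> (\<exists>m\<in>Mor S (fst p) (fst q). m \<cdot> snd p = snd q)"
  by (simp add: ext_class_def)

lemma self_in_ext_class:
  assumes "p \<in> ext_pairs S c \<eta>" shows "p \<in> ext_class S c \<eta> p"
proof -
  have \<phi>: "snd p \<in> Over S c \<eta> (fst p)" using assms by (simp add: ext_pairs_iff)
  then show ?thesis
    unfolding mem_ext_class using assms Mor_Ident[OF OverD(7)[OF \<phi>]] OverD[OF \<phi>] by force
qed

lemma ext_class_subset:
  assumes p: "p \<in> ext_pairs S c \<eta>" and m: "m \<in> Mor S (fst p) (fst q)" "m \<cdot> snd p = snd q"
  shows "ext_class S c \<eta> q \<subseteq> ext_class S c \<eta> p"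
proof
  have \<phi>: "snd p \<in> Over S c \<eta> (fst p)" using p by (simp add: ext_pairs_iff)
  fix r assume "r \<in> ext_class S c \<eta> q"
  then obtain k where r: "r \<in> ext_pairs S c \<eta>" and k: "k \<in> Mor S (fst q) (fst r)" "k \<cdot> snd q = snd r"
    by (auto simp: mem_ext_class)
  have "(k \<cdot> m) \<cdot> snd p = snd r"
    using k(2) m(2) OverD(1-3)[OF \<phi>] MorD(1-3)[OF k(1)] MorD(1-3)[OF m(1)] by simp
  then show "r \<in> ext_class S c \<eta> p"
    using r Mor_comp[OF m(1) k(1)] unfolding mem_ext_class by blast
qed

lemma ext_class_eqI:
  assumes p: "p \<in> ext_pairs S c \<eta>" and m: "m \<in> Mor S (fst p) (fst q)" "m \<cdot> snd p = snd q"
  shows "ext_class S c \<eta> p = ext_class S c \<eta> q"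
proof
  have \<phi>: "snd p \<in> Over S c \<eta> (fst p)" using p by (simp add: ext_pairs_iff)
  obtain k where k: "k \<in> Mor S (fst q) (fst p)" "k \<cdot> m = Ident S (fst p)" using Mor_inverse[OF m(1)] by metis
  have "snd q \<in> Over S c \<eta> (fst q)" using Mor_comp_Over[OF \<phi> m(1)] m(2) by simp
  then have q: "q \<in> ext_pairs S c \<eta>" by (simp add: ext_pairs_iff)
  have "k \<cdot> m \<cdot> snd p = (k \<cdot> m) \<cdot> snd p"
    using OverD(1-3)[OF \<phi>] MorD(1-3)[OF k(1)] MorD(1-3)[OF m(1)] by simp
  also have "\<dots> = snd p" unfolding k(2) using OverD[OF \<phi>] by simp
  finally have "k \<cdot> snd q = snd p" using m(2) by simp
  then show "ext_class S c \<eta> p \<subseteq> ext_class S c \<eta> q" by (rule ext_class_subset[OF q k(1)])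
  show "ext_class S c \<eta> q \<subseteq> ext_class S c \<eta> p" by (rule ext_class_subset[OF p m])
qed

lemma ext_class_eqD:
  assumes "ext_class S c \<eta> p = ext_class S c \<eta> q" "q \<in> ext_pairs S c \<eta>"
  obtains m where "m \<in> Mor S (fst p) (fst q)" "m \<cdot> snd p = snd q"
  using self_in_ext_class[OF assms(2)] that unfolding assms(1)[symmetric] mem_ext_class by blast

lemma pair_sum_ext:
  assumes L: "small_law c V j L" and p: "p \<in> ext_pairs S c \<eta>" and y: "y \<in> Fib S (sqz K V)"
  shows "pair_sum S c L p y \<in> ext_pairs S c \<eta>"
  using leg(1)[OF L _ y] p by (simp add: ext_pairs_iff pair_sum_eq)

lemma pair_sum_cong:
  assumes L: "small_law c V j L" and M: "small_law c V j M" and p: "p \<in> ext_pairs S c \<eta>" and y: "y \<in> Fib S (sqz K V)"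
    and p': "p' \<in> ext_class S c \<eta> p" and y': "y' \<in> iso_class S y"
  shows "ext_class S c \<eta> (pair_sum S c M p' y') = ext_class S c \<eta> (pair_sum S c L p y)"
proof -
  obtain x \<phi> x' \<phi>' where pp: "p = (x, \<phi>)" "p' = (x', \<phi>')" by (metis surj_pair)
  have \<phi>: "\<phi> \<in> Over S c \<eta> x" and \<phi>': "\<phi>' \<in> Over S c \<eta> x'"
    using p p' pp by (simp_all add: mem_ext_class ext_pairs_iff)
  obtain f where f: "f \<in> Mor S x x'" "f \<cdot> \<phi> = \<phi>'" using p' pp by (auto simp: mem_ext_class)
  obtain g where g: "g \<in> Mor S y y'" using y' by (auto simp: mem_iso_class)
  have Y: "y' \<in> Fib S (sqz K V)" using iso_class_Fib[OF y y'] .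
  obtain n where n: "sum_rel M L f g n" "n \<in> Mor S (sum_ob L x y) (sum_ob M x' y')"
    by (rule sum_rel_Mor_ex[OF M L f(1) OverD(11)[OF \<phi>'] g Y])
  have "f \<in> Over S (arr_id (proj_ob S x)) x x'" using f(1) by (simp only: Mor_iff)
  from sum_rel_leg[OF M L this MorD(1-3)[OF g] y Y n(1) \<phi>' \<phi>, of "Ident S \<eta>"]
  have "n \<cdot> leg c L x \<phi> y = leg c M x' \<phi>' y'"
    using f(2) OverD[OF \<phi>] OverD[OF \<phi>'] OverD(1-3)[OF leg(1)[OF M \<phi>' Y]] by simp
  then show ?thesis
    using ext_class_eqI[OF pair_sum_ext[OF L p y], of n "pair_sum S c M p' y'"] n(2)
    by (simp add: pair_sum_eq pp)
qed

lemma T_act_class: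
  assumes L: "small_law c V j L" and p: "p \<in> ext_pairs S c \<eta>" and y: "y \<in> Fib S (sqz K V)"
  shows "T_act S c L \<eta> (iso_class S y) (ext_class S c \<eta> p) = ext_class S c \<eta> (pair_sum S c L p y)"
proof -
  have y': "y \<in> iso_class S y" using self_in_iso_class y by (simp add: Fib_iff)
  have "T_act S c L \<eta> (iso_class S y) (ext_class S c \<eta> p) =
      (\<Union>p'\<in>ext_class S c \<eta> p. \<Union>y'\<in>iso_class S y. ext_class S c \<eta> (pair_sum S c L p' y'))"
    using p by (simp add: T_act_def T_ext_def)
  also have "\<dots> = (\<Union>p'\<in>ext_class S c \<eta> p. \<Union>y'\<in>iso_class S y. ext_class S c \<eta> (pair_sum S c L p y))"
    using pair_sum_cong[OF L L p y] by (intro SUP_cong refl)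
  also have "\<dots> = ext_class S c \<eta> (pair_sum S c L p y)"
    using self_in_ext_class[OF p] y' by blast
  finally show ?thesis .
qed

lemma T_act_indep:
  assumes L: "small_law c V j L" and M: "small_law c V j M" and t: "t \<in> iso_class S ` Fib S (sqz K V)"
  shows "T_act S c M \<eta> t = T_act S c L \<eta> t"
proof (rule extensionalityI[of _ "T_ext S c \<eta>"])
  fix P assume "P \<in> T_ext S c \<eta>"
  then obtain p where p: "p \<in> ext_pairs S c \<eta>" "P = ext_class S c \<eta> p" by (auto simp: T_ext_def)
  obtain y where y: "y \<in> Fib S (sqz K V)" "t = iso_class S y" using t by blast
  show "T_act S c M \<eta> t P = T_act S c L \<eta> t P"
    unfolding p(2) y(2) T_act_class[OF L p(1) y(1)] T_act_class[OF M p(1) y(1)]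
    using self_in_iso_class y(1) by (intro pair_sum_cong[OF L M p(1) y(1) self_in_ext_class[OF p(1)]])
      (simp add: Fib_iff)
qed (simp_all add: T_act_def)

text \<open>
  The action law is \<open>sum_assoc\<close>, up to exchanging the two summands in \<open>T\<close>.
\<close>

lemma T_ext_pseudotorsor:
  assumes L: "small_law c V j L" and L0: "sqz_law K S V L0"
  shows "pseudotorsor (T_group K S V L0) (T_ext S c \<eta>) (T_act S c L \<eta>)"
proof -
  note V = lawD(2,3)[OF L]
  note law0 = law_sqz[OF V L0]
  let ?T = "T_group K S V L0"
  have car: "carrier ?T = iso_class S ` Fib S (sqz K V)" and one: "\<one>\<^bsub>?T\<^esub> = iso_class S (zeta K S V)"
    by (simp_all add: T_group_def)
  interpret T: comm_group ?T by (rule T_comm_group[OF V L0])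
  note act = T_act_class[OF L]
  have sum: "sum_ob L0 x y \<in> Fib S (sqz K V)" if "x \<in> Fib S (sqz K V)" "y \<in> Fib S (sqz K V)" for x y
    using sum_ob_Fib[OF law0 _ that(2)] that by simp
  have mult: "T_act S c L \<eta> (s \<otimes>\<^bsub>?T\<^esub> t) P = T_act S c L \<eta> s (T_act S c L \<eta> t P)"
    if s: "s \<in> carrier ?T" and t: "t \<in> carrier ?T" and P: "P \<in> T_ext S c \<eta>" for s t P
  proof -
    obtain z where z: "z \<in> Fib S (sqz K V)" "s = iso_class S z" using s car by blast
    obtain y where y: "y \<in> Fib S (sqz K V)" "t = iso_class S y" using t car by blast
    obtain p where p: "p \<in> ext_pairs S c \<eta>" "P = ext_class S c \<eta> p" using P by (auto simp: T_ext_def)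
    have \<phi>: "snd p \<in> Over S c \<eta> (fst p)" using p(1) by (simp add: ext_pairs_iff)
    note q = pair_sum_ext[OF L p(1) y(1)]
    obtain n where "n \<in> Mor S (sum_ob L (sum_ob L (fst p) y) z) (sum_ob L (fst p) (sum_ob L0 y z))"
      "n \<cdot> leg c L (sum_ob L (fst p) y) (leg c L (fst p) (snd p) y) z = leg c L (fst p) (snd p) (sum_ob L0 y z)"
      by (rule sum_assoc[OF L law0 \<phi> y(1) z(1)])
    then have "ext_class S c \<eta> (pair_sum S c L (pair_sum S c L p y) z) =
        ext_class S c \<eta> (pair_sum S c L p (sum_ob L0 y z))"
      by (intro ext_class_eqI[OF pair_sum_ext[OF L q z(1)]]) (simp_all add: pair_sum_eq)
    moreover have "s \<otimes>\<^bsub>?T\<^esub> t = iso_class S (sum_ob L0 y z)"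
      using T.m_comm[OF s t] T_mult[OF law0 y(1) z(1)] y z by simp
    ultimately show ?thesis
      using act[OF p(1) y(1)] act[OF q z(1)] act[OF p(1) sum[OF y(1) z(1)]] p y z by simp
  qed
  have closed: "T_act S c L \<eta> t P \<in> T_ext S c \<eta>" if t: "t \<in> carrier ?T" and P: "P \<in> T_ext S c \<eta>" for t P
  proof -
    obtain y where y: "y \<in> Fib S (sqz K V)" "t = iso_class S y" using t car by blast
    obtain p where p: "p \<in> ext_pairs S c \<eta>" "P = ext_class S c \<eta> p" using P by (auto simp: T_ext_def)
    show ?thesis
      using act[OF p(1) y(1)] pair_sum_ext[OF L p(1) y(1)] p(2) y(2) by (simp add: T_ext_def)
  qed
  have trans: "\<exists>t\<in>carrier ?T. T_act S c L \<eta> t P = Q" if P: "P \<in> T_ext S c \<eta>" and Q: "Q \<in> T_ext S c \<eta>" for P Q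
  proof -
    obtain p where p: "p \<in> ext_pairs S c \<eta>" "P = ext_class S c \<eta> p" using P by (auto simp: T_ext_def)
    obtain q where q: "q \<in> ext_pairs S c \<eta>" "Q = ext_class S c \<eta> q" using Q by (auto simp: T_ext_def)
    have "snd p \<in> Over S c \<eta> (fst p)" "snd q \<in> Over S c \<eta> (fst q)" using p q by (simp_all add: ext_pairs_iff)
    then obtain y n where y: "y \<in> Fib S (sqz K V)"
      and n: "n \<in> Mor S (sum_ob L (fst p) y) (fst q)" "n \<cdot> leg c L (fst p) (snd p) y = snd q"
      by (rule sum_transitive[OF L])
    have "ext_class S c \<eta> (pair_sum S c L p y) = ext_class S c \<eta> q"
      by (rule ext_class_eqI[OF pair_sum_ext[OF L p(1) y], of n]) (use n in \<open>simp_all add: pair_sum_eq\<close>)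
    then have "T_act S c L \<eta> (iso_class S y) P = Q" using act[OF p(1) y] p q by simp
    then show ?thesis using y car by blast
  qed
  show ?thesis
  proof (rule pseudotorsorI)
    \<comment> \<open>by transitivity some \<open>t\<close> fixes \<open>P\<close>, whence \<open>0 + P = 0 + (t + P) = (0 + t) + P = t + P = P\<close>\<close>
    show "T_act S c L \<eta> \<one>\<^bsub>?T\<^esub> P = P" if P: "P \<in> T_ext S c \<eta>" for P
    proof -
      obtain t where t: "t \<in> carrier ?T" "T_act S c L \<eta> t P = P" using trans[OF P P] by blast
      then show ?thesis using mult[OF T.one_closed t(1) P] by simp
    qed
    show "s = t" if s: "s \<in> carrier ?T" and t: "t \<in> carrier ?T" and P: "P \<in> T_ext S c \<eta>"
      and eq: "T_act S c L \<eta> s P = T_act S c L \<eta> t P" for s t P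
    proof -
      obtain y where y: "y \<in> Fib S (sqz K V)" "s = iso_class S y" using s car by blast
      obtain y' where y': "y' \<in> Fib S (sqz K V)" "t = iso_class S y'" using t car by blast
      obtain p where p: "p \<in> ext_pairs S c \<eta>" "P = ext_class S c \<eta> p" using P by (auto simp: T_ext_def)
      have \<phi>: "snd p \<in> Over S c \<eta> (fst p)" using p(1) by (simp add: ext_pairs_iff)
      have "ext_class S c \<eta> (pair_sum S c L p y) = ext_class S c \<eta> (pair_sum S c L p y')"
        using eq act[OF p(1) y(1)] act[OF p(1) y'(1)] p(2) y(2) y'(2) by simp
      then obtain n where "n \<in> Mor S (sum_ob L (fst p) y) (sum_ob L (fst p) y')"
        "n \<cdot> leg c L (fst p) (snd p) y = leg c L (fst p) (snd p) y'"
        using ext_class_eqD[OF _ pair_sum_ext[OF L p(1) y'(1)]] by (metis pair_sum_eq fst_conv snd_conv)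
      from sum_free[OF L \<phi> y(1) y'(1) this] show ?thesis
        using iso_class_eqI y(2) y'(2) by blast
    qed
    show "T_act S c L \<eta> t \<in> extensional (T_ext S c \<eta>)" for t by (simp add: T_act_def)
  qed (use closed mult trans T.is_group in auto)
qed

section \<open>The torsors of automorphisms\<close>

lemma restr_mor_comp:
  assumes c: "arr c" and x: "x \<in> Fib S (asrc c)" and m: "m \<in> Mor S x y" and n: "n \<in> Mor S y z"
  shows "restr_mor S c (n \<cdot> m) = restr_mor S c n \<cdot> restr_mor S c m"
proof -
  have y: "y \<in> Fib S (asrc c)" and z: "z \<in> Fib S (asrc c)"
    using x MorD[OF m] MorD[OF n] by (simp_all add: Fib_iff)
  note r = restr_mor[OF c x m] and s = restr_mor[OF c y n]
  note [simp] = OverD(1-3)[OF pullback(1)[OF c x]] OverD(1-3)[OF pullback(1)[OF c y]]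
    OverD(1-3)[OF pullback(1)[OF c z]] MorD(1-3)[OF m] MorD(1-3)[OF n] MorD(1-3)[OF r(1)] MorD(1-3)[OF s(1)]
  have "pullback S c z \<cdot> restr_mor S c n \<cdot> restr_mor S c m = (n \<cdot> m) \<cdot> pullback S c x"
    using comp_eq_comp[OF s(2), of "restr_mor S c m"] r(2) by simp
  then show ?thesis
    using restr_mor(3)[OF c x Mor_comp[OF m n] Mor_comp[OF r(1) s(1)]] by simp
qed

lemma sum_Ident_Mor:
  assumes L: "small_law c V j L" and x: "x \<in> Fib S (asrc c)" and \<alpha>: "\<alpha> \<in> Aut S (zeta K S V)"
  shows "sum_mor S L (Ident S x) \<alpha> \<in> Aut S x"
  using star_mor(4)[OF L Mor_Ident x \<alpha> lawD(7)[OF L]] x lawD(8)[OF L x] by (simp add: Fib_iff)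

lemma sum_Ident_comp:
  assumes L: "small_law c V j L" and x: "x \<in> Fib S (asrc c)" and \<alpha>: "\<alpha> \<in> Aut S (zeta K S V)"
    and \<beta>: "\<beta> \<in> Aut S (zeta K S V)"
  shows "sum_mor S L (Ident S x) (\<alpha> \<cdot> \<beta>) = sum_mor S L (Ident S x) \<alpha> \<cdot> sum_mor S L (Ident S x) \<beta>"
proof -
  have xO: "x \<in> Obj S" using x by (simp add: Fib_iff)
  show ?thesis
    using sum_mor_comp[OF L Mor_Ident[OF xO] Mor_Ident[OF xO] x \<alpha> \<beta> lawD(7)[OF L]] xO by simp
qed

text \<open>
  The test morphism is the leg from the restriction of \<open>x\<close> to \<open>x = x + \<zeta>\<close>, the one appearing in
  \<open>torsor_pushout\<close>.
\<close>

lemma A_ext_id_iff: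
  assumes L: "small_law c V j L" and x: "x \<in> Fib S (asrc c)"
  shows "n \<in> A_ext S c x (Ident S (restr_ob S c x)) \<longleftrightarrow>
    n \<in> Aut S x \<and> n \<cdot> leg c L x (pullback S c x) (zeta K S V) = leg c L x (pullback S c x) (zeta K S V)"
  using restr_mor_iff[OF _ leg(1)[OF L pullback(1)[OF lawD(5)[OF L] x] lawD(7)[OF L], unfolded lawD(8)[OF L x]] refl, of n]
  by (auto simp: A_ext_def)

text \<open>
  By the two universal properties, an endomorphism of \<open>x * \<zeta>\<close> that is the identity on \<open>x\<close> is on the
  one hand an automorphism of \<open>\<zeta>\<close>, on the other an automorphism of \<open>x + \<zeta> = x\<close> that is the identity
  over \<open>A\<close>.
\<close>

lemma sum_Ident_bij:
  assumes L: "small_law c V j L" and x: "x \<in> Fib S (asrc c)"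
  shows "bij_betw (\<lambda>\<alpha>. sum_mor S L (Ident S x) \<alpha>) (Aut S (zeta K S V))
    (A_ext S c x (Ident S (restr_ob S c x)))"
proof -
  let ?z = "zeta K S V" and ?\<phi> = "pullback S c x"
  let ?l = "leg c L x ?\<phi> ?z" and ?s = "sum_arr L x ?z" and ?a = "star1 L x ?z" and ?b = "star2 L x ?z"
  note z = lawD(7)[OF L]
  have xO: "x \<in> Obj S" using x by (simp add: Fib_iff)
  have sx: "sum_ob L x ?z = x" using lawD(8)[OF L x] .
  note \<phi> = pullback(1)[OF lawD(5)[OF L] x]
  note a = law_arrows[OF L x z, unfolded sx] and l = leg[OF L \<phi> z, unfolded sx]
  note [simp] = OverD(1-3)[OF \<phi>] OverD(1-3)[OF a(1)] OverD(1-3)[OF a(2)] OverD(1-3)[OF a(3)] OverD(1-3)[OF l(1)]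
  have star: "star_mor S L (Ident S x) \<alpha> \<in> Mor S (star_ob L x ?z) (star_ob L x ?z)"
    "star_mor S L (Ident S x) \<alpha> \<cdot> ?a = ?a"
    "star_mor S L (Ident S x) \<alpha> \<cdot> ?b = ?b \<cdot> \<alpha>"
    "?s \<cdot> sum_mor S L (Ident S x) \<alpha> = star_mor S L (Ident S x) \<alpha> \<cdot> ?s" if "\<alpha> \<in> Aut S ?z" for \<alpha>
    using star_mor[OF L Mor_Ident[OF xO] x that z] xO by simp_all
  note sum = sum_Ident_Mor[OF L x]
  have push: "\<exists>!m. m \<in> Mor S (star_ob L x ?z) (star_ob L x ?z) \<and> m \<cdot> ?s = ?s \<cdot> n \<and> m \<cdot> ?a = ?a"
    if n: "n \<in> Aut S x" "n \<cdot> ?l = ?l" for n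
  proof -
    note [simp] = MorD(1-3)[OF n(1)]
    have "(?s \<cdot> n) \<cdot> ?l = ?a \<cdot> ?\<phi>" using n(2) l(2) by simp
    then show ?thesis
      by (rule torsor_pushout[OF L l(1) \<phi> a(3,1) l(2) Over_comp_Mor[OF a(3) n(1)] a(1)])
  qed
  have mem: "sum_mor S L (Ident S x) \<alpha> \<in> A_ext S c x (Ident S (restr_ob S c x))" if \<alpha>: "\<alpha> \<in> Aut S ?z" for \<alpha>
  proof -
    note st = star[OF \<alpha>]
    note [simp] = MorD(1-3)[OF sum[OF \<alpha>]] MorD(1-3)[OF st(1)]
    have "sum_mor S L (Ident S x) \<alpha> \<cdot> ?l = ?l"
    proof (rule cancel[OF a(3) Mor_comp_Over[OF l(1) sum[OF \<alpha>]] l(1)])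
      have "?s \<cdot> sum_mor S L (Ident S x) \<alpha> \<cdot> ?l = star_mor S L (Ident S x) \<alpha> \<cdot> ?s \<cdot> ?l"
        using comp_eq_comp[OF st(4), of ?l] by simp
      also have "\<dots> = (star_mor S L (Ident S x) \<alpha> \<cdot> ?a) \<cdot> ?\<phi>" using l(2) by simp
      also have "\<dots> = ?s \<cdot> ?l" unfolding st(2) using l(2) by simp
      finally show "?s \<cdot> sum_mor S L (Ident S x) \<alpha> \<cdot> ?l = ?s \<cdot> ?l" .
    qed
    then show ?thesis using sum[OF \<alpha>] A_ext_id_iff[OF L x] by simp
  qed
  have inj: "\<alpha> = \<beta>" if \<alpha>: "\<alpha> \<in> Aut S ?z" and \<beta>: "\<beta> \<in> Aut S ?z"
    and eq: "sum_mor S L (Ident S x) \<alpha> = sum_mor S L (Ident S x) \<beta>" for \<alpha> \<beta>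
  proof -
    have "sum_mor S L (Ident S x) \<alpha> \<in> Aut S x" "sum_mor S L (Ident S x) \<alpha> \<cdot> ?l = ?l"
      using mem[OF \<alpha>] A_ext_id_iff[OF L x] by simp_all
    from push[OF this] have "star_mor S L (Ident S x) \<alpha> = star_mor S L (Ident S x) \<beta>"
      using star[OF \<alpha>] star[OF \<beta>] eq by metis
    then have "?b \<cdot> \<alpha> = ?b \<cdot> \<beta>" using star(3)[OF \<alpha>] star(3)[OF \<beta>] by simp
    then show ?thesis using cancel[OF a(2)] \<alpha> \<beta> by (simp add: Mor_iff)
  qed
  have surj: "\<exists>\<alpha>\<in>Aut S ?z. n = sum_mor S L (Ident S x) \<alpha>"
    if n: "n \<in> A_ext S c x (Ident S (restr_ob S c x))" for n
  proof -
    have n: "n \<in> Aut S x" "n \<cdot> ?l = ?l" using n A_ext_id_iff[OF L x] by simp_all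
    obtain m where m: "m \<in> Mor S (star_ob L x ?z) (star_ob L x ?z)" "m \<cdot> ?s = ?s \<cdot> n" "m \<cdot> ?a = ?a"
      using push[OF n] by blast
    obtain \<alpha> where \<alpha>: "\<alpha> \<in> Aut S ?z" "?b \<cdot> \<alpha> = m \<cdot> ?b"
      using Mor_factor[OF a(2) Mor_comp_Over[OF a(2) m(1)]] .
    have "sum_rel L L (Ident S x) \<alpha> n"
      unfolding sum_rel_def using m \<alpha> n MorD(1-3)[OF m(1)] MorD(1-3)[OF \<alpha>(1)] xO sx
      by (intro exI[of _ m]) (simp add: Mor_iff)
    then have "sum_mor S L (Ident S x) \<alpha> = n"
      by (rule sum_mor_eqI[OF L Mor_Ident[OF xO] x \<alpha>(1) z])
    then show ?thesis using \<alpha>(1) by blast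
  qed
  show ?thesis
    unfolding bij_betw_def inj_on_def using mem inj surj by blast
qed

lemma A_ext_id_group: 
  assumes c: "arr c" and x: "x \<in> Fib S (asrc c)"
  shows "group (A_ext_id_group S c x)"
proof -
  let ?p = "pullback S c x"
  note p = pullback(1)[OF c x]
  note [simp] = OverD(1-3)[OF p]
  have xO: "x \<in> Obj S" using x by (simp add: Fib_iff)
  have iff: "n \<in> A_ext S c x (Ident S (restr_ob S c x)) \<longleftrightarrow> n \<in> Aut S x \<and> n \<cdot> ?p = ?p" for n
    using restr_mor_iff[OF _ p refl, of n] by (auto simp: A_ext_def)
  show ?thesis
  proof (rule groupI)
    fix n assume "n \<in> carrier (A_ext_id_group S c x)"
    then have n: "n \<in> Aut S x" "n \<cdot> ?p = ?p" by (simp_all add: A_ext_id_group_def iff)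
    obtain k where k: "k \<in> Aut S x" "k \<cdot> n = Ident S x" using Mor_inverse[OF n(1)] by metis
    have "k \<cdot> ?p = (k \<cdot> n) \<cdot> ?p" using n(2) MorD(1-3)[OF n(1)] MorD(1-3)[OF k(1)] by simp
    then have "k \<cdot> ?p = ?p" unfolding k(2) by simp
    then show "\<exists>k\<in>carrier (A_ext_id_group S c x). k \<otimes>\<^bsub>A_ext_id_group S c x\<^esub> n = \<one>\<^bsub>A_ext_id_group S c x\<^esub>"
      using k by (auto simp: A_ext_id_group_def iff)
  next
    fix m n assume "m \<in> carrier (A_ext_id_group S c x)" "n \<in> carrier (A_ext_id_group S c x)"
    then have m: "m \<in> Aut S x" "m \<cdot> ?p = ?p" and n: "n \<in> Aut S x" "n \<cdot> ?p = ?p"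
      by (simp_all add: A_ext_id_group_def iff)
    then show "m \<otimes>\<^bsub>A_ext_id_group S c x\<^esub> n \<in> carrier (A_ext_id_group S c x)"
      using Mor_comp[OF n(1) m(1)] MorD(1-3)[OF n(1)] MorD(1-3)[OF m(1)]
      by (simp add: A_ext_id_group_def iff)
  qed (use xO in \<open>auto simp: A_ext_id_group_def iff Mor_Ident MorD\<close>)
qed

lemma sum_Ident_iso:
  assumes L: "small_law c V j L" and L0: "sqz_law K S V L0" and x: "x \<in> Fib S (asrc c)"
  shows "(\<lambda>\<alpha>. sum_mor S L (Ident S x) \<alpha>) \<in> iso (A_group K S V L0) (A_ext_id_group S c x)"
  using sum_Ident_bij[OF L x] sum_Ident_comp[OF L x] sum_mor_zeta[OF lawD(2,3)[OF L] L0]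
    bij_betwE[OF sum_Ident_bij[OF L x]]
  by (auto simp: iso_def hom_def A_group_def A_ext_id_group_def)

lemma A_ext_pseudotorsor:
  assumes L: "small_law c V j L" and L0: "sqz_law K S V L0" and x: "x \<in> Fib S (asrc c)"
    and \<phi>: "\<phi> \<in> Aut S (restr_ob S c x)"
  shows "pseudotorsor (A_group K S V L0) (A_ext S c x \<phi>) (A_act S c L x \<phi>)"
proof -
  note c = lawD(5)[OF L] and V = lawD(2,3)[OF L]
  interpret A: comm_group "A_group K S V L0" by (rule A_comm_group[OF V L0])
  have xO: "x \<in> Obj S" using x by (simp add: Fib_iff)
  have car: "carrier (A_group K S V L0) = Aut S (zeta K S V)" by (simp add: A_group_def)
  let ?i = "\<lambda>\<alpha>. sum_mor S L (Ident S x) \<alpha>"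
  have i: "?i \<alpha> \<in> Aut S x" "restr_mor S c (?i \<alpha>) = Ident S (restr_ob S c x)" if "\<alpha> \<in> Aut S (zeta K S V)" for \<alpha>
    using bij_betwE[OF sum_Ident_bij[OF L x]] that by (auto simp: A_ext_def)
  have act: "A_act S c L x \<phi> \<alpha> n = ?i \<alpha> \<cdot> n" if "n \<in> A_ext S c x \<phi>" for \<alpha> n
    using that by (simp add: A_act_def)
  have closed: "?i \<alpha> \<cdot> n \<in> A_ext S c x \<phi>" if \<alpha>: "\<alpha> \<in> Aut S (zeta K S V)" and n: "n \<in> A_ext S c x \<phi>" for \<alpha> n
  proof -
    have n: "n \<in> Aut S x" "restr_mor S c n = \<phi>" using n by (simp_all add: A_ext_def)
    show ?thesis
      using restr_mor_comp[OF c x n(1) i(1)[OF \<alpha>]] Mor_comp[OF n(1) i(1)[OF \<alpha>]] i(2)[OF \<alpha>] n(2) MorD[OF \<phi>]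
      by (simp add: A_ext_def)
  qed
  show ?thesis
  proof (rule pseudotorsorI[OF A.is_group], unfold car)
    show "A_act S c L x \<phi> \<alpha> \<in> extensional (A_ext S c x \<phi>)" for \<alpha> by (simp add: A_act_def)
    show "A_act S c L x \<phi> \<alpha> n \<in> A_ext S c x \<phi>" if "\<alpha> \<in> Aut S (zeta K S V)" "n \<in> A_ext S c x \<phi>" for \<alpha> n
      using closed that act by simp
    show "A_act S c L x \<phi> (\<alpha> \<otimes>\<^bsub>A_group K S V L0\<^esub> \<beta>) n = A_act S c L x \<phi> \<alpha> (A_act S c L x \<phi> \<beta> n)"
      if \<alpha>: "\<alpha> \<in> Aut S (zeta K S V)" and \<beta>: "\<beta> \<in> Aut S (zeta K S V)" and n: "n \<in> A_ext S c x \<phi>" for \<alpha> \<beta> n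
    proof -
      have nA: "n \<in> Aut S x" using n by (simp add: A_ext_def)
      have "\<alpha> \<otimes>\<^bsub>A_group K S V L0\<^esub> \<beta> = \<alpha> \<cdot> \<beta>" using sum_mor_zeta[OF V L0 \<alpha> \<beta>] by (simp add: A_group_def)
      then show ?thesis
        using act[OF n] act[OF closed[OF \<beta> n]] sum_Ident_comp[OF L x \<alpha> \<beta>]
          MorD(1-3)[OF nA] MorD(1-3)[OF i(1)[OF \<alpha>]] MorD(1-3)[OF i(1)[OF \<beta>]] by simp
    qed
    show "A_act S c L x \<phi> \<one>\<^bsub>A_group K S V L0\<^esub> n = n" if n: "n \<in> A_ext S c x \<phi>" for n
      using act[OF n] lawD(9)[OF L Mor_Ident[OF xO] x] n MorD[of n x x] by (simp add: A_group_def A_ext_def)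
    show "\<alpha> = \<beta>" if \<alpha>: "\<alpha> \<in> Aut S (zeta K S V)" and \<beta>: "\<beta> \<in> Aut S (zeta K S V)" and n: "n \<in> A_ext S c x \<phi>"
      and eq: "A_act S c L x \<phi> \<alpha> n = A_act S c L x \<phi> \<beta> n" for \<alpha> \<beta> n
    proof -
      have nA: "n \<in> Aut S x" using n by (simp add: A_ext_def)
      have "?i \<alpha> = ?i \<beta>"
        by (rule Mor_epi[OF nA])
          (use eq act[OF n] MorD[OF i(1)[OF \<alpha>]] MorD[OF i(1)[OF \<beta>]] in simp_all)
      then show ?thesis
        using sum_Ident_bij[OF L x] \<alpha> \<beta> by (auto simp: bij_betw_def dest: inj_onD)
    qed
    show "\<exists>\<alpha>\<in>Aut S (zeta K S V). A_act S c L x \<phi> \<alpha> m = n"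
      if m: "m \<in> A_ext S c x \<phi>" and n: "n \<in> A_ext S c x \<phi>" for m n
    proof -
      have mA: "m \<in> Aut S x" "restr_mor S c m = \<phi>" and nA: "n \<in> Aut S x" "restr_mor S c n = \<phi>"
        using m n by (simp_all add: A_ext_def)
      obtain k where k: "k \<in> Aut S x" "k \<cdot> m = Ident S x" using Mor_inverse[OF mA(1)] by metis
      note [simp] = MorD(1-3)[OF mA(1)] MorD(1-3)[OF nA(1)] MorD(1-3)[OF k(1)]
      note nk = Mor_comp[OF k(1) nA(1)]
      have nkm: "(n \<cdot> k) \<cdot> m = n" using k(2) by simp
      have r: "restr_mor S c (n \<cdot> k) \<in> Aut S (restr_ob S c x)" using restr_mor(1)[OF c x nk] .
      have "restr_mor S c (n \<cdot> k) \<cdot> \<phi> = Ident S (restr_ob S c x) \<cdot> \<phi>"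
        using restr_mor_comp[OF c x mA(1) nk] nkm mA(2) nA(2) MorD[OF \<phi>] by simp
      then have "restr_mor S c (n \<cdot> k) = Ident S (restr_ob S c x)"
        by (rule Mor_epi[OF \<phi>, rotated -1]) (use MorD[OF r] MorD[OF \<phi>] in simp_all)
      then have "n \<cdot> k \<in> A_ext S c x (Ident S (restr_ob S c x))" using nk by (simp add: A_ext_def)
      then have "n \<cdot> k \<in> ?i ` Aut S (zeta K S V)"
        using bij_betw_imp_surj_on[OF sum_Ident_bij[OF L x]] by simp
      then obtain \<alpha> where \<alpha>: "\<alpha> \<in> Aut S (zeta K S V)" "?i \<alpha> = n \<cdot> k" by force
      have "A_act S c L x \<phi> \<alpha> m = n" unfolding act[OF m] \<alpha>(2) by (rule nkm)
      then show ?thesis using \<alpha>(1) by blast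
    qed
  qed
qed

section \<open>Functoriality\<close>

text \<open>
  \<open>(id + \<alpha>) \<circ> (f + g) = f + \<alpha> g = f + g \<beta> = (f + g) \<circ> (id + \<beta>)\<close>.  The chosen sum \<open>f + g\<close> is in
  general not \<open>f\<close>, but only \<open>f\<close> up to an automorphism \<open>\<gamma>\<close> of its source; the normalization
  \<open>\<gamma> + id = \<gamma>\<close> of the laws makes this discrepancy harmless.
\<close>

lemma sum_Ident_natural:
  assumes L: "small_law c V j L" and M: "small_law d W i M"
    and f: "f \<in> Over S h x' x" and h: "asrc h = asrc c" "atgt h = asrc d"
    and g: "g \<in> Over S (sqz_map K V W \<psi>) (zeta K S W) (zeta K S V)" and \<psi>: "linear_map K V W \<psi>"
    and compat: "\<And>v. v \<in> carrier V \<Longrightarrow> afun h (j v) = i (\<psi> v)"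
    and \<alpha>: "\<alpha> \<in> Aut S (zeta K S V)" and \<beta>: "\<beta> \<in> Aut S (zeta K S W)" and eq: "g \<cdot> \<beta> = \<alpha> \<cdot> g"
  shows "sum_mor S L (Ident S x) \<alpha> \<cdot> f = f \<cdot> sum_mor S M (Ident S x') \<beta>"
proof -
  have x: "x \<in> Fib S (asrc c)" and x': "x' \<in> Fib S (asrc d)" using OverD(10,11)[OF f] h by simp_all
  note z = lawD(7)[OF L] and z' = lawD(7)[OF M]
  have O: "x \<in> Obj S" "x' \<in> Obj S" "zeta K S V \<in> Obj S" "zeta K S W \<in> Obj S"
    using x x' z z' by (simp_all add: Fib_iff)
  note sx = lawD(8)[OF L x] and sx' = lawD(8)[OF M x']
  note [simp] = OverD(1-3)[OF f] OverD(1-3)[OF g] MorD(1-3)[OF \<alpha>] MorD(1-3)[OF \<beta>]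
  obtain N where N: "sum_rel L M f g N" and NO: "N \<in> Over S h x' x"
    using sum_rel_ex[OF L M f h g \<psi> compat] sx sx' by metis
  let ?A = "sum_mor S L (Ident S x) \<alpha>" and ?B = "sum_mor S M (Ident S x') \<beta>"
  note A = sum_Ident_Mor[OF L x \<alpha>] and B = sum_Ident_Mor[OF M x' \<beta>]
  have "sum_rel L M (Ident S x \<cdot> f) (\<alpha> \<cdot> g) (?A \<cdot> N)"
    by (rule sum_rel_comp[OF L L M _ _ _ _ _ _ _ _ _ _ _ _ sum_rel_sum_mor[OF L Mor_Ident[OF O(1)] x \<alpha> z] N])
      (use x x' z z' O in simp_all)
  then have 1: "sum_rel L M f (\<alpha> \<cdot> g) (?A \<cdot> N)" by simp
  have "sum_rel L M (f \<cdot> Ident S x') (g \<cdot> \<beta>) (N \<cdot> ?B)"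
    by (rule sum_rel_comp[OF L M M _ _ _ _ _ _ _ _ _ _ _ _ N sum_rel_sum_mor[OF M Mor_Ident[OF O(2)] x' \<beta> z']])
      (use x x' z z' O in simp_all)
  then have 2: "sum_rel L M f (\<alpha> \<cdot> g) (N \<cdot> ?B)" using eq by simp
  have N_eq: "?A \<cdot> N = N \<cdot> ?B"
    by (rule sum_rel_unique[OF L M _ _ _ _ _ _ 1 2]) (use x x' z z' in simp_all)
  \<comment> \<open>\<open>f\<close> and \<open>N = f + g\<close> differ by \<open>\<gamma> = \<gamma> + id\<close>, which commutes with \<open>id + \<beta>\<close>\<close>
  obtain \<gamma> where \<gamma>: "\<gamma> \<in> Aut S x'" "N \<cdot> \<gamma> = f" using Mor_factor[OF NO f] .
  note [simp] = MorD(1-3)[OF \<gamma>(1)] MorD(1-3)[OF A] MorD(1-3)[OF B] OverD(1-3)[OF NO]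
  note id' = Mor_Ident[OF O(4)]
  have "sum_mor S M \<gamma> (Ident S (zeta K S W)) = \<gamma>" using lawD(9)[OF M \<gamma>(1) x'] .
  then have "\<gamma> \<cdot> ?B = sum_mor S M (\<gamma> \<cdot> Ident S x') (Ident S (zeta K S W) \<cdot> \<beta>)"
    "?B \<cdot> \<gamma> = sum_mor S M (Ident S x' \<cdot> \<gamma>) (\<beta> \<cdot> Ident S (zeta K S W))"
    using sum_mor_comp[OF M \<gamma>(1) Mor_Ident[OF O(2)] x' id' \<beta> z']
      sum_mor_comp[OF M Mor_Ident[OF O(2)] \<gamma>(1) x' \<beta> id' z'] by simp_all
  then have comm: "\<gamma> \<cdot> ?B = ?B \<cdot> \<gamma>" by simp
  have "?A \<cdot> f = ?A \<cdot> N \<cdot> \<gamma>" using \<gamma>(2) by simp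
  also have "\<dots> = N \<cdot> ?B \<cdot> \<gamma>" using comp_eq_comp[OF N_eq, of \<gamma>] by simp
  also have "\<dots> = N \<cdot> \<gamma> \<cdot> ?B" using comm by simp
  also have "\<dots> = f \<cdot> ?B" using comp_assoc[of ?B \<gamma> N] \<gamma>(2) by simp
  finally show ?thesis .
qed

lemma sum_Ident_indep:
  assumes L: "small_law c V j L" and M: "small_law c V j M" and x: "x \<in> Fib S (asrc c)"
    and \<alpha>: "\<alpha> \<in> Aut S (zeta K S V)"
  shows "sum_mor S M (Ident S x) \<alpha> = sum_mor S L (Ident S x) \<alpha>"
proof -
  note V = lawD(2,3)[OF L] and z = lawD(7)[OF L]
  have jA: "j v \<in> carrier (asrc c)" if "v \<in> carrier V" for v
    using kernel_isoD(1)[OF lawD(4)[OF L] that] ker_closed(1)[OF lawD(5)[OF L]] by blast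
  have "Ident S (zeta K S V) \<in> Over S (sqz_map K V V (\<lambda>v. v)) (zeta K S V) (zeta K S V)"
    using Over_Ident[OF z] sqz_map_id[OF V] by simp
  from sum_Ident_natural[OF L M Over_Ident[OF x] _ _ this _ _ \<alpha> \<alpha>] jA
  show ?thesis
    using MorD[OF \<alpha>] MorD[OF sum_Ident_Mor[OF L x \<alpha>]] MorD[OF sum_Ident_Mor[OF M x \<alpha>]]
    by (simp add: linear_map_def)
qed

text \<open>
  As for \<open>T_map_eq\<close>: the restricted class can be computed from any morphism over \<open>h'\<close> compatible
  with the extensions.
\<close>

lemma T_ext_restr_eq:
  assumes d: "arr d" "arr h'" "atgt h' = asrc d" "arr h" and sq: "arr_comp h c = arr_comp d h'"
    and p: "(x, \<phi>) \<in> ext_pairs S c \<eta>" and q: "(x', \<phi>') \<in> ext_pairs S d (restr_ob S h \<eta>)"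
    and h: "asrc h' = asrc c" "asrc h = atgt c"
    and f: "f \<in> Over S h' x' x" and eq: "f \<cdot> \<phi>' = \<phi> \<cdot> pullback S h \<eta>"
  shows "T_ext_restr S d h' h \<eta> (ext_class S c \<eta> (x, \<phi>)) = ext_class S d (restr_ob S h \<eta>) (x', \<phi>')"
proof -
  have \<phi>: "\<phi> \<in> Over S c \<eta> x" and \<phi>': "\<phi>' \<in> Over S d (restr_ob S h \<eta>) x'"
    using p q by (simp_all add: ext_pairs_iff)
  have \<eta>: "\<eta> \<in> Fib S (asrc h)" using OverD(10)[OF \<phi>] h by simp
  note k = pullback(1)[OF d(4) \<eta>]
  have "ext_class S d (restr_ob S h \<eta>) (pair_restr S d h' h \<eta> r) = ext_class S d (restr_ob S h \<eta>) (x', \<phi>')"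
    if "r \<in> ext_class S c \<eta> (x, \<phi>)" for r
  proof -
    obtain y \<chi> where r: "r = (y, \<chi>)" by (metis surj_pair)
    then have \<chi>: "\<chi> \<in> Over S c \<eta> y" and "\<exists>m\<in>Mor S x y. m \<cdot> \<phi> = \<chi>"
      using that by (auto simp: mem_ext_class ext_pairs_iff)
    then obtain m where m: "m \<in> Mor S x y" "m \<cdot> \<phi> = \<chi>" by blast
    have y: "y \<in> Fib S (asrc h')" using OverD(11)[OF \<chi>] h by simp
    note p' = pullback(1)[OF d(2) y]
    let ?y = "restr_ob S h' y" and ?p = "pullback S h' y" and ?k = "pullback S h \<eta>"
    define \<omega> where "\<omega> = factor_thru S d ?p (\<chi> \<cdot> ?k)"
    have \<omega>: "\<omega> \<in> Over S d (restr_ob S h \<eta>) ?y" "?p \<cdot> \<omega> = \<chi> \<cdot> ?k"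
      unfolding \<omega>_def using factor_thru[OF p' Over_comp[OF k \<chi>] d(1)] d sq by simp_all
    have pr: "pair_restr S d h' h \<eta> r = (?y, \<omega>)" by (simp add: pair_restr_def r \<omega>_def)
    obtain n where n: "n \<in> Mor S x' ?y" "?p \<cdot> n = m \<cdot> f"
      using Mor_factor[OF p' Mor_comp_Over[OF f m(1)]] .
    note [simp] = OverD(1-3)[OF \<phi>] OverD(1-3)[OF \<phi>'] OverD(1-3)[OF k] OverD(1-3)[OF \<chi>] OverD(1-3)[OF p']
      OverD(1-3)[OF \<omega>(1)] OverD(1-3)[OF f] MorD(1-3)[OF m(1)] MorD(1-3)[OF n(1)]
    have "n \<cdot> \<phi>' = \<omega>"
    proof (rule cancel[OF p' Mor_comp_Over[OF \<phi>' n(1)] \<omega>(1)])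
      have "?p \<cdot> n \<cdot> \<phi>' = m \<cdot> f \<cdot> \<phi>'" using comp_eq_comp[OF n(2), of \<phi>'] by simp
      also have "\<dots> = (m \<cdot> \<phi>) \<cdot> ?k" using eq by simp
      also have "\<dots> = ?p \<cdot> \<omega>" unfolding m(2) using \<omega>(2) by simp
      finally show "?p \<cdot> n \<cdot> \<phi>' = ?p \<cdot> \<omega>" .
    qed
    then show ?thesis
      unfolding pr using ext_class_eqI[OF q, of n "(?y, \<omega>)"] n(1) by simp
  qed
  then show ?thesis
    unfolding T_ext_restr_def using self_in_ext_class[OF p] by blast
qed

lemma T_act_natural:
  assumes L: "small_law c V j L" and M: "small_law d W i M"
    and h': "arr h'" "asrc h' = asrc c" "atgt h' = asrc d"
    and h: "arr h" "asrc h = atgt c" "atgt h = atgt d" and sq: "arr_comp h c = arr_comp d h'"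
    and \<psi>: "linear_map K V W \<psi>" and compat: "\<And>v. v \<in> carrier V \<Longrightarrow> afun h' (j v) = i (\<psi> v)"
    and P: "P \<in> T_ext S c \<eta>" and t: "t \<in> iso_class S ` Fib S (sqz K V)"
  shows "T_ext_restr S d h' h \<eta> P \<in> T_ext S d (restr_ob S h \<eta>)"
    "T_map K S V W \<psi> t \<in> iso_class S ` Fib S (sqz K W)"
    "T_ext_restr S d h' h \<eta> (T_act S c L \<eta> t P) =
      T_act S d M (restr_ob S h \<eta>) (T_map K S V W \<psi> t) (T_ext_restr S d h' h \<eta> P)"
proof -
  note V = lawD(2,3)[OF L] and W = lawD(2,3)[OF M] and d = lawD(5)[OF M]
  obtain y y' g where y: "t = iso_class S y" "y \<in> Fib S (sqz K V)" "y' \<in> Fib S (sqz K W)"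
    "g \<in> Over S (sqz_map K V W \<psi>) y' y" "T_map K S V W \<psi> t = iso_class S y'"
    by (rule T_map_ex[OF sqz_map_arr[OF V W \<psi>] t])
  then show "T_map K S V W \<psi> t \<in> iso_class S ` Fib S (sqz K W)" by simp
  obtain p where p: "p \<in> ext_pairs S c \<eta>" "P = ext_class S c \<eta> p" using P by (auto simp: T_ext_def)
  obtain x \<phi> where p_eq: "p = (x, \<phi>)" by (metis surj_pair)
  have \<phi>: "\<phi> \<in> Over S c \<eta> x" using p p_eq by (simp add: ext_pairs_iff)
  have x: "x \<in> Fib S (asrc h')" and \<eta>: "\<eta> \<in> Fib S (asrc h)" using OverD(10,11)[OF \<phi>] h h' by simp_all
  note f = pullback(1)[OF h'(1) x] and k = pullback(1)[OF h(1) \<eta>]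
  let ?f = "pullback S h' x" and ?x = "restr_ob S h' x" and ?k = "pullback S h \<eta>"
  obtain \<phi>' where \<phi>': "\<phi>' \<in> Over S d (restr_ob S h \<eta>) ?x" "?f \<cdot> \<phi>' = \<phi> \<cdot> ?k"
    by (rule lift[OF f Over_comp[OF k \<phi>] d]) (use h' sq in simp_all)
  have q: "(?x, \<phi>') \<in> ext_pairs S d (restr_ob S h \<eta>)" using \<phi>' by (simp add: ext_pairs_iff)
  have R: "T_ext_restr S d h' h \<eta> P = ext_class S d (restr_ob S h \<eta>) (?x, \<phi>')"
    unfolding p(2) p_eq using T_ext_restr_eq[OF d h'(1,3) h(1) sq _ q h'(2) h(2) f \<phi>'(2)] p p_eq by simp
  then show "T_ext_restr S d h' h \<eta> P \<in> T_ext S d (restr_ob S h \<eta>)" using q by (simp add: T_ext_def)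
  obtain n where n: "sum_rel L M ?f g n" "n \<in> Over S h' (sum_ob M ?x y') (sum_ob L x y)"
    by (rule sum_rel_ex[OF L M f h'(2,3) y(4) \<psi> compat])
  have leg: "n \<cdot> leg d M ?x \<phi>' y' = leg c L x \<phi> y \<cdot> ?k"
    by (rule sum_rel_leg[OF L M f OverD(1-3)[OF y(4)] y(3,2) n(1) \<phi> \<phi>'(1) OverD(1-3)[OF k] \<phi>'(2)])
  have "T_ext_restr S d h' h \<eta> (ext_class S c \<eta> (pair_sum S c L p y)) =
      ext_class S d (restr_ob S h \<eta>) (pair_sum S d M (?x, \<phi>') y')"
    using T_ext_restr_eq[OF d h'(1,3) h(1) sq _ _ h'(2) h(2) n(2) leg] pair_sum_ext[OF L p(1) y(2)]
      pair_sum_ext[OF M q y(3)] by (simp add: pair_sum_eq p_eq)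
  then show "T_ext_restr S d h' h \<eta> (T_act S c L \<eta> t P) =
      T_act S d M (restr_ob S h \<eta>) (T_map K S V W \<psi> t) (T_ext_restr S d h' h \<eta> P)"
    using T_act_class[OF L p(1) y(2)] T_act_class[OF M q y(3)] R y(5) by (simp only: y(1) p(2))
qed

lemma A_act_natural:
  assumes L: "small_law c V j L" and M: "small_law d W i M"
    and h': "arr h'" "asrc h' = asrc c" "atgt h' = asrc d"
    and h: "arr h" "asrc h = atgt c" "atgt h = atgt d" and sq: "arr_comp h c = arr_comp d h'"
    and \<psi>: "linear_map K V W \<psi>" and compat: "\<And>v. v \<in> carrier V \<Longrightarrow> afun h' (j v) = i (\<psi> v)"
    and x: "x \<in> Fib S (asrc c)" and \<phi>: "\<phi> \<in> Aut S (restr_ob S c x)" and n: "n \<in> A_ext S c x \<phi>"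
    and \<alpha>: "\<alpha> \<in> Aut S (zeta K S V)"
  shows "restr_mor S h' n \<in> A_ext S d (restr_ob S h' x) (aut_restr S c d h' h x \<phi>)"
    "A_map K S V W \<psi> \<alpha> \<in> Aut S (zeta K S W)"
    "restr_mor S h' (A_act S c L x \<phi> \<alpha> n) =
      A_act S d M (restr_ob S h' x) (aut_restr S c d h' h x \<phi>) (A_map K S V W \<psi> \<alpha>) (restr_mor S h' n)"
proof -
  note V = lawD(2,3)[OF L] and W = lawD(2,3)[OF M] and c = lawD(5)[OF L] and d = lawD(5)[OF M]
  have xh: "x \<in> Fib S (asrc h')" using x h' by simp
  note f = pullback[OF h'(1) xh] and p = pullback[OF c x]
  let ?f = "pullback S h' x" and ?x = "restr_ob S h' x" and ?p = "pullback S c x"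
  have x': "?x \<in> Fib S (asrc d)" using f(2) h' by simp
  note q = pullback[OF d x']
  let ?q = "pullback S d ?x"
  have nA: "n \<in> Aut S x" and nr: "restr_mor S c n = \<phi>" using n by (simp_all add: A_ext_def)
  note r = restr_mor[OF h'(1) xh nA] note s = restr_mor[OF d x' r(1)]
  note t = restr_mor(2)[OF c x nA, unfolded nr]
  let ?r = "restr_mor S h' n" and ?s = "restr_mor S d (restr_mor S h' n)"
  define u where "u = factor_thru S h ?p (?f \<cdot> ?q)"
  have u: "u \<in> Over S h (restr_ob S d ?x) (restr_ob S c x)" "?p \<cdot> u = ?f \<cdot> ?q"
    unfolding u_def using factor_thru[OF p(1) Over_comp[OF q(1) f(1)] h(1)] h sq by simp_all
  note [simp] = OverD(1-3)[OF f(1)] OverD(1-3)[OF p(1)] OverD(1-3)[OF q(1)] OverD(1-3)[OF u(1)]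
    MorD(1-3)[OF nA] MorD(1-3)[OF \<phi>] MorD(1-3)[OF r(1)] MorD(1-3)[OF s(1)]
  have "u \<cdot> ?s = \<phi> \<cdot> u"
  proof (rule cancel[OF p(1) Over_comp_Mor[OF u(1) s(1)] Mor_comp_Over[OF u(1) \<phi>]])
    have "?p \<cdot> u \<cdot> ?s = ?f \<cdot> ?q \<cdot> ?s" using comp_eq_comp[OF u(2), of ?s] by simp
    also have "\<dots> = ?f \<cdot> ?r \<cdot> ?q" using s(2) by simp
    also have "\<dots> = n \<cdot> ?f \<cdot> ?q" using comp_eq_comp[OF r(2), of ?q] by simp
    also have "\<dots> = n \<cdot> ?p \<cdot> u" using u(2) by simp
    also have "\<dots> = ?p \<cdot> \<phi> \<cdot> u" using comp_eq_comp[OF t, of u] by simp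
    finally show "?p \<cdot> u \<cdot> ?s = ?p \<cdot> \<phi> \<cdot> u" .
  qed
  then have "aut_restr S c d h' h x \<phi> = ?s"
    unfolding aut_restr_def u_def[symmetric] Let_def by (rule restr_along_eqI[OF u(1) u(1) \<phi> s(1)])
  then show mem: "?r \<in> A_ext S d ?x (aut_restr S c d h' h x \<phi>)"
    using r(1) by (simp add: A_ext_def)
  note A = A_map[OF V W \<psi> \<alpha>]
  show "A_map K S V W \<psi> \<alpha> \<in> Aut S (zeta K S W)" by (rule A)
  let ?A = "sum_mor S L (Ident S x) \<alpha>" and ?B = "sum_mor S M (Ident S ?x) (A_map K S V W \<psi> \<alpha>)"
  have "?A \<cdot> ?f = ?f \<cdot> ?B"
    by (rule sum_Ident_natural[OF L M f(1) h'(2,3) zeta_arr(1)[OF V W \<psi>] \<psi> compat \<alpha> A])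
  then have "restr_mor S h' ?A = ?B"
    using restr_mor(3)[OF h'(1) xh sum_Ident_Mor[OF L x \<alpha>] sum_Ident_Mor[OF M x' A(1)]] by simp
  then have "restr_mor S h' (?A \<cdot> n) = ?B \<cdot> ?r"
    using restr_mor_comp[OF h'(1) xh nA sum_Ident_Mor[OF L x \<alpha>]] by simp
  then show "restr_mor S h' (A_act S c L x \<phi> \<alpha> n) =
      A_act S d M ?x (aut_restr S c d h' h x \<phi>) (A_map K S V W \<psi> \<alpha>) ?r"
    using n mem by (simp add: A_act_def)
qed

end

section \<open>The theorem\<close>

theorem theorem2p4p3:
  fixes \<Lambda> :: "'l ring" and K :: "('l, 'r) alg" and S :: "('l, 'r, 'o, 'm) stack"
    and c :: "('l, 'r) alg_arr"
  assumes "infinite (UNIV :: 'r set)"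
    and "coefficient_ring \<Lambda> K"
    and "deformation_stack \<Lambda> K S"
    and "small_extension \<Lambda> K c"
  shows
    \<comment> \<open>(1)\<close>
    "((\<forall>V L. fd_space K V \<longrightarrow> sqz_law K S V L \<longrightarrow>
        comm_group (T_group K S V L) \<and>
        (\<forall>x\<in>Fib S (sqz K V). \<forall>y\<in>Fib S (sqz K V).
          iso_class S x \<otimes>\<^bsub>T_group K S V L\<^esub> iso_class S y = iso_class S (sum_ob L x y)) \<and>
        comm_group (A_group K S V L) \<and>
        (\<forall>\<alpha>\<in>Aut S (zeta K S V). \<forall>\<beta>\<in>Aut S (zeta K S V).
          \<alpha> \<otimes>\<^bsub>A_group K S V L\<^esub> \<beta> = Comp S \<alpha> \<beta>) \<and>
        (\<forall>L'. sqz_law K S V L' \<longrightarrow>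
          (\<forall>P\<in>carrier (T_group K S V L). \<forall>Q\<in>carrier (T_group K S V L).
            P \<otimes>\<^bsub>T_group K S V L'\<^esub> Q = P \<otimes>\<^bsub>T_group K S V L\<^esub> Q) \<and>
          (\<forall>\<alpha>\<in>carrier (A_group K S V L). \<forall>\<beta>\<in>carrier (A_group K S V L).
            \<alpha> \<otimes>\<^bsub>A_group K S V L'\<^esub> \<beta> = \<alpha> \<otimes>\<^bsub>A_group K S V L\<^esub> \<beta>))) \<and>
      (\<forall>V W \<psi> L M. fd_space K V \<longrightarrow> fd_space K W \<longrightarrow> linear_map K V W \<psi> \<longrightarrow>
        sqz_law K S V L \<longrightarrow> sqz_law K S W M \<longrightarrow>
        T_map K S V W \<psi> \<in> hom (T_group K S V L) (T_group K S W M) \<and>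
        A_map K S V W \<psi> \<in> hom (A_group K S V L) (A_group K S W M)) \<and>
      (\<forall>V. fd_space K V \<longrightarrow>
        (\<forall>P\<in>iso_class S ` Fib S (sqz K V). T_map K S V V (\<lambda>v. v) P = P) \<and>
        (\<forall>\<alpha>\<in>Aut S (zeta K S V). A_map K S V V (\<lambda>v. v) \<alpha> = \<alpha>)) \<and>
      (\<forall>U V W \<psi> \<chi>. fd_space K U \<longrightarrow> fd_space K V \<longrightarrow> fd_space K W \<longrightarrow>
        linear_map K U V \<psi> \<longrightarrow> linear_map K V W \<chi> \<longrightarrow>
        (\<forall>P\<in>iso_class S ` Fib S (sqz K U).
          T_map K S U W (\<chi> \<circ> \<psi>) P = T_map K S V W \<chi> (T_map K S U V \<psi> P)) \<and>
        (\<forall>\<alpha>\<in>Aut S (zeta K S U).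
          A_map K S U W (\<chi> \<circ> \<psi>) \<alpha> = A_map K S V W \<chi> (A_map K S U V \<psi> \<alpha>))))
     \<and>
     \<comment> \<open>(2)\<close>
     (\<forall>\<eta>\<in>Fib S (atgt c). \<forall>L0 L. sqz_law K S (ker_space c) L0 \<longrightarrow> ext_law K S c L \<longrightarrow>
        pseudotorsor (T_group K S (ker_space c) L0) (T_ext S c \<eta>) (T_act S c L \<eta>) \<and>
        (\<forall>p\<in>ext_pairs S c \<eta>. \<forall>y\<in>Fib S (sqz K (ker_space c)).
          T_act S c L \<eta> (iso_class S y) (ext_class S c \<eta> p) =
            ext_class S c \<eta> (pair_sum S c L p y)) \<and>
        (\<forall>L'. ext_law K S c L' \<longrightarrow>
          (\<forall>t\<in>carrier (T_group K S (ker_space c) L0). T_act S c L' \<eta> t = T_act S c L \<eta> t)))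
     \<and>
     \<comment> \<open>(3)\<close>
     (\<forall>\<eta>'\<in>Fib S (asrc c). \<forall>L0 L. sqz_law K S (ker_space c) L0 \<longrightarrow> ext_law K S c L \<longrightarrow>
        group (A_ext_id_group S c \<eta>') \<and>
        (\<lambda>\<alpha>. sum_mor S L (Ident S \<eta>') \<alpha>)
          \<in> iso (A_group K S (ker_space c) L0) (A_ext_id_group S c \<eta>') \<and>
        (\<forall>L'. ext_law K S c L' \<longrightarrow>
          (\<forall>\<alpha>\<in>Aut S (zeta K S (ker_space c)).
            sum_mor S L' (Ident S \<eta>') \<alpha> = sum_mor S L (Ident S \<eta>') \<alpha>)) \<and>
        (\<forall>\<phi>\<in>Aut S (restr_ob S c \<eta>').
          pseudotorsor (A_group K S (ker_space c) L0) (A_ext S c \<eta>' \<phi>) (A_act S c L \<eta>' \<phi>)))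
     \<and>
     \<comment> \<open>(4)\<close>
     (\<forall>d h'. small_extension \<Lambda> K d \<longrightarrow> h' \<in> Homs (art \<Lambda> K) (asrc c) (asrc d) \<longrightarrow>
        afun h' ` arr_ker c \<subseteq> arr_ker d \<longrightarrow>
        (\<exists>!h. h \<in> Homs (art \<Lambda> K) (atgt c) (atgt d) \<and> arr_comp h c = arr_comp d h') \<and>
        (\<forall>h L M. h \<in> Homs (art \<Lambda> K) (atgt c) (atgt d) \<longrightarrow> arr_comp h c = arr_comp d h' \<longrightarrow>
          ext_law K S c L \<longrightarrow> ext_law K S d M \<longrightarrow>
          (\<forall>\<eta>\<in>Fib S (atgt c). \<forall>P\<in>T_ext S c \<eta>. \<forall>t\<in>iso_class S ` Fib S (sqz K (ker_space c)).
            T_ext_restr S d h' h \<eta> P \<in> T_ext S d (restr_ob S h \<eta>) \<and>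
            T_map K S (ker_space c) (ker_space d) (afun h') t
              \<in> iso_class S ` Fib S (sqz K (ker_space d)) \<and>
            T_ext_restr S d h' h \<eta> (T_act S c L \<eta> t P) =
              T_act S d M (restr_ob S h \<eta>) (T_map K S (ker_space c) (ker_space d) (afun h') t)
                (T_ext_restr S d h' h \<eta> P)) \<and>
          (\<forall>\<eta>'\<in>Fib S (asrc c). \<forall>\<phi>\<in>Aut S (restr_ob S c \<eta>'). \<forall>\<phi>'\<in>A_ext S c \<eta>' \<phi>.
            \<forall>\<alpha>\<in>Aut S (zeta K S (ker_space c)).
            restr_mor S h' \<phi>' \<in> A_ext S d (restr_ob S h' \<eta>') (aut_restr S c d h' h \<eta>' \<phi>) \<and>
            A_map K S (ker_space c) (ker_space d) (afun h') \<alpha> \<in> Aut S (zeta K S (ker_space d)) \<and>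
            restr_mor S h' (A_act S c L \<eta>' \<phi> \<alpha> \<phi>') =
              A_act S d M (restr_ob S h' \<eta>') (aut_restr S c d h' h \<eta>' \<phi>)
                (A_map K S (ker_space c) (ker_space d) (afun h') \<alpha>) (restr_mor S h' \<phi>'))))"
proof -
  interpret deformation \<Lambda> K S
    using assms by unfold_locales
  note ker = module_ker_space[OF assms(4)] art_alg_sqz_ker[OF assms(4)] and law_c = law_ext[OF assms(4)]
  have fd: "module K V" "art_alg \<Lambda> K (sqz K V)" if "fd_space K V" for V
    using that art_alg_sqz_fd by (simp_all add: fd_space_def)
  have A_mult: "\<alpha> \<otimes>\<^bsub>A_group K S V L\<^esub> \<beta> = Comp S \<alpha> \<beta>"
    if "fd_space K V" "sqz_law K S V L" "\<alpha> \<in> Aut S (zeta K S V)" "\<beta> \<in> Aut S (zeta K S V)" for V L \<alpha> \<beta>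
    using sum_mor_zeta[OF fd[OF that(1)] that(2-4)] by (simp add: A_group_def)
  have A_car: "carrier (A_group K S V L) = Aut S (zeta K S V)"
    and T_car: "carrier (T_group K S V L) = iso_class S ` Fib S (sqz K V)" for V L
    by (simp_all add: A_group_def T_group_def)
  \<comment> \<open>a map of small extensions induces a linear map of the kernels\<close>
  have nat: "arr h' \<and> asrc h' = asrc c \<and> atgt h' = asrc d \<and> arr h \<and> asrc h = atgt c \<and> atgt h = atgt d \<and>
      linear_map K (ker_space c) (ker_space d) (afun h')"
    if "small_extension \<Lambda> K d" "h' \<in> Homs (art \<Lambda> K) (asrc c) (asrc d)" "afun h' ` arr_ker c \<subseteq> arr_ker d"
      "h \<in> Homs (art \<Lambda> K) (atgt c) (atgt d)" for d h' h
    using that linear_map_ker_space[OF assms(4) that(1) _ _ _ that(3)] by (simp add: Homs_art)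
  show ?thesis
    apply (intro conjI allI impI ballI)
    subgoal using T_comm_group fd by blast
    subgoal using T_mult[OF law_sqz] fd by blast
    subgoal using A_comm_group fd by blast
    subgoal using A_mult by blast
    subgoal using T_mult_indep fd by blast
    subgoal unfolding A_car using A_mult by simp
    subgoal using T_map_hom fd by blast
    subgoal using A_map_hom fd by blast
    subgoal using T_A_map_id(1) fd by blast
    subgoal using T_A_map_id(2) fd by blast
    subgoal using T_A_map_comp(1) fd by blast
    subgoal using T_A_map_comp(2) fd by blast
    subgoal using T_ext_pseudotorsor[OF law_c] by blast
    subgoal using T_act_class[OF law_c] by blast
    subgoal unfolding T_car using T_act_indep[OF law_c law_c] by blast
    subgoal using A_ext_id_group[OF small_extensionD(1)[OF assms(4)]] by blast
    subgoal using sum_Ident_iso[OF law_c] by blast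
    subgoal using sum_Ident_indep[OF law_c law_c] by blast
    subgoal using A_ext_pseudotorsor[OF law_c] by blast
    subgoal using induced_arrow[OF assms(4)] by blast
    subgoal for d h' h L M
      using T_act_natural(1)[OF law_c law_ext, where h' = h' and h = h and \<psi> = "afun h'"] nat[of d h' h] by auto
    subgoal for d h' h L M
      using T_act_natural(2)[OF law_c law_ext, where h' = h' and h = h and \<psi> = "afun h'"] nat[of d h' h] by auto
    subgoal for d h' h L M
      using T_act_natural(3)[OF law_c law_ext, where h' = h' and h = h and \<psi> = "afun h'"] nat[of d h' h] by auto
    subgoal for d h' h L M
      using A_act_natural(1)[OF law_c law_ext, where h' = h' and h = h and \<psi> = "afun h'"] nat[of d h' h] by auto
    subgoal for d h' h L M
      using A_act_natural(2)[OF law_c law_ext, where h' = h' and h = h and \<psi> = "afun h'"] nat[of d h' h] by auto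
    subgoal for d h' h L M
      using A_act_natural(3)[OF law_c law_ext, where h' = h' and h = h and \<psi> = "afun h'"] nat[of d h' h] by auto
    done
qed

end
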